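(* Let $\Omega\subset\mathbb R^n$ be a Borel set with $|\Omega|<+\infty$. Suppose that for some $p>n/2$ (when $n=1$, for $p=1$) we have, for $1\le i\le N$, $f_i\in L^p(\Omega)$, $f_i(x)\ge0$ almost everywhere, and $g_i\in L^p(\Omega)$. Suppose that the functional $F:\mathcal W(\Omega)\to\mathbb R$ is bounded, and that $(\mathbf u,\mathbf W)$ is a minimizer for $J$ in $\mathcal F(\Omega)$. Then $\mathbf u$ is bounded, and $\|u_i\|_\infty\le C$ for $1\le i\le N$, where $C$ depends only on $n$, $N$, $p$, a bound for $|F|$, $|\Omega|$, and the norms $\|g_i\|_{L^p(\Omega)}$.
   Context: $n\ge1$ and $N\ge1$ are integers; $|A|$ is the Lebesgue measure of $A$. $W^{1,2}(\mathbb R^n)$ denotes the set of functions in $L^2_{loc}(\mathbb R^n)$ whose distributional gradient lies in $L^2(\mathbb R^n)$. $\mathcal W(\Omega)$ is the set of $N$-tuples $\mathbf W=(W_1,\dots,W_N)$ of pairwise disjoint Borel subsets of $\Omega$. $\mathcal F(\Omega)$ is the set of pairs $(\mathbf u,\mathbf W)$ with $\mathbf W\in\mathcal W(\Omega)$ and $\mathbf u=(u_1,\dots,u_N)$ an $N$-tuple of real-valued functions $u_i\in W^{1,2}(\mathbb R^n)$ such that $u_i(x)=0$ for almost every $x\in\mathbb R^n\setminus W_i$. For $(\mathbf u,\mathbf W)\in\mathcal F(\Omega)$, $$J(\mathbf u,\mathbf W)=\sum_{i=1}^N\int|\nabla u_i|^2\,dx+\sum_{i=1}^N\int[u_i^2f_i-u_ig_i]\,dx+F(W_1,\dots,W_N).$$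 A minimizer for $J$ in $\mathcal F(\Omega)$ is a pair $(\mathbf u,\mathbf W)\in\mathcal F(\Omega)$ such that $J(\mathbf u,\mathbf W)\le J(\mathbf u^*,\mathbf W^* )$ for all $(\mathbf u^*,\mathbf W^* )\in\mathcal F(\Omega)$. *)

theory Defs
  imports "HOL-Probability.Essential_Supremum" "HOL-Analysis.Analysis"
begin

definition in_Lp :: "'a measure \<Rightarrow> ennreal \<Rightarrow> ('a \<Rightarrow> real) \<Rightarrow> bool" where
  "in_Lp M p h \<longleftrightarrow> h \<in> borel_measurable M \<and>
     (if p = \<infinity> then esssup M (\<lambda>x. ennreal \<bar>h x\<bar>) < \<infinity>
      else integrable M (\<lambda>x. \<bar>h x\<bar> powr enn2real p))"

text \<open>Only meaningful for \<open>1 \<le> p\<close> and \<open>in_Lp M p h\<close>.\<close>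

definition Lp_norm :: "'a measure \<Rightarrow> ennreal \<Rightarrow> ('a \<Rightarrow> real) \<Rightarrow> real" where
  "Lp_norm M p h =
     (if p = \<infinity> then enn2real (esssup M (\<lambda>x. ennreal \<bar>h x\<bar>))
      else (\<integral>x. \<bar>h x\<bar> powr enn2real p \<partial>M) powr (1 / enn2real p))"

definition in_Lp_loc :: "ennreal \<Rightarrow> (real ^ 'n \<Rightarrow> real) \<Rightarrow> bool" where
  "in_Lp_loc p h \<longleftrightarrow> (\<forall>K. compact K \<longrightarrow> in_Lp (lebesgue_on K) p h)"

definition partial_deriv :: "'n \<Rightarrow> (real ^ 'n \<Rightarrow> real) \<Rightarrow> real ^ 'n \<Rightarrow> real" where
  "partial_deriv j \<phi> x = frechet_derivative \<phi> (at x) (axis j 1)"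

primrec Ck :: "nat \<Rightarrow> (real ^ 'n \<Rightarrow> real) \<Rightarrow> bool" where
  "Ck 0 \<phi> \<longleftrightarrow> continuous_on UNIV \<phi>"
| "Ck (Suc k) \<phi> \<longleftrightarrow> (\<forall>x. \<phi> differentiable (at x)) \<and> (\<forall>j. Ck k (partial_deriv j \<phi>))"

definition test_fun :: "(real ^ 'n \<Rightarrow> real) \<Rightarrow> bool" where
  "test_fun \<phi> \<longleftrightarrow> (\<forall>k. Ck k \<phi>) \<and> compact (closure {x. \<phi> x \<noteq> 0})"

definition is_distr_grad :: "(real ^ 'n \<Rightarrow> real) \<Rightarrow> (real ^ 'n \<Rightarrow> real ^ 'n) \<Rightarrow> bool" where
  "is_distr_grad v D \<longleftrightarrow> (\<forall>j. in_Lp_loc 1 (\<lambda>x. D x $ j)) \<and>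
     (\<forall>\<phi> j. test_fun \<phi> \<longrightarrow>
        (\<integral>x. v x * partial_deriv j \<phi> x \<partial>lebesgue) = - (\<integral>x. D x $ j * \<phi> x \<partial>lebesgue))"

text \<open>A representative of the distributional gradient, which is unique up to a null set.\<close>

definition distr_grad :: "(real ^ 'n \<Rightarrow> real) \<Rightarrow> real ^ 'n \<Rightarrow> real ^ 'n" where
  "distr_grad v = (SOME D. is_distr_grad v D)"

text \<open>Local square integrability of the function is required, but not global: only the gradient
  has to be globally in \<open>L\<^sup>2\<close>.\<close>

definition W12 :: "(real ^ 'n \<Rightarrow> real) set" where
  "W12 = {v. in_Lp_loc 2 v \<and>
     (\<exists>D. is_distr_grad v D \<and> (\<forall>j. in_Lp lebesgue 2 (\<lambda>x. D x $ j)))}"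

text \<open>An \<open>N\<close>-tuple is a family indexed by a finite type \<open>'m\<close> with \<open>CARD('m) = N\<close>.\<close>

definition disjoint_tuples :: "(real ^ 'n) set \<Rightarrow> ('m::finite \<Rightarrow> (real ^ 'n) set) set" where
  "disjoint_tuples \<Omega> = {W. (\<forall>i. W i \<in> sets borel \<and> W i \<subseteq> \<Omega>) \<and> disjoint_family W}"

definition admissible ::
  "(real ^ 'n) set \<Rightarrow> (('m::finite \<Rightarrow> real ^ 'n \<Rightarrow> real) \<times> ('m \<Rightarrow> (real ^ 'n) set)) set" where
  "admissible \<Omega> = {(u, W). W \<in> disjoint_tuples \<Omega> \<and>
     (\<forall>i. u i \<in> W12 \<and> (AE x in lebesgue. x \<notin> W i \<longrightarrow> u i x = 0))}"

text \<open>The data \<open>f i\<close> and \<open>g i\<close> are functions on \<open>\<Omega>\<close>, so the second integral is taken over \<open>\<Omega>\<close>;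
  for admissible pairs \<open>u i\<close> vanishes almost everywhere outside \<open>\<Omega>\<close>.\<close>

definition J_fun ::
  "(real ^ 'n) set \<Rightarrow> ('m::finite \<Rightarrow> real ^ 'n \<Rightarrow> real) \<Rightarrow> ('m \<Rightarrow> real ^ 'n \<Rightarrow> real) \<Rightarrow>
   (('m \<Rightarrow> (real ^ 'n) set) \<Rightarrow> real) \<Rightarrow>
   ('m \<Rightarrow> real ^ 'n \<Rightarrow> real) \<Rightarrow> ('m \<Rightarrow> (real ^ 'n) set) \<Rightarrow> real" where
  "J_fun \<Omega> f g F u W =
     (\<Sum>i\<in>UNIV. \<integral>x. (norm (distr_grad (u i) x))\<^sup>2 \<partial>lebesgue) +
     (\<Sum>i\<in>UNIV. \<integral>x. (u i x)\<^sup>2 * f i x - u i x * g i x \<partial>(lebesgue_on \<Omega>)) +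
     F W"

definition is_minimizer ::
  "(real ^ 'n) set \<Rightarrow> ('m::finite \<Rightarrow> real ^ 'n \<Rightarrow> real) \<Rightarrow> ('m \<Rightarrow> real ^ 'n \<Rightarrow> real) \<Rightarrow>
   (('m \<Rightarrow> (real ^ 'n) set) \<Rightarrow> real) \<Rightarrow>
   ('m \<Rightarrow> real ^ 'n \<Rightarrow> real) \<Rightarrow> ('m \<Rightarrow> (real ^ 'n) set) \<Rightarrow> bool" where
  "is_minimizer \<Omega> f g F u W \<longleftrightarrow> (u, W) \<in> admissible \<Omega> \<and>
     (\<forall>(u', W') \<in> admissible \<Omega>. J_fun \<Omega> f g F u W \<le> J_fun \<Omega> f g F u' W')"

end

theory Submission
  imports Defs
begin

text \<open>
  The bound is De Giorgi's truncation argument combined with Stampacchia's iteration; it works one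
  component at a time and keeps \<open>W\<close> fixed, so that \<open>F\<close> cancels in the comparison.

  Let \<open>u\<close> be a component of the minimizer, \<open>0 < k < h\<close> and \<open>w = min (max (u - k) 0) (h - k)\<close>.
  The competitor \<open>u - w\<close> satisfies \<open>|u - w| \<le> |u|\<close>, so the term with \<open>f\<close> does not increase, while
  \<open>\<integral>|\<nabla>u|\<^sup>2\<close> drops by \<open>\<integral>|\<nabla>w|\<^sup>2\<close>. Hence minimality gives
  \<open>\<integral>|\<nabla>w|\<^sup>2 \<le> \<integral>w g\<close>, and since \<open>w \<le> h - k\<close> vanishes off \<open>A k = {x. k \<le> u x}\<close>, Hoelder's
  inequality bounds the right-hand side by \<open>(h - k) \<parallel>g\<parallel>\<^sub>p |A k|\<^bsup>1 - 1/p\<^esup>\<close>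
  (\<open>truncation_energy_le\<close>, \<open>in_Lp_integral_subset_le\<close>). On the other side, averaging over
  translations shows that a function supported in a set of measure \<open>a\<close> satisfies
  \<open>\<integral>w \<le> C a\<^bsup>1/n\<^esup> \<integral>|\<nabla>w|\<close> (\<open>L1_Faber_Krahn\<close>), and \<open>\<integral>w \<ge> (h - k) |A h|\<close>. Together with the
  Cauchy--Schwarz inequality on \<open>A k\<close> this is the decay estimate \<open>level_set_decay\<close>:
  \<open>(h - k)\<^bsup>1/2\<^esup> |A h| \<le> C |A k|\<^bsup>1+\<beta>\<^esup>\<close> with \<open>\<beta> = 1/n - 1/(2p)\<close>. The hypothesis on \<open>p\<close> says
  exactly that \<open>\<beta> > 0\<close> (it is \<open>1/2\<close> when \<open>n = p = 1\<close>), and then iteration along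
  \<open>k\<^sub>m = K (2 - 2\<^bsup>-m\<^esup>)\<close> gives \<open>|A (2 K)| = 0\<close> for a suitable \<open>K\<close>
  (\<open>stampacchia_iteration\<close>). Replacing \<open>(u, g)\<close> by \<open>(-u, -g)\<close> bounds \<open>u\<close> from below.
  Truncating from above as well, rather than using \<open>max (u - k) 0\<close>, keeps \<open>w\<close> bounded; because
  of this no Sobolev embedding is needed, and one argument covers all \<open>n\<close> and \<open>p\<close>.

  What has to be known about weak derivatives is little. They are unique, because boxes can be
  approximated by test functions (\<open>AE_eq_zero_if_test_integrals_zero\<close>); increments of a function
  are integrals of its weak derivative along segments (\<open>weak_partial_increment\<close>), hence difference
  quotients converge locally in \<open>L\<^sup>1\<close>; and the chain rule for \<open>|u - k|\<close>, of which truncations are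
  linear combinations, follows by passing to the limit in symmetric difference quotients
  (\<open>weak_partial_abs_diff\<close>).
\<close>

section \<open>Smooth bump functions\<close>

lemma Ck_imp_continuous: "Ck k \<phi> \<Longrightarrow> continuous_on UNIV \<phi>"
  by (cases k) (auto simp: differentiable_imp_continuous_within continuous_at_imp_continuous_on)

lemma Ck_Suc_imp_Ck: "Ck (Suc k) \<phi> \<Longrightarrow> Ck k \<phi>"
proof (induction k arbitrary: \<phi>)
  case 0
  then show ?case using Ck_imp_continuous[OF 0] by simp
qed auto

lemma partial_deriv_eq:
  "(\<phi> has_derivative \<phi>') (at x) \<Longrightarrow> partial_deriv j \<phi> x = \<phi>' (axis j 1)"
  unfolding partial_deriv_def by (simp add: frechet_derivative_at[symmetric])

lemma Ck_const: "Ck k (\<lambda>x. c)"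
proof (induction k arbitrary: c)
  case (Suc k)
  have "partial_deriv j (\<lambda>x. c) = (\<lambda>x. 0)" for j :: 'a and c
    by (rule ext, subst partial_deriv_eq[of _ "\<lambda>x. 0"]) auto
  then show ?case using Suc by auto
qed auto

lemma Ck_add:
  "Ck k \<phi> \<Longrightarrow> Ck k \<psi> \<Longrightarrow> Ck k (\<lambda>x. \<phi> x + \<psi> x)"
proof (induction k arbitrary: \<phi> \<psi>)
  case 0
  then show ?case by (auto intro: continuous_intros)
next
  case (Suc k)
  have "partial_deriv j (\<lambda>x. \<phi> x + \<psi> x) x = partial_deriv j \<phi> x + partial_deriv j \<psi> x" for j x
    using Suc.prems
    by (subst partial_deriv_eq[OF has_derivative_add[OF frechet_derivative_works[THEN iffD1]
          frechet_derivative_works[THEN iffD1]]]) (auto simp: partial_deriv_def)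
  then have "partial_deriv j (\<lambda>x. \<phi> x + \<psi> x) = (\<lambda>x. partial_deriv j \<phi> x + partial_deriv j \<psi> x)" for j
    by auto
  then show ?case using Suc by auto
qed

lemma Ck_mult:
  "Ck k \<phi> \<Longrightarrow> Ck k \<psi> \<Longrightarrow> Ck k (\<lambda>x. \<phi> x * \<psi> x)"
proof (induction k arbitrary: \<phi> \<psi>)
  case 0
  then show ?case by (auto intro: continuous_intros)
next
  case (Suc k)
  have "partial_deriv j (\<lambda>x. \<phi> x * \<psi> x) x
      = \<phi> x * partial_deriv j \<psi> x + partial_deriv j \<phi> x * \<psi> x" for j x
    using Suc.prems
    by (subst partial_deriv_eq[OF has_derivative_mult[OF frechet_derivative_works[THEN iffD1]
          frechet_derivative_works[THEN iffD1]]]) (auto simp: partial_deriv_def)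
  then have "partial_deriv j (\<lambda>x. \<phi> x * \<psi> x)
      = (\<lambda>x. \<phi> x * partial_deriv j \<psi> x + partial_deriv j \<phi> x * \<psi> x)" for j
    by auto
  then show ?case
    using Suc Suc.prems[THEN Ck_Suc_imp_Ck] by (auto intro!: Ck_add Suc.IH)
qed

lemma Ck_prod: "finite I \<Longrightarrow> (\<And>i. i \<in> I \<Longrightarrow> Ck k (\<phi> i)) \<Longrightarrow> Ck k (\<lambda>x. \<Prod>i\<in>I. \<phi> i x)"
  by (induction I rule: finite_induct) (auto intro: Ck_const Ck_mult)

lemma Ck_translate: "Ck k \<phi> \<Longrightarrow> Ck k (\<lambda>x. \<phi> (x + h))"
  and partial_deriv_translate:
    "\<phi> differentiable at (x + h) \<Longrightarrow> partial_deriv j (\<lambda>x. \<phi> (x + h)) x = partial_deriv j \<phi> (x + h)"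
proof -
  have *: "((\<lambda>x. \<phi> (x + h)) has_derivative frechet_derivative \<phi> (at (x + h))) (at x)"
    if "\<phi> differentiable at (x + h)" for x and \<phi> :: "real^'a \<Rightarrow> real"
  proof (rule has_derivative_compose[of "\<lambda>x. x + h" "\<lambda>x. x"])
    show "((\<lambda>x. x + h) has_derivative (\<lambda>x. x)) (at x)" by (auto intro!: derivative_eq_intros)
  qed (use that frechet_derivative_works in blast)
  show **: "partial_deriv j (\<lambda>x. \<phi> (x + h)) x = partial_deriv j \<phi> (x + h)"
    if "\<phi> differentiable at (x + h)" for x j and \<phi> :: "real^'a \<Rightarrow> real"
    using partial_deriv_eq[OF *[OF that]] by (simp add: partial_deriv_def)
  show "Ck k \<phi> \<Longrightarrow> Ck k (\<lambda>x. \<phi> (x + h))" for \<phi> :: "real^'a \<Rightarrow> real"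
  proof (induction k arbitrary: \<phi>)
    case 0
    then show ?case by (auto intro!: continuous_on_compose2[of UNIV \<phi>] continuous_intros)
  next
    case (Suc k)
    have "partial_deriv j (\<lambda>x. \<phi> (x + h)) = (\<lambda>x. partial_deriv j \<phi> (x + h))" for j
      using Suc.prems ** by auto
    moreover have "(\<lambda>x. \<phi> (x + h)) differentiable at x" for x
      using *[of \<phi> x] Suc.prems by (auto intro: differentiableI)
    ultimately show ?case using Suc by auto
  qed
qed

text \<open>
  The derivatives of \<open>exp (-1/x)\<close>, extended by zero to \<open>x \<le> 0\<close>, all have this form, which makes
  the induction on the order of differentiability in \<open>Ck_flat_coordinate\<close> possible.
\<close>

definition flat :: "real poly \<Rightarrow> real \<Rightarrow> real" where
  "flat p x = (if x > 0 then poly p (1 / x) * exp (- (1 / x)) else 0)"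

lemma tendsto_poly_exp_0: "((\<lambda>y. poly p y * exp (- y)) \<longlongrightarrow> (0::real)) at_top"
proof (induction p rule: pCons_induct)
  case (pCons a p)
  have "((\<lambda>y. poly p y * y * exp (- y)) \<longlongrightarrow> 0) at_top"
  proof -
    have "((\<lambda>y. \<Sum>i\<le>degree p. coeff p i * (y ^ Suc i / exp y)) \<longlongrightarrow> (\<Sum>i\<le>degree p. coeff p i * 0)) at_top"
      by (intro tendsto_intros tendsto_power_div_exp_0)
    then show ?thesis
      by (simp add: poly_altdef sum_distrib_right sum_distrib_left exp_minus field_simps)
  qed
  moreover have "((\<lambda>y. a * (y ^ 0 / exp y)) \<longlongrightarrow> a * 0) at_top"
    by (intro tendsto_intros tendsto_power_div_exp_0)
  ultimately have "((\<lambda>y. a * (y ^ 0 / exp y) + poly p y * y * exp (- y)) \<longlongrightarrow> a * 0 + 0) at_top"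
    by (rule tendsto_add[rotated])
  then show ?case by (simp add: exp_minus field_simps)
qed simp

text \<open>
  With \<open>y = 1/x\<close>, whose derivative is \<open>- y\<^sup>2\<close>, the chain rule turns \<open>p y * exp (- y)\<close> into
  \<open>y\<^sup>2 (p y - p' y) exp (- y)\<close>; at \<open>0\<close> the exponential beats every power of \<open>y\<close>.
\<close>

lemma flat_has_derivative:
  "(flat p has_real_derivative flat ([:0, 0, 1:] * (p - pderiv p)) x) (at x)"
proof -
  consider "x > 0" | "x < 0" | "x = 0" by linarith
  then show ?thesis
  proof cases
    case 1
    have "((\<lambda>x. poly p (1 / x) * exp (- (1 / x))) has_real_derivative
            flat ([:0, 0, 1:] * (p - pderiv p)) x) (at x)"
      using 1 by (auto intro!: derivative_eq_intros DERIV_chain2[OF poly_DERIV]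
          simp: flat_def field_simps power2_eq_square)
    then show ?thesis
      by (rule has_field_derivative_transform_within_open[where S = "{0<..}"])
         (use 1 in \<open>auto simp: flat_def\<close>)
  next
    case 2
    have "((\<lambda>x. 0) has_real_derivative flat ([:0, 0, 1:] * (p - pderiv p)) x) (at x)"
      using 2 by (auto simp: flat_def)
    then show ?thesis
      by (rule has_field_derivative_transform_within_open[where S = "{..<0}"])
         (use 2 in \<open>auto simp: flat_def\<close>)
  next
    case 3
    have "((\<lambda>h. flat p h / h) \<longlongrightarrow> 0) (at_right 0)"
    proof -
      have "((\<lambda>h. poly ([:0, 1:] * p) (inverse h) * exp (- inverse h)) \<longlongrightarrow> 0) (at_right 0)"
        by (rule filterlim_compose[OF tendsto_poly_exp_0 filterlim_inverse_at_top_right])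
      then show ?thesis
        by (rule Lim_transform_eventually)
           (auto simp: eventually_at_filter flat_def field_simps)
    qed
    moreover have "((\<lambda>h. flat p h / h) \<longlongrightarrow> 0) (at_left 0)"
      by (rule tendsto_eventually) (auto simp: eventually_at_filter flat_def)
    ultimately have "((\<lambda>h. flat p h / h) \<longlongrightarrow> 0) (at 0)"
      by (simp add: filterlim_split_at)
    then show ?thesis using 3 by (simp add: DERIV_def flat_def)
  qed
qed

lemma Ck_flat_coordinate: "Ck k (\<lambda>x. flat p (c * x $ i + a))"
proof (induction k arbitrary: p)
  case 0
  have "continuous_on UNIV (flat p)"
    using flat_has_derivative[of p] by (auto intro!: DERIV_continuous_on)
  then show ?case by (auto intro!: continuous_on_compose2[of UNIV "flat p"] continuous_intros)
next
  case (Suc k)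
  let ?q = "[:0, 0, 1:] * (p - pderiv p)"
  have *: "((\<lambda>x. flat p (c * x $ i + a)) has_derivative
           (\<lambda>h. flat ?q (c * x $ i + a) * (c * h $ i))) (at x)" for x :: "real^'a"
  proof (rule has_derivative_compose[of "\<lambda>x. c * x $ i + a" "\<lambda>h. c * h $ i", rotated])
    show "(flat p has_derivative (*) (flat ?q (c * x $ i + a))) (at (c * x $ i + a))"
      using flat_has_derivative[of p "c * x $ i + a"] by (simp add: has_field_derivative_def)
    show "((\<lambda>x. c * x $ i + a) has_derivative (\<lambda>h. c * h $ i)) (at x)"
      by (auto intro!: derivative_eq_intros bounded_linear_imp_has_derivative bounded_linear_vec_nth)
  qed
  have "partial_deriv j (\<lambda>x. flat p (c * x $ i + a))
      = (\<lambda>x. flat ?q (c * x $ i + a) * (c * (axis j 1 :: real^'a) $ i))" for j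
    by (rule ext) (rule partial_deriv_eq[OF *])
  then show ?case
    using * Suc unfolding Ck.simps differentiable_def by (auto intro!: Ck_mult Ck_const)
qed

text \<open>
  The factor \<open>flat 1 (m t)\<close> is \<open>exp (-1/(m t))\<close> for \<open>t > 0\<close> and tends to \<open>1\<close> there, so no
  normalization is needed for these functions to converge to the indicator function of the box.
\<close>

definition box_bump :: "nat \<Rightarrow> real^'n \<Rightarrow> real^'n \<Rightarrow> real^'n \<Rightarrow> real" where
  "box_bump m a b x = (\<Prod>i\<in>UNIV. flat 1 (real m * (x $ i - a $ i)) * flat 1 (real m * (b $ i - x $ i)))"

lemma flat_1_bounds: "0 \<le> flat 1 x" "flat 1 x \<le> 1" "x \<le> 0 \<Longrightarrow> flat 1 x = 0"
  by (auto simp: flat_def)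

lemma flat_1_tendsto: "x > 0 \<Longrightarrow> (\<lambda>m. flat 1 (real m * x)) \<longlonglongrightarrow> 1"
proof -
  assume x: "x > 0"
  have "(\<lambda>m. exp (- (inverse (real m) * inverse x))) \<longlonglongrightarrow> exp (- (0 * inverse x))"
    by (intro tendsto_intros lim_inverse_n)
  then show ?thesis
    by (rule_tac Lim_transform_eventually)
       (use x in \<open>auto simp: flat_def field_simps eventually_sequentially intro!: exI[of _ 1]\<close>)
qed

lemma box_bump_bounds: "0 \<le> box_bump m a b x" "box_bump m a b x \<le> 1"
  unfolding box_bump_def by (auto intro!: prod_nonneg prod_le_1 mult_nonneg_nonneg mult_le_one flat_1_bounds)

lemma box_bump_outside: "x \<notin> box a b \<Longrightarrow> box_bump m a b x = 0"
proof -
  assume "x \<notin> box a b"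
  then obtain i where "x $ i \<le> a $ i \<or> b $ i \<le> x $ i" by (auto simp: mem_box_cart not_less)
  then have "flat 1 (real m * (x $ i - a $ i)) * flat 1 (real m * (b $ i - x $ i)) = 0"
    using flat_1_bounds(3)[of "real m * (x $ i - a $ i)"] flat_1_bounds(3)[of "real m * (b $ i - x $ i)"]
    by (auto simp: mult_nonneg_nonpos)
  then show ?thesis unfolding box_bump_def by (auto intro!: prod_zero)
qed

lemma box_bump_tendsto: "(\<lambda>m. box_bump m a b x) \<longlonglongrightarrow> indicator (box a b) x"
proof (cases "x \<in> box a b")
  case True
  then have "(\<lambda>m. box_bump m a b x) \<longlonglongrightarrow> (\<Prod>i\<in>(UNIV :: 'a set). 1 * 1)"
    unfolding box_bump_def by (intro tendsto_intros flat_1_tendsto) (auto simp: mem_box_cart)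
  then show ?thesis using True by simp
qed (simp add: box_bump_outside)

lemma test_fun_box_bump: "test_fun (box_bump m a b)"
  unfolding test_fun_def
proof
  have "Ck k (\<lambda>x. \<Prod>i\<in>UNIV. flat 1 (real m * x $ i + - real m * a $ i) * flat 1 (- real m * x $ i + real m * b $ i))" for k
    by (intro Ck_prod Ck_mult Ck_flat_coordinate) auto
  then show "\<forall>k. Ck k (box_bump m a b)"
    unfolding box_bump_def by (simp add: algebra_simps)
  have "{x. box_bump m a b x \<noteq> 0} \<subseteq> cbox a b"
    using box_bump_outside[of _ a b m] box_subset_cbox by blast
  then show "compact (closure {x. box_bump m a b x \<noteq> 0})"
    using bounded_subset[OF bounded_cbox] by (simp add: compact_closure)
qed

lemma test_fun_translate: "test_fun \<phi> \<Longrightarrow> test_fun (\<lambda>x. \<phi> (x + h))"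
proof -
  assume \<phi>: "test_fun \<phi>"
  have "{x. \<phi> (x + h) \<noteq> 0} = (\<lambda>x. - h + x) ` {x. \<phi> x \<noteq> 0}"
    by (force simp: image_iff algebra_simps)
  then have "closure {x. \<phi> (x + h) \<noteq> 0} = (\<lambda>x. - h + x) ` closure {x. \<phi> x \<noteq> 0}"
    by (simp only: closure_translation)
  moreover have "compact ((\<lambda>x. - h + x) ` closure {x. \<phi> x \<noteq> 0})"
    using \<phi> unfolding test_fun_def by (blast intro: compact_translation)
  ultimately have "compact (closure {x. \<phi> (x + h) \<noteq> 0})" by simp
  with \<phi> show ?thesis
    unfolding test_fun_def by (blast intro: Ck_translate)
qed

lemma test_fun_differentiable: "test_fun \<phi> \<Longrightarrow> \<phi> differentiable at x"
  unfolding test_fun_def by (metis Ck.simps(2))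

lemma test_fun_continuous:
  assumes "test_fun \<phi>"
  shows "continuous_on UNIV \<phi>" "continuous_on UNIV (partial_deriv j \<phi>)"
proof -
  show "continuous_on UNIV \<phi>" using assms Ck_imp_continuous unfolding test_fun_def by auto
  have "Ck (Suc 0) \<phi>" using assms unfolding test_fun_def by blast
  then show "continuous_on UNIV (partial_deriv j \<phi>)" by simp
qed

text \<open>
  One constant and one radius serve for a test function and its derivative, since both vanish on
  the open complement of the support.
\<close>

lemma test_fun_bounded:
  assumes \<phi>: "test_fun \<phi>"
  obtains M R where "M > 0" "R > 0" "\<And>x. \<bar>\<phi> x\<bar> \<le> M" "\<And>x. \<bar>partial_deriv j \<phi> x\<bar> \<le> M"
    "\<And>x. norm x > R \<Longrightarrow> \<phi> x = 0" "\<And>x. norm x > R \<Longrightarrow> partial_deriv j \<phi> x = 0"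
proof -
  define K where "K = closure {x. \<phi> x \<noteq> 0}"
  have K: "compact K" using \<phi> by (simp add: K_def test_fun_def)
  have out: "\<phi> x = 0 \<and> partial_deriv j \<phi> x = 0" if "x \<notin> K" for x
  proof
    have 0: "\<phi> y = 0" if "y \<in> - K" for y using that closure_subset[of "{x. \<phi> x \<noteq> 0}"] by (auto simp: K_def)
    then show "\<phi> x = 0" using that by auto
    have "(\<phi> has_derivative (\<lambda>h. 0)) (at x)"
      by (rule has_derivative_transform_within_open[of "\<lambda>x. 0" _ _ UNIV "- K"])
         (use 0 that K in \<open>auto simp: compact_imp_closed\<close>)
    then show "partial_deriv j \<phi> x = 0" by (subst partial_deriv_eq) auto
  qed
  have "compact (\<phi> ` K)" "compact (partial_deriv j \<phi> ` K)"
    using K test_fun_continuous[OF \<phi>] by (auto intro: compact_continuous_image continuous_on_subset)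
  then obtain M1 M2 where "\<forall>y\<in>\<phi> ` K. norm y \<le> M1" "\<forall>y\<in>partial_deriv j \<phi> ` K. norm y \<le> M2"
    using compact_imp_bounded[THEN bounded_normE] by metis
  then have M: "\<bar>\<phi> x\<bar> \<le> M1" "\<bar>partial_deriv j \<phi> x\<bar> \<le> M2" if "x \<in> K" for x using that by auto
  obtain R where R: "\<And>x. x \<in> K \<Longrightarrow> norm x \<le> R"
    using K compact_imp_bounded bounded_iff by metis
  show ?thesis
  proof (rule that[of "max 1 (max M1 M2)" "max 1 R"])
    fix x
    show "\<bar>\<phi> x\<bar> \<le> max 1 (max M1 M2)" using M[of x] out[of x] by (cases "x \<in> K") auto
    show "\<bar>partial_deriv j \<phi> x\<bar> \<le> max 1 (max M1 M2)" using M[of x] out[of x] by (cases "x \<in> K") auto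
    assume "norm x > max 1 R"
    then have "x \<notin> K" using R[of x] by auto
    then show "\<phi> x = 0" "partial_deriv j \<phi> x = 0" using out by auto
  qed auto
qed

section \<open>Locally integrable functions against test functions\<close>

lemma nn_integral_lborel_translate:
  fixes f :: "'a::euclidean_space \<Rightarrow> ennreal"
  assumes "f \<in> borel_measurable borel"
  shows "(\<integral>\<^sup>+x. f (x + h) \<partial>lborel) = (\<integral>\<^sup>+x. f x \<partial>lborel)"
  using nn_integral_distr[of "(+) h" lborel borel f] assms
  by (simp add: lborel_distr_plus add.commute)

lemma integrable_lborel_translate:
  fixes f :: "'a::euclidean_space \<Rightarrow> real"
  assumes "integrable lborel f"
  shows "integrable lborel (\<lambda>x. f (x + h))"
  using integrable_distr[of "(+) h" lborel borel f] assms
  by (simp add: lborel_distr_plus add.commute)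

lemma integral_lborel_translate:
  fixes f :: "'a::euclidean_space \<Rightarrow> real"
  assumes "f \<in> borel_measurable borel"
  shows "(\<integral>x. f (x + h) \<partial>lborel) = (\<integral>x. f x \<partial>lborel)"
  using integral_distr[of "(+) h" lborel borel f] assms
  by (simp add: lborel_distr_plus add.commute)

text \<open>
  Weak derivatives are developed for Borel functions: the composition of a Lebesgue measurable
  function with \<open>(s, x) \<mapsto> x + s h\<close> need not be measurable for the product measure, which
  Fubini's theorem requires below.
\<close>

definition loc_int :: "(real^'n \<Rightarrow> real) \<Rightarrow> bool" where
  "loc_int v \<longleftrightarrow> v \<in> borel_measurable borel \<and>
     (\<forall>R. integrable lborel (\<lambda>x. indicator (cball 0 R) x * v x))"

lemma loc_int_measurable: "loc_int v \<Longrightarrow> v \<in> borel_measurable borel"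
  by (simp add: loc_int_def)

lemma integrable_mult_loc_int:
  assumes v: "loc_int v" and [measurable]: "\<phi> \<in> borel_measurable borel"
    and bd: "\<And>x. \<bar>\<phi> x\<bar> \<le> M" and out: "\<And>x. norm x > R \<Longrightarrow> \<phi> x = 0"
  shows "integrable lborel (\<lambda>x. v x * \<phi> x)"
proof (rule Bochner_Integration.integrable_bound)
  show "integrable lborel (\<lambda>x. M * (indicator (cball 0 R) x * v x))"
    using v unfolding loc_int_def by simp
  show "(\<lambda>x. v x * \<phi> x) \<in> borel_measurable lborel"
    using loc_int_measurable[OF v] by measurable
  have "\<bar>v x * \<phi> x\<bar> \<le> \<bar>M * (indicator (cball 0 R) x * v x)\<bar>" for x
  proof (cases "norm x > R")
    case False
    have "0 \<le> M" using bd[of x] by linarith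
    then show ?thesis using bd[of x] False
      by (auto simp: abs_mult mult.commute[of M] intro!: mult_left_mono)
  qed (simp add: out)
  then show "AE x in lborel. norm (v x * \<phi> x) \<le> norm (M * (indicator (cball 0 R) x * v x))"
    by simp
qed

lemma loc_int_dominated:
  assumes "loc_int d" and [measurable]: "v \<in> borel_measurable borel" and le: "\<And>x. \<bar>v x\<bar> \<le> \<bar>d x\<bar> + c"
  shows "loc_int v"
  unfolding loc_int_def
proof safe
  fix R :: real
  have [measurable]: "cball (0::real^'a) R \<in> sets borel" by simp
  show "integrable lborel (\<lambda>x. indicator (cball 0 R) x * v x)"
  proof (rule Bochner_Integration.integrable_bound)
    show "integrable lborel (\<lambda>x. \<bar>indicator (cball 0 R) x * d x\<bar> + indicator (cball 0 R) x * \<bar>c\<bar>)"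
      using assms(1) unfolding loc_int_def
      by (intro Bochner_Integration.integrable_add integrable_abs integrable_mult_left)
         (auto intro!: integrable_real_indicator emeasure_bounded_finite)
    show "AE x in lborel. norm (indicator (cball 0 R) x * v x)
        \<le> norm (\<bar>indicator (cball 0 R) x * d x\<bar> + indicator (cball 0 R) x * \<bar>c\<bar>)"
    proof (rule AE_I2)
      fix x show "norm (indicator (cball 0 R) x * v x)
        \<le> norm (\<bar>indicator (cball 0 R) x * d x\<bar> + indicator (cball 0 R) x * \<bar>c\<bar>)"
        using le[of x] by (auto simp: indicator_def)
    qed
  qed measurable
qed measurable

lemma loc_int_const: "loc_int (\<lambda>x. c)"
  unfolding loc_int_def
  by (auto intro!: integrable_mult_left integrable_real_indicator emeasure_bounded_finite)

lemma loc_int_cmult: "loc_int v \<Longrightarrow> loc_int (\<lambda>x. c * v x)"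
  unfolding loc_int_def by (auto simp: mult.left_commute[of _ c])

lemma loc_int_add: "loc_int v \<Longrightarrow> loc_int w \<Longrightarrow> loc_int (\<lambda>x. v x + w x)"
  unfolding loc_int_def by (auto simp: distrib_left)

lemma loc_int_translate:
  assumes v: "loc_int v" shows "loc_int (\<lambda>x. v (x + h))"
  unfolding loc_int_def
proof safe
  note [measurable] = loc_int_measurable[OF v]
  show "(\<lambda>x. v (x + h)) \<in> borel_measurable borel" by measurable
  fix R :: real
  have [measurable]: "cball (0::real^'a) R \<in> sets borel" by simp
  have "integrable lborel (\<lambda>x. indicator (cball 0 (R + norm h)) (x + h) * v (x + h))"
    using integrable_lborel_translate v unfolding loc_int_def by blast
  then show "integrable lborel (\<lambda>x. indicator (cball 0 R) x * v (x + h))"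
  proof (rule Bochner_Integration.integrable_bound)
    have "norm (x + h) \<le> R + norm h" if "norm x \<le> R" for x
      using norm_triangle_ineq[of x h] that by simp
    then show "AE x in lborel. norm (indicator (cball 0 R) x * v (x + h)) \<le>
       norm (indicator (cball 0 (R + norm h)) (x + h) * v (x + h))"
      by (auto simp: indicator_def)
  qed measurable
qed

text \<open>
  The positive and the negative part of \<open>d\<close> are densities of two finite measures that agree on
  boxes, hence on all Borel sets.
\<close>

lemma AE_eq_zero_if_box_integrals_zero:
  fixes d :: "'a::euclidean_space \<Rightarrow> real"
  assumes d: "integrable lborel d"
    and box: "\<And>a b. (\<integral>x. d x * indicator (box a b) x \<partial>lborel) = 0"
  shows "AE x in lborel. d x = 0"
proof -
  note [measurable] = borel_measurable_integrable[OF d]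
  let ?P = "density lborel (\<lambda>x. ennreal (d x))" and ?N = "density lborel (\<lambda>x. ennreal (- d x))"
  have fin: "(\<integral>\<^sup>+x. ennreal (d x) * indicator A x \<partial>lborel) < \<infinity>"
       "(\<integral>\<^sup>+x. ennreal (- d x) * indicator A x \<partial>lborel) < \<infinity>" for A
  proof -
    have "(\<integral>\<^sup>+x. ennreal (d x) * indicator A x \<partial>lborel) \<le> (\<integral>\<^sup>+x. ennreal (norm (d x)) \<partial>lborel)"
      "(\<integral>\<^sup>+x. ennreal (- d x) * indicator A x \<partial>lborel) \<le> (\<integral>\<^sup>+x. ennreal (norm (d x)) \<partial>lborel)"
      by (auto intro!: nn_integral_mono simp: indicator_def ennreal_leI)
    then show "(\<integral>\<^sup>+x. ennreal (d x) * indicator A x \<partial>lborel) < \<infinity>"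
       "(\<integral>\<^sup>+x. ennreal (- d x) * indicator A x \<partial>lborel) < \<infinity>"
      using d unfolding integrable_iff_bounded by (auto simp: le_less_trans)
  qed
  have "?P = ?N"
  proof (rule measure_eqI_generator_eq)
    let ?E = "range (\<lambda>(a, b). box a b :: 'a set)"
    show "Int_stable ?E" by (auto simp: Int_stable_def box_Int_box)
    show "?E \<subseteq> Pow UNIV" by simp
    show "sets ?P = sigma_sets UNIV ?E" "sets ?N = sigma_sets UNIV ?E"
      by (simp_all add: borel_eq_box)
    let ?A = "\<lambda>n::nat. box (- (real n *\<^sub>R One)) (real n *\<^sub>R One) :: 'a set"
    show "range ?A \<subseteq> ?E" by auto
    show "(\<Union>i. ?A i) = UNIV" unfolding UN_box_eq_UNIV by auto
    show "emeasure ?P (?A i) \<noteq> \<infinity>" for i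
      using fin(1)[of "?A i"] by (simp add: emeasure_density)
    fix X assume "X \<in> ?E"
    then obtain a b where X: "X = box a b" by auto
    have int: "integrable lborel (\<lambda>x. d x * indicator X x)"
      using d by (auto simp: X intro: integrable_real_mult_indicator)
    have "(\<integral>x. d x * indicator X x \<partial>lborel) =
        enn2real (\<integral>\<^sup>+x. ennreal (d x * indicator X x) \<partial>lborel)
        - enn2real (\<integral>\<^sup>+x. ennreal (- (d x * indicator X x)) \<partial>lborel)"
      by (rule real_lebesgue_integral_def[OF int])
    moreover have "(\<integral>\<^sup>+x. ennreal (d x * indicator X x) \<partial>lborel) = (\<integral>\<^sup>+x. ennreal (d x) * indicator X x \<partial>lborel)"
      "(\<integral>\<^sup>+x. ennreal (- (d x * indicator X x)) \<partial>lborel) = (\<integral>\<^sup>+x. ennreal (- d x) * indicator X x \<partial>lborel)"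
      by (auto intro!: nn_integral_cong simp: indicator_def)
    ultimately have "enn2real (\<integral>\<^sup>+x. ennreal (d x) * indicator X x \<partial>lborel)
       = enn2real (\<integral>\<^sup>+x. ennreal (- d x) * indicator X x \<partial>lborel)"
      using box[of a b] by (simp add: X)
    then have "(\<integral>\<^sup>+x. ennreal (d x) * indicator X x \<partial>lborel)
       = (\<integral>\<^sup>+x. ennreal (- d x) * indicator X x \<partial>lborel)"
      using fin[of X] by (metis ennreal_enn2real infinity_ennreal_def)
    then show "emeasure ?P X = emeasure ?N X"
      by (simp add: emeasure_density X)
  qed
  then have "AE x in lborel. ennreal (d x) = ennreal (- d x)"
    by (intro sigma_finite_measure.density_unique[OF sigma_finite_lborel]) auto
  then show ?thesis
    by eventually_elim (smt (verit) ennreal_eq_0_iff)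
qed

text \<open>
  The fundamental lemma of the calculus of variations. Bump functions turn the hypothesis into
  vanishing integrals over boxes; cutting off by large boxes reduces to integrable functions.
\<close>

lemma AE_eq_zero_if_test_integrals_zero:
  fixes d :: "real^'n \<Rightarrow> real"
  assumes d: "loc_int d" and zero: "\<And>\<phi>. test_fun \<phi> \<Longrightarrow> (\<integral>x. d x * \<phi> x \<partial>lborel) = 0"
  shows "AE x in lborel. d x = 0"
proof -
  note [measurable] = loc_int_measurable[OF d]
  have box: "integrable lborel (\<lambda>x. d x * indicator (box a b) x)"
            "(\<integral>x. d x * indicator (box a b) x \<partial>lborel) = 0" for a b
  proof -
    obtain R where R: "\<forall>x\<in>box a b. norm x \<le> R"
      using bounded_box bounded_iff by metis
    show int: "integrable lborel (\<lambda>x. d x * indicator (box a b) x)"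
      by (rule integrable_mult_loc_int[OF d, of _ 1 R]) (use R in \<open>auto simp: indicator_def not_less[symmetric]\<close>)
    have [measurable]: "box_bump m a b \<in> borel_measurable borel" for m
      by (intro borel_measurable_continuous_onI test_fun_continuous test_fun_box_bump)
    have "(\<lambda>m. \<integral>x. d x * box_bump m a b x \<partial>lborel) \<longlonglongrightarrow> (\<integral>x. d x * indicator (box a b) x \<partial>lborel)"
    proof (rule integral_dominated_convergence[where w = "\<lambda>x. \<bar>d x * indicator (box a b) x\<bar>"])
      show "AE x in lborel. (\<lambda>m. d x * box_bump m a b x) \<longlonglongrightarrow> d x * indicator (box a b) x"
        by (intro AE_I2 tendsto_intros box_bump_tendsto)
      have "norm (d x * box_bump m a b x) \<le> \<bar>d x * indicator (box a b) x\<bar>" for m x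
        using box_bump_bounds[of m a b x] box_bump_outside[of x a b m]
        by (cases "x \<in> box a b") (auto simp: abs_mult mult_left_le)
      then show "AE x in lborel. norm (d x * box_bump m a b x) \<le> \<bar>d x * indicator (box a b) x\<bar>" for m
        by simp
    qed (use int in auto)
    then show "(\<integral>x. d x * indicator (box a b) x \<partial>lborel) = 0"
      by (simp add: zero test_fun_box_bump LIMSEQ_const_iff)
  qed
  have "AE x in lborel. d x * indicator (box (- (real n *\<^sub>R One)) (real n *\<^sub>R One)) x = 0" for n :: nat
  proof (rule AE_eq_zero_if_box_integrals_zero)
    fix a b
    have "(\<lambda>x. d x * indicator (box (- (real n *\<^sub>R One)) (real n *\<^sub>R One)) x * indicator (box a b) x)
       = (\<lambda>x. d x * indicator (box (- (real n *\<^sub>R One)) (real n *\<^sub>R One) \<inter> box a b) x)"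
      by (auto simp: indicator_def)
    then show "(\<integral>x. d x * indicator (box (- (real n *\<^sub>R One)) (real n *\<^sub>R One)) x * indicator (box a b) x \<partial>lborel) = 0"
      by (simp add: box_Int_box box(2))
  qed (rule box(1))
  then have "AE x in lborel. \<forall>n::nat. d x * indicator (box (- (real n *\<^sub>R One)) (real n *\<^sub>R One)) x = 0"
    unfolding AE_all_countable by blast
  then show ?thesis
  proof eventually_elim
    fix x assume *: "\<forall>n::nat. d x * indicator (box (- (real n *\<^sub>R One)) (real n *\<^sub>R One)) x = 0"
    have "x \<in> (\<Union>n::nat. box (- (real n *\<^sub>R One)) (real n *\<^sub>R One))"
      using UN_box_eq_UNIV by blast
    then obtain n :: nat where "x \<in> box (- (real n *\<^sub>R One)) (real n *\<^sub>R One)" by blast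
    with *[rule_format, of n] show "d x = 0" by simp
  qed
qed

section \<open>Translations and averages along segments\<close>

text \<open>
  Squeeze \<open>A\<close> between a compact set and an open set of almost the same measure. A translation
  shorter than the distance of the two moves points in or out of \<open>A\<close> only through the thin
  differences.
\<close>

lemma L1_translation_continuous_indicator:
  fixes A :: "'a::euclidean_space set"
  assumes A[measurable]: "A \<in> sets borel" and bdd: "bounded A" and e: "e > 0"
  shows "\<exists>\<delta>>0. \<forall>h. norm h < \<delta> \<longrightarrow>
    (\<integral>x. \<bar>indicator A (x + h) - indicator A x\<bar> \<partial>lborel) \<le> (e::real)"
proof -
  have Al: "A \<in> sets lebesgue" using A by simp
  obtain U where U: "open U" "A \<subseteq> U" "U - A \<in> lmeasurable" "emeasure lebesgue (U - A) < ennreal (e / 4)"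
    using sets_lebesgue_outer_open[OF Al, of "e / 4"] e by auto
  obtain T where T: "closed T" "T \<subseteq> A" "A - T \<in> lmeasurable" "emeasure lebesgue (A - T) < ennreal (e / 4)"
    using sets_lebesgue_inner_closed[OF Al, of "e / 4"] e by auto
  have [measurable]: "U \<in> sets borel" "T \<in> sets borel" using U T by auto
  have UA: "U - A \<in> sets borel" "A - T \<in> sets borel" by measurable
  have eU: "emeasure lborel (U - A) < ennreal (e / 4)" "emeasure lborel (A - T) < ennreal (e / 4)"
    using U(4) T(4) UA by simp_all
  have int: "integrable lborel (indicator (U - A) :: 'a \<Rightarrow> real)" "integrable lborel (indicator (A - T) :: 'a \<Rightarrow> real)"
    using eU UA by (auto intro!: integrable_real_indicator intro: less_trans)
  have le: "(\<integral>x. indicator (U - A) x \<partial>lborel) \<le> e / 4" "(\<integral>x. indicator (A - T) x \<partial>lborel) \<le> e / 4"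
    using eU e enn2real_leI[OF _ less_imp_le[OF eU(1)]] enn2real_leI[OF _ less_imp_le[OF eU(2)]]
    by (simp_all add: measure_def)
  have "compact T" using T(1,2) bdd bounded_subset compact_eq_bounded_closed by blast
  then obtain \<delta> where \<delta>: "\<delta> > 0" "(\<Union>x\<in>T. ball x \<delta>) \<subseteq> U"
    using compact_subset_open_imp_ball_epsilon_subset U(1,2) T(2) by (metis order_trans)
  have "(\<integral>x. \<bar>indicator A (x + h) - indicator A x\<bar> \<partial>lborel) \<le> e" if h: "norm h < \<delta>" for h
  proof -
    have near: "x + y \<in> U" if "x \<in> T" "norm y = norm h" for x y
    proof -
      have "x + y \<in> ball x \<delta>" using h that by (simp add: dist_norm)
      then show ?thesis using \<delta> that by blast
    qed
    have pw: "\<bar>indicator A (x + h) - indicator A x\<bar> \<le> indicator (A - T) x + indicator (U - A) (x + h)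
        + indicator (A - T) (x + h) + (indicator (U - A) x :: real)" for x
      using near[of x h] near[of "x + h" "- h"] by (auto simp: indicator_def)
    note ints = int integrable_lborel_translate[OF int(1), of h] integrable_lborel_translate[OF int(2), of h]
    have "(\<integral>x. \<bar>indicator A (x + h) - indicator A x\<bar> \<partial>lborel) \<le>
      (\<integral>x. indicator (A - T) x + indicator (U - A) (x + h)
        + indicator (A - T) (x + h) + (indicator (U - A) x :: real) \<partial>lborel)"
    proof (rule integral_mono_AE')
      show "integrable lborel (\<lambda>x. indicator (A - T) x + indicator (U - A) (x + h)
        + indicator (A - T) (x + h) + (indicator (U - A) x :: real))"
        using ints by auto
    qed (use pw in auto)
    also have "\<dots> = (\<integral>x. indicator (A - T) x \<partial>lborel) + (\<integral>x. indicator (U - A) (x + h) \<partial>lborel)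
       + (\<integral>x. indicator (A - T) (x + h) \<partial>lborel) + (\<integral>x. indicator (U - A) x \<partial>lborel)"
      using ints by simp
    also have "\<dots> = 2 * (\<integral>x. indicator (A - T) x \<partial>lborel) + 2 * (\<integral>x. indicator (U - A) x \<partial>lborel)"
      using UA by (simp only: integral_lborel_translate borel_measurable_indicator)
    also have "\<dots> \<le> e" using le by linarith
    finally show ?thesis .
  qed
  with \<delta> show ?thesis by blast
qed

text \<open>
  Indicator functions of bounded sets are treated above, and the property survives dominated
  limits, which also serve to pass to unbounded sets.
\<close>

lemma L1_translation_continuous:
  fixes d :: "'a::euclidean_space \<Rightarrow> real"
  assumes "integrable lborel d" "e > 0"
  shows "\<exists>\<delta>>0. \<forall>h. norm h < \<delta> \<longrightarrow> (\<integral>x. \<bar>d (x + h) - d x\<bar> \<partial>lborel) \<le> e"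
  using assms
proof (induction d arbitrary: e rule: integrable_induct)
  have limit_step: "\<exists>\<delta>>0. \<forall>h. norm h < \<delta> \<longrightarrow> (\<integral>x. \<bar>f (x + h) - f x\<bar> \<partial>lborel) \<le> e"
    if f: "integrable lborel f" and s: "\<And>i. integrable lborel (s i)" and e: "e > 0"
    and to: "\<And>x. (\<lambda>i. s i x) \<longlonglongrightarrow> f x" and bd: "\<And>i x. \<bar>s i x\<bar> \<le> 2 * \<bar>f x\<bar>"
    and IH: "\<And>i e. e > 0 \<Longrightarrow> \<exists>\<delta>>0. \<forall>h. norm h < \<delta> \<longrightarrow> (\<integral>x. \<bar>s i (x + h) - s i x\<bar> \<partial>lborel) \<le> e"
    for f :: "'a \<Rightarrow> real" and s :: "nat \<Rightarrow> 'a \<Rightarrow> real" and e :: real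
  proof -
    note [measurable] = borel_measurable_integrable[OF f] borel_measurable_integrable[OF s]
    have "(\<lambda>i. \<integral>x. \<bar>s i x - f x\<bar> \<partial>lborel) \<longlonglongrightarrow> (\<integral>x. 0 \<partial>(lborel :: 'a measure))"
    proof (rule integral_dominated_convergence[where w = "\<lambda>x. 3 * \<bar>f x\<bar>"])
      show "AE x in lborel. (\<lambda>i. \<bar>s i x - f x\<bar>) \<longlonglongrightarrow> 0"
        using to by (auto simp: tendsto_rabs_zero_iff LIM_zero_iff)
      show "AE x in lborel. norm \<bar>s i x - f x\<bar> \<le> 3 * \<bar>f x\<bar>" for i
      proof (rule AE_I2)
        fix x show "norm \<bar>s i x - f x\<bar> \<le> 3 * \<bar>f x\<bar>" using bd[of i x] by simp
      qed
    qed (use f in auto)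
    then have "\<forall>\<^sub>F i in sequentially. (\<integral>x. \<bar>s i x - f x\<bar> \<partial>lborel) < e / 3"
      by (rule order_tendstoD(2)) (use e in simp)
    then obtain i where i: "(\<integral>x. \<bar>s i x - f x\<bar> \<partial>lborel) < e / 3"
      by (meson eventually_happens' sequentially_bot)
    obtain \<delta> where \<delta>: "\<delta> > 0" "\<And>h. norm h < \<delta> \<Longrightarrow> (\<integral>x. \<bar>s i (x + h) - s i x\<bar> \<partial>lborel) \<le> e / 3"
      using IH[of "e / 3" i] e by auto
    have "(\<integral>x. \<bar>f (x + h) - f x\<bar> \<partial>lborel) \<le> e" if "norm h < \<delta>" for h
    proof -
      have sf: "integrable lborel (\<lambda>x. \<bar>s i x - f x\<bar>)" using s f by auto
      note ints = sf integrable_lborel_translate[OF sf, of h] integrable_lborel_translate[OF s, of i h] s[of i]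
      have "(\<integral>x. \<bar>f (x + h) - f x\<bar> \<partial>lborel) \<le>
        (\<integral>x. \<bar>s i (x + h) - f (x + h)\<bar> + \<bar>s i (x + h) - s i x\<bar> + \<bar>s i x - f x\<bar> \<partial>lborel)"
        by (rule integral_mono_AE') (use ints in auto)
      also have "\<dots> = (\<integral>x. \<bar>s i (x + h) - f (x + h)\<bar> \<partial>lborel) + (\<integral>x. \<bar>s i (x + h) - s i x\<bar> \<partial>lborel)
          + (\<integral>x. \<bar>s i x - f x\<bar> \<partial>lborel)"
        using ints by auto
      also have "(\<integral>x. \<bar>s i (x + h) - f (x + h)\<bar> \<partial>lborel) = (\<integral>x. \<bar>s i x - f x\<bar> \<partial>lborel)"
        by (rule integral_lborel_translate) measurable
      finally show ?thesis using i \<delta>(2)[OF that] by linarith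
    qed
    with \<delta> show ?thesis by blast
  qed
  {
    case (base A c)
    \<comment> \<open>bounded pieces, to which the lemma for indicator functions applies\<close>
    let ?A = "\<lambda>n::nat. A \<inter> cball 0 (real n)"
    have sets: "?A n \<in> sets borel" for n using base by auto
    have ev: "\<forall>\<^sub>F n in sequentially. indicator (?A n) x *\<^sub>R c = indicator A x *\<^sub>R c" for x
    proof -
      obtain N where "norm x \<le> real N" using real_arch_simple by blast
      then show ?thesis
        by (auto simp: eventually_sequentially indicator_def intro!: exI[of _ N])
    qed
    show ?case
    proof (rule limit_step[where s = "\<lambda>n x. indicator (?A n) x *\<^sub>R c"])
      show "integrable lborel (\<lambda>x. indicator A x *\<^sub>R c)" using base by auto
      show "integrable lborel (\<lambda>x. indicator (?A n) x *\<^sub>R c)" for n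
        using sets emeasure_bounded_finite[OF bounded_Int, of A "cball 0 (real n)"]
        by (auto intro!: integrable_scaleR_left integrable_real_indicator)
      show "(\<lambda>n. indicator (?A n) x *\<^sub>R c) \<longlonglongrightarrow> indicator A x *\<^sub>R c" for x
        by (rule tendsto_eventually[OF ev])
      show "\<bar>indicator (?A n) x *\<^sub>R c\<bar> \<le> 2 * \<bar>indicator A x *\<^sub>R c\<bar>" for n x
        by (auto simp: indicator_def)
      fix n and e :: real assume e: "e > 0"
      obtain \<delta> where \<delta>: "\<delta> > 0" "\<And>h. norm h < \<delta> \<Longrightarrow>
          (\<integral>x. \<bar>indicator (?A n) (x + h) - indicator (?A n) x\<bar> \<partial>lborel) \<le> e / (\<bar>c\<bar> + 1)"
        using L1_translation_continuous_indicator[OF sets[of n], of "e / (\<bar>c\<bar> + 1)"] e by auto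
      show "\<exists>\<delta>>0. \<forall>h. norm h < \<delta> \<longrightarrow>
        (\<integral>x. \<bar>indicator (?A n) (x + h) *\<^sub>R c - indicator (?A n) x *\<^sub>R c\<bar> \<partial>lborel) \<le> e"
      proof (intro exI[of _ \<delta>] conjI allI impI \<delta>(1))
        fix h :: 'a assume h: "norm h < \<delta>"
        have "(\<integral>x. \<bar>indicator (?A n) (x + h) *\<^sub>R c - indicator (?A n) x *\<^sub>R c\<bar> \<partial>lborel)
           = \<bar>c\<bar> * (\<integral>x. \<bar>indicator (?A n) (x + h) - indicator (?A n) x\<bar> \<partial>lborel)"
          by (subst integral_mult_right_zero[symmetric]) (simp add: abs_mult[symmetric] algebra_simps)
        also have "\<dots> \<le> \<bar>c\<bar> * (e / (\<bar>c\<bar> + 1))" by (intro mult_left_mono \<delta>(2) h) auto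
        also have "\<dots> \<le> e" using e by (simp add: field_simps)
        finally show "(\<integral>x. \<bar>indicator (?A n) (x + h) *\<^sub>R c - indicator (?A n) x *\<^sub>R c\<bar> \<partial>lborel) \<le> e" .
      qed
    qed (use base in auto)
  next
    case (add f g)
    obtain \<delta>1 where \<delta>1: "\<delta>1 > 0" "\<And>h. norm h < \<delta>1 \<Longrightarrow> (\<integral>x. \<bar>f (x + h) - f x\<bar> \<partial>lborel) \<le> e / 2"
      using add.IH(1)[of "e / 2"] add.prems by auto
    obtain \<delta>2 where \<delta>2: "\<delta>2 > 0" "\<And>h. norm h < \<delta>2 \<Longrightarrow> (\<integral>x. \<bar>g (x + h) - g x\<bar> \<partial>lborel) \<le> e / 2"
      using add.IH(2)[of "e / 2"] add.prems by auto
    show ?case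
    proof (intro exI[of _ "min \<delta>1 \<delta>2"] conjI allI impI)
      fix h :: 'a assume h: "norm h < min \<delta>1 \<delta>2"
      note ints = add.hyps(1,2) add.hyps(1,2)[THEN integrable_lborel_translate, of h]
      have "(\<integral>x. \<bar>f (x + h) + g (x + h) - (f x + g x)\<bar> \<partial>lborel)
         \<le> (\<integral>x. \<bar>f (x + h) - f x\<bar> + \<bar>g (x + h) - g x\<bar> \<partial>lborel)"
        by (rule integral_mono_AE') (use ints in auto)
      also have "\<dots> = (\<integral>x. \<bar>f (x + h) - f x\<bar> \<partial>lborel) + (\<integral>x. \<bar>g (x + h) - g x\<bar> \<partial>lborel)"
        using ints by auto
      also have "\<dots> \<le> e" using \<delta>1(2)[of h] \<delta>2(2)[of h] h by auto
      finally show "(\<integral>x. \<bar>f (x + h) + g (x + h) - (f x + g x)\<bar> \<partial>lborel) \<le> e" .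
    qed (use \<delta>1 \<delta>2 in auto)
  next
    case (lim f s)
    show ?case
      by (rule limit_step[of f s e]) (use lim in auto)
  }
qed

text \<open>
  The mean of \<open>d\<close> over the segment from \<open>x\<close> to \<open>x + h\<close>; if \<open>d\<close> is the derivative of \<open>v\<close> in the
  direction \<open>h\<close>, this is \<open>v (x + h) - v x\<close>.
\<close>

definition segment_avg :: "real^'n \<Rightarrow> (real^'n \<Rightarrow> real) \<Rightarrow> real^'n \<Rightarrow> real" where
  "segment_avg h d x = (\<integral>s. indicator {0..1} s * d (x + s *\<^sub>R h) \<partial>lborel)"

text \<open>
  The two cases that are used, \<open>b = 0\<close> and \<open>a = 0\<close>, correspond to placing the translation on
  the function or on the test function.
\<close>

lemma integrable_segment_product:
  fixes v :: "real^'n \<Rightarrow> real"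
  assumes v: "loc_int v" and \<psi>[measurable]: "\<psi> \<in> borel_measurable borel"
    and bd: "\<And>x. \<bar>\<psi> x\<bar> \<le> M" and out: "\<And>x. norm x > R \<Longrightarrow> \<psi> x = 0"
  shows "integrable (lborel \<Otimes>\<^sub>M lborel)
    (\<lambda>(s, x). indicator {0..1::real} s * (v (x + s *\<^sub>R a) * \<psi> (x + s *\<^sub>R b)))"
proof (rule lborel_pair.Fubini_integrable)
  note [measurable] = loc_int_measurable[OF v]
  let ?f = "\<lambda>(s, x). indicator {0..1::real} s * (v (x + s *\<^sub>R a) * \<psi> (x + s *\<^sub>R b))"
  have M: "M \<ge> 0" using bd[of 0] by linarith
  show "?f \<in> borel_measurable (lborel \<Otimes>\<^sub>M lborel)" by measurable
  have int: "integrable lborel (\<lambda>x. v (x + s *\<^sub>R a) * \<psi> (x + s *\<^sub>R b))" for s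
  proof (rule integrable_mult_loc_int[OF loc_int_translate[OF v], of _ M "R + norm (s *\<^sub>R b)"])
    fix x :: "real^'n" assume "norm x > R + norm (s *\<^sub>R b)"
    then have "norm (x + s *\<^sub>R b) > R" using norm_triangle_ineq4[of "x + s *\<^sub>R b" "s *\<^sub>R b"] by simp
    then show "\<psi> (x + s *\<^sub>R b) = 0" by (rule out)
  qed (use bd in auto)
  then show "AE s in lborel. integrable lborel (\<lambda>x. ?f (s, x))" by auto
  define C where "C = M * (\<integral>x. \<bar>indicator (cball 0 (R + norm (b - a))) x * v x\<bar> \<partial>lborel)"
  show "integrable lborel (\<lambda>s. \<integral>x. norm (?f (s, x)) \<partial>lborel)"
  proof (rule Bochner_Integration.integrable_bound)
    show "integrable lborel (\<lambda>s. C * indicator {0..1::real} s)" by auto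
    have "(\<integral>x. norm (?f (s, x)) \<partial>lborel) \<le> C * indicator {0..1} s" for s
    proof (cases "s \<in> {0..1}")
      case True
      have "(\<integral>x. norm (?f (s, x)) \<partial>lborel) = (\<integral>x. \<bar>v (x + s *\<^sub>R a) * \<psi> (x + s *\<^sub>R a + s *\<^sub>R (b - a))\<bar> \<partial>lborel)"
        using True by (simp add: algebra_simps)
      also have "\<dots> = (\<integral>x. \<bar>v x * \<psi> (x + s *\<^sub>R (b - a))\<bar> \<partial>lborel)"
        by (rule integral_lborel_translate) measurable
      also have "\<dots> \<le> (\<integral>x. M * \<bar>indicator (cball 0 (R + norm (b - a))) x * v x\<bar> \<partial>lborel)"
      proof (rule integral_mono_AE')
        show "integrable lborel (\<lambda>x. M * \<bar>indicator (cball 0 (R + norm (b - a))) x * v x\<bar>)"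
          using v unfolding loc_int_def by auto
        have "\<bar>v x * \<psi> (x + s *\<^sub>R (b - a))\<bar> \<le> M * \<bar>indicator (cball 0 (R + norm (b - a))) x * v x\<bar>" for x
        proof (cases "norm x \<le> R + norm (b - a)")
          case True
          then show ?thesis using bd[of "x + s *\<^sub>R (b - a)"]
            by (auto simp: abs_mult mult.commute[of M] intro!: mult_left_mono)
        next
          case False
          have "norm (s *\<^sub>R (b - a)) \<le> norm (b - a)" using True by (simp add: mult_left_le_one_le)
          then have "norm (x + s *\<^sub>R (b - a)) > R"
            using False norm_triangle_ineq4[of "x + s *\<^sub>R (b - a)" "s *\<^sub>R (b - a)"] by simp
          then show ?thesis by (simp add: out M)
        qed
        then show "AE x in lborel. \<bar>v x * \<psi> (x + s *\<^sub>R (b - a))\<bar> \<le> M * \<bar>indicator (cball 0 (R + norm (b - a))) x * v x\<bar>"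
          by simp
      qed (use M in simp)
      also have "\<dots> = C" by (simp add: C_def)
      finally show ?thesis using True by simp
    qed auto
    then show "AE s in lborel. norm (\<integral>x. norm (?f (s, x)) \<partial>lborel) \<le> norm (C * indicator {0..1} s)"
      by (intro AE_I2) (force simp: abs_of_nonneg intro: order_trans[OF _ abs_ge_self])
  qed measurable
qed

lemma segment_avg_measurable:
  assumes [measurable]: "v \<in> borel_measurable borel"
  shows "segment_avg h v \<in> borel_measurable borel"
  unfolding segment_avg_def by measurable

lemma segment_avg_mult:
  "segment_avg h v x * c = (\<integral>s. indicator {0..1} s * (v (x + s *\<^sub>R h) * c) \<partial>lborel)"
  unfolding segment_avg_def by (subst integral_mult_left_zero[symmetric]) (simp add: mult.assoc)

lemma
  fixes v :: "real^'n \<Rightarrow> real"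
  assumes v: "loc_int v" and \<psi>: "\<psi> \<in> borel_measurable borel"
    and bd: "\<And>x. \<bar>\<psi> x\<bar> \<le> M" and out: "\<And>x. norm x > R \<Longrightarrow> \<psi> x = 0"
  shows integrable_segment_avg_mult: "integrable lborel (\<lambda>x. segment_avg h v x * \<psi> x)"
    and integral_segment_avg_mult: "(\<integral>x. segment_avg h v x * \<psi> x \<partial>lborel)
      = (\<integral>s. indicator {0..1} s * (\<integral>x. v (x + s *\<^sub>R h) * \<psi> x \<partial>lborel) \<partial>lborel)"
proof -
  have int: "integrable (lborel \<Otimes>\<^sub>M lborel) (\<lambda>(s, x). indicator {0..1::real} s * (v (x + s *\<^sub>R h) * \<psi> x))"
    using integrable_segment_product[OF v \<psi> bd out, where a = h and b = 0] by simp
  show "integrable lborel (\<lambda>x. segment_avg h v x * \<psi> x)"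
    using lborel_pair.integrable_snd[OF int] by (simp add: segment_avg_mult)
  show "(\<integral>x. segment_avg h v x * \<psi> x \<partial>lborel)
      = (\<integral>s. indicator {0..1} s * (\<integral>x. v (x + s *\<^sub>R h) * \<psi> x \<partial>lborel) \<partial>lborel)"
    using lborel_pair.Fubini_integral[OF int] by (simp add: segment_avg_mult)
qed

lemma loc_int_segment_avg:
  assumes v: "loc_int v"
  shows "loc_int (segment_avg h v)"
  unfolding loc_int_def
proof safe
  show "segment_avg h v \<in> borel_measurable borel"
    by (rule segment_avg_measurable[OF loc_int_measurable[OF v]])
  fix R :: real
  have "integrable lborel (\<lambda>x. segment_avg h v x * indicator (cball 0 R) x)"
    by (rule integrable_segment_avg_mult[OF v, where M = 1 and R = R]) (auto simp: indicator_def)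
  then show "integrable lborel (\<lambda>x. indicator (cball 0 R) x * segment_avg h v x)"
    by (simp add: mult.commute)
qed

text \<open>
  Tonelli's theorem. Where \<open>v\<close> is not integrable along the segment, its mean has the default
  value \<open>0\<close>, but then the integral of \<open>|v - w|\<close> along the segment is infinite.
\<close>

lemma nn_integral_segment_avg_le:
  fixes v :: "real^'n \<Rightarrow> real"
  assumes [measurable]: "v \<in> borel_measurable borel" "w \<in> borel_measurable borel" "B \<in> sets borel"
    and le: "\<And>s. 0 \<le> s \<Longrightarrow> s \<le> 1 \<Longrightarrow> (\<integral>\<^sup>+x. indicator B x * ennreal \<bar>v (x + s *\<^sub>R h) - w x\<bar> \<partial>lborel) \<le> C"
  shows "(\<integral>\<^sup>+x. indicator B x * ennreal \<bar>segment_avg h v x - w x\<bar> \<partial>lborel) \<le> C"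
proof -
  have "ennreal \<bar>segment_avg h v x - w x\<bar> \<le> (\<integral>\<^sup>+s. indicator {0..1::real} s * ennreal \<bar>v (x + s *\<^sub>R h) - w x\<bar> \<partial>lborel)" for x
  proof (cases "integrable lborel (\<lambda>s. indicator {0..1} s * v (x + s *\<^sub>R h))")
    case True
    have ind: "integrable lborel (\<lambda>s. indicator {0..1::real} s * w x)" by auto
    have "segment_avg h v x - w x = (\<integral>s. indicator {0..1} s * v (x + s *\<^sub>R h) - indicator {0..1::real} s * w x \<partial>lborel)"
      using True ind by (simp add: segment_avg_def)
    also have "ennreal (norm \<dots>) \<le> (\<integral>\<^sup>+s. ennreal (norm (indicator {0..1} s * v (x + s *\<^sub>R h) - indicator {0..1::real} s * w x)) \<partial>lborel)"
      using True ind by (intro integral_norm_bound_ennreal) auto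
    also have "\<dots> = (\<integral>\<^sup>+s. indicator {0..1::real} s * ennreal \<bar>v (x + s *\<^sub>R h) - w x\<bar> \<partial>lborel)"
      by (auto intro!: nn_integral_cong simp: indicator_def)
    finally show ?thesis by simp
  next
    case False
    have "\<not> integrable lborel (\<lambda>s. indicator {0..1::real} s * (v (x + s *\<^sub>R h) - w x))"
    proof
      assume "integrable lborel (\<lambda>s. indicator {0..1::real} s * (v (x + s *\<^sub>R h) - w x))"
      then have "integrable lborel (\<lambda>s. indicator {0..1::real} s * (v (x + s *\<^sub>R h) - w x) + indicator {0..1::real} s * w x)"
        by (intro Bochner_Integration.integrable_add) auto
      then show False using False by (simp add: algebra_simps)
    qed
    then have "(\<integral>\<^sup>+s. ennreal (norm (indicator {0..1::real} s * (v (x + s *\<^sub>R h) - w x))) \<partial>lborel) = \<infinity>"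
      by (auto simp: integrable_iff_bounded less_top[symmetric])
    moreover have "(\<integral>\<^sup>+s. ennreal (norm (indicator {0..1::real} s * (v (x + s *\<^sub>R h) - w x))) \<partial>lborel)
        = (\<integral>\<^sup>+s. indicator {0..1::real} s * ennreal \<bar>v (x + s *\<^sub>R h) - w x\<bar> \<partial>lborel)"
      by (auto intro!: nn_integral_cong simp: indicator_def)
    ultimately show ?thesis by simp
  qed
  then have "(\<integral>\<^sup>+x. indicator B x * ennreal \<bar>segment_avg h v x - w x\<bar> \<partial>lborel)
    \<le> (\<integral>\<^sup>+x. indicator B x * (\<integral>\<^sup>+s. indicator {0..1::real} s * ennreal \<bar>v (x + s *\<^sub>R h) - w x\<bar> \<partial>lborel) \<partial>lborel)"
    by (intro nn_integral_mono mult_left_mono) auto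
  also have "\<dots> = (\<integral>\<^sup>+x. (\<integral>\<^sup>+s. indicator {0..1::real} s * (indicator B x * ennreal \<bar>v (x + s *\<^sub>R h) - w x\<bar>) \<partial>lborel) \<partial>lborel)"
    by (subst nn_integral_cmult[symmetric]) (auto simp: ac_simps)
  also have "\<dots> = (\<integral>\<^sup>+s. (\<integral>\<^sup>+x. indicator {0..1::real} s * (indicator B x * ennreal \<bar>v (x + s *\<^sub>R h) - w x\<bar>) \<partial>lborel) \<partial>lborel)"
    by (rule lborel_pair.Fubini') measurable
  also have "\<dots> \<le> (\<integral>\<^sup>+s. C * indicator {0..1::real} s \<partial>lborel)"
  proof (intro nn_integral_mono)
    fix s :: real
    show "(\<integral>\<^sup>+x. indicator {0..1::real} s * (indicator B x * ennreal \<bar>v (x + s *\<^sub>R h) - w x\<bar>) \<partial>lborel) \<le> C * indicator {0..1} s"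
      using le[of s] by (cases "s \<in> {0..1}") auto
  qed
  also have "\<dots> = C" by (simp add: nn_integral_cmult_indicator)
  finally show ?thesis .
qed

section \<open>Weak partial derivatives\<close>

text \<open>
  Short segments starting in a ball stay in a slightly larger ball, so that the continuity of
  translations applies to a cut-off of \<open>d\<close>.
\<close>

lemma segment_avg_tendsto_L1_local:
  fixes d :: "real^'n \<Rightarrow> real"
  assumes d: "loc_int d" and h: "h \<longlonglongrightarrow> 0"
  shows "(\<lambda>m. \<integral>x. indicator (cball 0 R) x * \<bar>segment_avg (h m) d x - d x\<bar> \<partial>lborel) \<longlonglongrightarrow> 0"
proof (rule LIMSEQ_I)
  fix e :: real assume e: "e > 0"
  note [measurable] = loc_int_measurable[OF d] segment_avg_measurable[OF loc_int_measurable[OF d]]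
  have cb[measurable]: "cball (0::real^'n) R \<in> sets borel" for R by simp
  define d' where "d' = (\<lambda>x. indicator (cball 0 (R + 1)) x * d x)"
  have d': "integrable lborel d'" using d unfolding d'_def loc_int_def by simp
  obtain \<delta> where \<delta>: "\<delta> > 0" "\<And>h. norm h < \<delta> \<Longrightarrow> (\<integral>x. \<bar>d' (x + h) - d' x\<bar> \<partial>lborel) \<le> e / 2"
    using L1_translation_continuous[OF d', of "e / 2"] e by auto
  have bound: "(\<integral>x. indicator (cball 0 R) x * \<bar>segment_avg h d x - d x\<bar> \<partial>lborel) \<le> e / 2"
    if h: "norm h < min \<delta> 1" for h
  proof -
    have "(\<integral>\<^sup>+x. indicator (cball 0 R) x * ennreal \<bar>segment_avg h d x - d x\<bar> \<partial>lborel) \<le> ennreal (e / 2)"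
    proof (rule nn_integral_segment_avg_le)
      fix s :: real assume s: "0 \<le> s" "s \<le> 1"
      have sh: "norm (s *\<^sub>R h) \<le> norm h" using s by (simp add: mult_left_le_one_le)
      have "(\<integral>\<^sup>+x. indicator (cball 0 R) x * ennreal \<bar>d (x + s *\<^sub>R h) - d x\<bar> \<partial>lborel)
        \<le> (\<integral>\<^sup>+x. ennreal \<bar>d' (x + s *\<^sub>R h) - d' x\<bar> \<partial>lborel)"
      proof (rule nn_integral_mono)
        fix x :: "real^'n"
        have "norm (x + s *\<^sub>R h) \<le> R + 1" if "norm x \<le> R"
          using norm_triangle_ineq[of x "s *\<^sub>R h"] sh h that by simp
        then show "indicator (cball 0 R) x * ennreal \<bar>d (x + s *\<^sub>R h) - d x\<bar>
          \<le> ennreal \<bar>d' (x + s *\<^sub>R h) - d' x\<bar>"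
          by (auto simp: d'_def indicator_def)
      qed
      also have "\<dots> = ennreal (\<integral>x. \<bar>d' (x + s *\<^sub>R h) - d' x\<bar> \<partial>lborel)"
        by (rule nn_integral_eq_integral) (use d' integrable_lborel_translate[OF d', of "s *\<^sub>R h"] in auto)
      also have "\<dots> \<le> ennreal (e / 2)" using \<delta>(2)[of "s *\<^sub>R h"] sh h by (intro ennreal_leI) auto
      finally show "(\<integral>\<^sup>+x. indicator (cball 0 R) x * ennreal \<bar>d (x + s *\<^sub>R h) - d x\<bar> \<partial>lborel) \<le> ennreal (e / 2)" .
    qed measurable
    also have "(\<integral>\<^sup>+x. indicator (cball 0 R) x * ennreal \<bar>segment_avg h d x - d x\<bar> \<partial>lborel)
      = (\<integral>\<^sup>+x. ennreal (indicator (cball 0 R) x * \<bar>segment_avg h d x - d x\<bar>) \<partial>lborel)"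
      by (auto intro!: nn_integral_cong simp: indicator_def)
    finally have "enn2real (\<integral>\<^sup>+x. ennreal (indicator (cball 0 R) x * \<bar>segment_avg h d x - d x\<bar>) \<partial>lborel) \<le> e / 2"
      by (rule enn2real_leI[rotated]) (use e in simp)
    then show ?thesis
      by (subst integral_eq_nn_integral) auto
  qed
  have "\<forall>\<^sub>F m in sequentially. norm (h m) < min \<delta> 1"
    using h \<delta>(1) by (auto simp: tendsto_iff dist_norm dest!: spec[of _ "min \<delta> 1"])
  then obtain N where N: "\<And>m. m \<ge> N \<Longrightarrow> norm (h m) < min \<delta> 1"
    unfolding eventually_sequentially by blast
  show "\<exists>N. \<forall>m\<ge>N. norm ((\<integral>x. indicator (cball 0 R) x * \<bar>segment_avg (h m) d x - d x\<bar> \<partial>lborel) - 0) < e"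
  proof (intro exI[of _ N] allI impI)
    fix m assume "m \<ge> N"
    have "0 \<le> (\<integral>x. indicator (cball 0 R) x * \<bar>segment_avg (h m) d x - d x\<bar> \<partial>lborel)" by simp
    then show "norm ((\<integral>x. indicator (cball 0 R) x * \<bar>segment_avg (h m) d x - d x\<bar> \<partial>lborel) - 0) < e"
      using bound[OF N[OF \<open>m \<ge> N\<close>]] e by simp
  qed
qed

lemma test_fun_DERIV_line:
  assumes "test_fun \<phi>"
  shows "((\<lambda>s. \<phi> (x + (c * s) *\<^sub>R axis j 1)) has_real_derivative
    c * partial_deriv j \<phi> (x + (c * s) *\<^sub>R axis j 1)) (at s)"
proof -
  let ?y = "x + (c * s) *\<^sub>R axis j 1"
  have D: "(\<phi> has_derivative frechet_derivative \<phi> (at ?y)) (at ?y)"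
    using test_fun_differentiable[OF assms] frechet_derivative_works by blast
  have "((\<lambda>s. \<phi> (x + (c * s) *\<^sub>R axis j 1)) has_derivative
     (\<lambda>r. frechet_derivative \<phi> (at ?y) ((c * r) *\<^sub>R axis j 1))) (at s)"
    by (rule has_derivative_compose[of "\<lambda>s. x + (c * s) *\<^sub>R axis j 1", OF _ D]) (auto intro!: derivative_eq_intros)
  moreover have "frechet_derivative \<phi> (at ?y) ((c * r) *\<^sub>R axis j 1) = c * partial_deriv j \<phi> ?y * r" for r
    using linear_cmul[OF has_derivative_linear[OF D]] by (simp add: partial_deriv_def)
  ultimately show ?thesis by (simp add: has_field_derivative_def)
qed

lemma test_fun_increment_le:
  assumes \<phi>: "test_fun \<phi>" and M: "\<And>x. \<bar>partial_deriv j \<phi> x\<bar> \<le> M"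
  shows "\<bar>\<phi> (x + t *\<^sub>R axis j 1) - \<phi> x\<bar> \<le> M * \<bar>t\<bar>"
proof -
  have "norm (\<phi> (x + (1 * t) *\<^sub>R axis j 1) - \<phi> (x + (1 * 0) *\<^sub>R axis j 1)) \<le> M * norm (t - 0)"
    by (rule field_differentiable_bound[of UNIV, OF convex_UNIV test_fun_DERIV_line[OF \<phi>]]) (use M in auto)
  then show ?thesis by simp
qed

definition weak_partial :: "'n \<Rightarrow> (real^'n \<Rightarrow> real) \<Rightarrow> (real^'n \<Rightarrow> real) \<Rightarrow> bool" where
  "weak_partial j v d \<longleftrightarrow> loc_int v \<and> loc_int d \<and>
     (\<forall>\<phi>. test_fun \<phi> \<longrightarrow>
        (\<integral>x. v x * partial_deriv j \<phi> x \<partial>lborel) = - (\<integral>x. d x * \<phi> x \<partial>lborel))"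

lemma test_fun_measurable:
  assumes "test_fun \<phi>"
  shows "\<phi> \<in> borel_measurable borel" "partial_deriv j \<phi> \<in> borel_measurable borel"
  using assms by (auto intro: borel_measurable_continuous_onI test_fun_continuous)

lemma integrable_mult_test_fun:
  assumes v: "loc_int v" and \<phi>: "test_fun \<phi>"
  shows "integrable lborel (\<lambda>x. v x * \<phi> x)" "integrable lborel (\<lambda>x. v x * partial_deriv j \<phi> x)"
proof -
  obtain M R where MR: "\<And>x. \<bar>\<phi> x\<bar> \<le> M" "\<And>x. \<bar>partial_deriv j \<phi> x\<bar> \<le> M"
    "\<And>x. norm x > R \<Longrightarrow> \<phi> x = 0" "\<And>x. norm x > R \<Longrightarrow> partial_deriv j \<phi> x = 0"
    using test_fun_bounded[OF \<phi>, of j] by metis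
  show "integrable lborel (\<lambda>x. v x * \<phi> x)"
    by (rule integrable_mult_loc_int[OF v test_fun_measurable(1)[OF \<phi>] MR(1,3)])
  show "integrable lborel (\<lambda>x. v x * partial_deriv j \<phi> x)"
    by (rule integrable_mult_loc_int[OF v test_fun_measurable(2)[OF \<phi>] MR(2,4)])
qed

text \<open>
  The fundamental theorem of calculus for weak derivatives. Tested against \<open>\<phi>\<close>, the increment
  of \<open>v\<close> becomes an increment of \<open>\<phi>\<close>, which is the integral of its derivative along a segment;
  the definition of the weak derivative is applied to each translate of \<open>\<phi>\<close>, and the fundamental
  lemma removes \<open>\<phi>\<close>.
\<close>

lemma weak_partial_increment:
  fixes v :: "real^'n \<Rightarrow> real"
  assumes vd: "weak_partial j v d"
  shows "AE x in lborel. v (x + t *\<^sub>R axis j 1) - v x = t * segment_avg (t *\<^sub>R axis j 1) d x"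
proof -
  define h :: "real^'n" where "h = t *\<^sub>R axis j 1"
  have v: "loc_int v" and d: "loc_int d"
    and parts: "\<And>\<phi>. test_fun \<phi> \<Longrightarrow> (\<integral>x. v x * partial_deriv j \<phi> x \<partial>lborel) = - (\<integral>x. d x * \<phi> x \<partial>lborel)"
    using vd by (auto simp: weak_partial_def)
  note [measurable] = loc_int_measurable[OF v] loc_int_measurable[OF d]
  define D where "D = (\<lambda>x. v (x + h) + (- 1) * v x + (- t) * segment_avg h d x)"
  have D: "loc_int D" unfolding D_def
    by (intro loc_int_add loc_int_cmult loc_int_translate loc_int_segment_avg v d)
  have zero: "(\<integral>x. D x * \<phi> x \<partial>lborel) = 0" if \<phi>: "test_fun \<phi>" for \<phi>
  proof -
    note [measurable] = test_fun_measurable[OF \<phi>]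
    obtain M R where MR: "\<And>x. \<bar>\<phi> x\<bar> \<le> M" "\<And>x. \<bar>partial_deriv j \<phi> x\<bar> \<le> M"
      "\<And>x. norm x > R \<Longrightarrow> \<phi> x = 0" "\<And>x. norm x > R \<Longrightarrow> partial_deriv j \<phi> x = 0"
      using test_fun_bounded[OF \<phi>, of j] by metis
    have \<phi>': "test_fun (\<lambda>x. \<phi> (x + y))" for y by (rule test_fun_translate[OF \<phi>])
    have FTC: "\<phi> (x - h) - \<phi> x = (\<integral>s. indicator {0..1} s * (- t * partial_deriv j \<phi> (x + s *\<^sub>R (- h))) \<partial>lborel)" for x
    proof -
      have "(\<integral>s. indicator {0..1} s *\<^sub>R (- t * partial_deriv j \<phi> (x + (- t * s) *\<^sub>R axis j 1)) \<partial>lborel)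
        = \<phi> (x + (- t * 1) *\<^sub>R axis j 1) - \<phi> (x + (- t * 0) *\<^sub>R axis j 1)"
      proof (rule integral_FTC_atLeastAtMost)
        fix s show "((\<lambda>s. \<phi> (x + (- t * s) *\<^sub>R axis j 1)) has_vector_derivative
           - t * partial_deriv j \<phi> (x + (- t * s) *\<^sub>R axis j 1)) (at s within {0..1})"
          using test_fun_DERIV_line[OF \<phi>, of x "- t" j s]
          by (simp add: has_real_derivative_iff_has_vector_derivative has_vector_derivative_at_within)
        show "continuous_on {0..1} (\<lambda>s. - t * partial_deriv j \<phi> (x + (- t * s) *\<^sub>R axis j 1))"
          by (intro continuous_intros continuous_on_compose2[OF test_fun_continuous(2)[OF \<phi>]]) auto
      qed simp
      then show ?thesis by (simp add: h_def mult.commute)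
    qed
    have shift: "(\<integral>x. v (x + h) * \<phi> x \<partial>lborel) = (\<integral>x. v x * \<phi> (x - h) \<partial>lborel)"
      using integral_lborel_translate[of "\<lambda>x. v x * \<phi> (x - h)" h] by simp
    have int1: "integrable lborel (\<lambda>x. v x * \<phi> (x - h))"
      using integrable_mult_test_fun(1)[OF v \<phi>'[of "- h"]] by simp
    have inth: "integrable lborel (\<lambda>x. v (x + h) * \<phi> x)"
      by (rule integrable_mult_test_fun(1)[OF loc_int_translate[OF v] \<phi>])
    note int2 = integrable_mult_test_fun(1)[OF v \<phi>]
    note int3 = integrable_mult_test_fun(1)[OF loc_int_segment_avg[OF d] \<phi>, of h]
    have "(\<integral>x. v (x + h) * \<phi> x \<partial>lborel) - (\<integral>x. v x * \<phi> x \<partial>lborel)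
       = (\<integral>x. v x * (\<phi> (x - h) - \<phi> x) \<partial>lborel)"
      unfolding shift using int1 int2 by (simp add: right_diff_distrib)
    also have "\<dots> = (\<integral>x. - t * (\<integral>s. indicator {0..1} s * (v x * partial_deriv j \<phi> (x + s *\<^sub>R (- h))) \<partial>lborel) \<partial>lborel)"
      unfolding FTC by (rule Bochner_Integration.integral_cong[OF refl],
        subst (1 2) integral_mult_right_zero[symmetric]) (simp add: ac_simps)
    also have "\<dots> = - t * (\<integral>x. (\<integral>s. indicator {0..1} s * (v x * partial_deriv j \<phi> (x + s *\<^sub>R (- h))) \<partial>lborel) \<partial>lborel)"
      by simp
    also have "(\<integral>x. (\<integral>s. indicator {0..1} s * (v x * partial_deriv j \<phi> (x + s *\<^sub>R (- h))) \<partial>lborel) \<partial>lborel)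
      = (\<integral>s. (\<integral>x. indicator {0..1} s * (v x * partial_deriv j \<phi> (x + s *\<^sub>R (- h))) \<partial>lborel) \<partial>lborel)"
    proof (rule lborel_pair.Fubini_integral)
      show "integrable (lborel \<Otimes>\<^sub>M lborel) (\<lambda>(s, x). indicator {0..1} s * (v x * partial_deriv j \<phi> (x + s *\<^sub>R (- h))))"
        using integrable_segment_product[OF v test_fun_measurable(2)[OF \<phi>] MR(2,4), where a = 0 and b = "- h"] by simp
    qed
    also have "\<dots> = (\<integral>s. indicator {0..1} s * - (\<integral>x. d (x + s *\<^sub>R h) * \<phi> x \<partial>lborel) \<partial>lborel)"
    proof (rule Bochner_Integration.integral_cong[OF refl])
      fix s :: real
      have "(\<integral>x. v x * partial_deriv j \<phi> (x + s *\<^sub>R (- h)) \<partial>lborel)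
        = (\<integral>x. v x * partial_deriv j (\<lambda>x. \<phi> (x + s *\<^sub>R (- h))) x \<partial>lborel)"
        by (simp only: partial_deriv_translate[OF test_fun_differentiable[OF \<phi>]])
      also have "\<dots> = - (\<integral>x. d x * \<phi> (x + s *\<^sub>R (- h)) \<partial>lborel)" by (rule parts[OF \<phi>'])
      also have "(\<integral>x. d x * \<phi> (x + s *\<^sub>R (- h)) \<partial>lborel) = (\<integral>x. d (x + s *\<^sub>R h) * \<phi> x \<partial>lborel)"
        using integral_lborel_translate[of "\<lambda>x. d x * \<phi> (x + s *\<^sub>R (- h))" "s *\<^sub>R h"] by simp
      finally show "(\<integral>x. indicator {0..1} s * (v x * partial_deriv j \<phi> (x + s *\<^sub>R (- h))) \<partial>lborel)
        = indicator {0..1} s * - (\<integral>x. d (x + s *\<^sub>R h) * \<phi> x \<partial>lborel)"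
        by simp
    qed
    also have "\<dots> = - (\<integral>x. segment_avg h d x * \<phi> x \<partial>lborel)"
      using integral_segment_avg_mult[OF d test_fun_measurable(1)[OF \<phi>] MR(1,3), where h = h] by simp
    finally have "(\<integral>x. v (x + h) * \<phi> x \<partial>lborel) - (\<integral>x. v x * \<phi> x \<partial>lborel) = t * (\<integral>x. segment_avg h d x * \<phi> x \<partial>lborel)"
      by simp
    moreover have "(\<integral>x. D x * \<phi> x \<partial>lborel) = (\<integral>x. v (x + h) * \<phi> x - v x * \<phi> x - t * (segment_avg h d x * \<phi> x) \<partial>lborel)"
      unfolding D_def by (simp add: algebra_simps)
    ultimately show ?thesis using inth int2 int3 by simp
  qed
  have "AE x in lborel. D x = 0"
    by (rule AE_eq_zero_if_test_integrals_zero[OF D]) (rule zero)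
  then show ?thesis
    unfolding D_def h_def by eventually_elim simp
qed

text \<open>
  For \<open>c = 0\<close> the one-sided quotients of the absolute value tend to \<open>|d|\<close> and \<open>-|d|\<close>. Their mean,
  the symmetric quotient, therefore has the limit \<open>sgn c * d\<close> in all cases.
\<close>

lemma symmetric_quotient_abs_tendsto:
  fixes a b t :: "nat \<Rightarrow> real"
  assumes a: "a \<longlonglongrightarrow> d" and b: "b \<longlonglongrightarrow> d" and t: "t \<longlonglongrightarrow> 0" and pos: "\<And>m. t m > 0"
  shows "(\<lambda>m. (\<bar>c + t m * a m\<bar> - \<bar>c - t m * b m\<bar>) / (2 * t m)) \<longlonglongrightarrow> sgn c * d"
proof -
  have A: "(\<lambda>m. c + t m * a m) \<longlonglongrightarrow> c + 0 * d" and B: "(\<lambda>m. c - t m * b m) \<longlonglongrightarrow> c - 0 * d"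
    by (intro tendsto_intros a b t)+
  have nz: "2 * t m \<noteq> 0" for m using pos[of m] by simp
  consider "c > 0" | "c < 0" | "c = 0" by linarith
  then show ?thesis
  proof cases
    case 1
    have "(\<lambda>m. (a m + b m) / 2) \<longlonglongrightarrow> (d + d) / 2" by (intro tendsto_intros a b) auto
    moreover have "\<forall>\<^sub>F m in sequentially. (a m + b m) / 2 = (\<bar>c + t m * a m\<bar> - \<bar>c - t m * b m\<bar>) / (2 * t m)"
    proof -
      have "\<forall>\<^sub>F m in sequentially. c + t m * a m > 0" "\<forall>\<^sub>F m in sequentially. c - t m * b m > 0"
        using order_tendstoD(1)[OF A, of 0] order_tendstoD(1)[OF B, of 0] 1 by simp_all
      then show ?thesis
        by eventually_elim (use nz in \<open>simp add: field_simps\<close>)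
    qed
    ultimately show ?thesis using 1 by (auto elim: Lim_transform_eventually)
  next
    case 2
    have "(\<lambda>m. - (a m + b m) / 2) \<longlonglongrightarrow> - (d + d) / 2" by (intro tendsto_intros a b) auto
    moreover have "\<forall>\<^sub>F m in sequentially. - (a m + b m) / 2 = (\<bar>c + t m * a m\<bar> - \<bar>c - t m * b m\<bar>) / (2 * t m)"
    proof -
      have "\<forall>\<^sub>F m in sequentially. c + t m * a m < 0" "\<forall>\<^sub>F m in sequentially. c - t m * b m < 0"
        using order_tendstoD(2)[OF A, of 0] order_tendstoD(2)[OF B, of 0] 2 by simp_all
      then show ?thesis
        by eventually_elim (use nz in \<open>simp add: field_simps\<close>)
    qed
    ultimately show ?thesis using 2 by (auto elim: Lim_transform_eventually)
  next
    case 3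
    have "(\<lambda>m. (\<bar>a m\<bar> - \<bar>b m\<bar>) / 2) \<longlonglongrightarrow> (\<bar>d\<bar> - \<bar>d\<bar>) / 2" by (intro tendsto_intros a b) auto
    moreover have "(\<bar>a m\<bar> - \<bar>b m\<bar>) / 2 = (\<bar>c + t m * a m\<bar> - \<bar>c - t m * b m\<bar>) / (2 * t m)" for m
      using pos[of m] 3 by (simp add: abs_mult field_simps)
    ultimately show ?thesis using 3 by simp
  qed
qed


lemma symmetric_quotient_test_fun_tendsto:
  assumes \<phi>: "test_fun \<phi>" and t: "t \<longlonglongrightarrow> 0" and pos: "\<And>m. t m > 0"
  shows "(\<lambda>m. (\<phi> (x - t m *\<^sub>R axis j 1) - \<phi> (x + t m *\<^sub>R axis j 1)) / (2 * t m))
    \<longlonglongrightarrow> - partial_deriv j \<phi> x"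
proof -
  have one_sided: "(\<lambda>m. (\<phi> (x + (c * t m) *\<^sub>R axis j 1) - \<phi> x) / t m) \<longlonglongrightarrow> c * partial_deriv j \<phi> x" for c
  proof -
    have "((\<lambda>s. (\<phi> (x + (c * (0 + s)) *\<^sub>R axis j 1) - \<phi> (x + (c * 0) *\<^sub>R axis j 1)) / s)
       \<longlongrightarrow> c * partial_deriv j \<phi> (x + (c * 0) *\<^sub>R axis j 1)) (at 0)"
      using test_fun_DERIV_line[OF \<phi>, of x c j 0] by (simp only: DERIV_def)
    moreover have "filterlim t (at 0) sequentially"
      using t pos by (auto simp: filterlim_at intro!: always_eventually) (metis less_irrefl)
    ultimately show ?thesis by (auto dest: filterlim_compose)
  qed
  have "(\<lambda>m. ((\<phi> (x + (- 1 * t m) *\<^sub>R axis j 1) - \<phi> x) / t m - (\<phi> (x + (1 * t m) *\<^sub>R axis j 1) - \<phi> x) / t m) / 2)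
    \<longlonglongrightarrow> (- 1 * partial_deriv j \<phi> x - 1 * partial_deriv j \<phi> x) / 2"
    by (intro tendsto_intros one_sided) auto
  moreover have "((\<phi> (x + (- 1 * t m) *\<^sub>R axis j 1) - \<phi> x) / t m - (\<phi> (x + (1 * t m) *\<^sub>R axis j 1) - \<phi> x) / t m) / 2
    = (\<phi> (x - t m *\<^sub>R axis j 1) - \<phi> (x + t m *\<^sub>R axis j 1)) / (2 * t m)" for m
    using pos[of m] by (simp add: field_simps)
  moreover have "(- 1 * partial_deriv j \<phi> x - 1 * partial_deriv j \<phi> x) / 2 = - partial_deriv j \<phi> x"
    by simp
  ultimately show ?thesis by (simp only:)
qed

text \<open>
  Symmetric difference quotients of \<open>|v - k|\<close> converge almost everywhere to \<open>sgn (v - k) d\<close>, also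
  on the set \<open>v = k\<close>, and they are dominated by the difference quotients of \<open>v\<close>, which converge in
  \<open>L\<^sup>1\<close>. No smoothing of \<open>v\<close> or of the absolute value is involved.
\<close>

lemma weak_partial_abs_diff:
  fixes v :: "real^'n \<Rightarrow> real"
  assumes vd: "weak_partial j v d"
  shows "weak_partial j (\<lambda>x. \<bar>v x - k\<bar>) (\<lambda>x. sgn (v x - k) * d x)"
proof -
  have v: "loc_int v" and d: "loc_int d" using vd by (auto simp: weak_partial_def)
  note [measurable] = loc_int_measurable[OF v] loc_int_measurable[OF d]
    segment_avg_measurable[OF loc_int_measurable[OF d]]
  define w where "w = (\<lambda>x. \<bar>v x - k\<bar>)"
  have w: "loc_int w" unfolding w_def
    by (rule loc_int_dominated[OF v, of _ "\<bar>k\<bar>"]) auto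
  note [measurable] = loc_int_measurable[OF w]
  define L where "L = (\<lambda>x. sgn (v x - k) * d x)"
  have L: "loc_int L" unfolding L_def
    by (rule loc_int_dominated[OF d, of _ 0]) (auto simp: sgn_real_def)
  note [measurable] = loc_int_measurable[OF L]
  define e :: "real^'n" where "e = axis j 1"
  have ne: "norm e = 1" by (simp add: e_def)
  have "(\<integral>x. w x * partial_deriv j \<phi> x \<partial>lborel) = - (\<integral>x. L x * \<phi> x \<partial>lborel)" if \<phi>: "test_fun \<phi>" for \<phi>
  proof -
    note [measurable] = test_fun_measurable[OF \<phi>]
    obtain M R where M: "M > 0" and MR: "\<And>x. \<bar>\<phi> x\<bar> \<le> M" "\<And>x. \<bar>partial_deriv j \<phi> x\<bar> \<le> M"
      "\<And>x. norm x > R \<Longrightarrow> \<phi> x = 0" "\<And>x. norm x > R \<Longrightarrow> partial_deriv j \<phi> x = 0"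
      using test_fun_bounded[OF \<phi>, of j] by metis
    define B where "B = cball (0::real^'n) R"
    have [measurable]: "B \<in> sets borel" by (simp add: B_def)
    define A where "A = (\<lambda>m. segment_avg ((1 / real (Suc m)) *\<^sub>R e) d)"
    define A' where "A' = (\<lambda>m. segment_avg ((- 1 / real (Suc m)) *\<^sub>R e) d)"
    have [measurable]: "A m \<in> borel_measurable borel" "A' m \<in> borel_measurable borel" for m
      by (auto simp: A_def A'_def)
    have li: "loc_int (A m)" "loc_int (A' m)" for m by (auto simp: A_def A'_def intro: loc_int_segment_avg d)
    define E where "E = (\<lambda>m x. indicator B x * (\<bar>A m x - d x\<bar> + \<bar>A' m x - d x\<bar>))"
    have int_part: "integrable lborel (\<lambda>x. indicator B x * \<bar>a x - d x\<bar>)" if "loc_int a" for a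
    proof -
      have "loc_int (\<lambda>x. a x + (- 1) * d x)" using that d by (intro loc_int_add loc_int_cmult)
      then have "integrable lborel (\<lambda>x. \<bar>indicator B x * (a x + (- 1) * d x)\<bar>)"
        unfolding loc_int_def B_def by auto
      then show ?thesis by (simp add: abs_mult)
    qed
    have Eint: "integrable lborel (E m)" for m
      unfolding E_def distrib_left by (intro Bochner_Integration.integrable_add int_part li)
    have E0: "E m x \<ge> 0" for m x by (simp add: E_def)
    have inv: "(\<lambda>m. 1 / real (Suc m)) \<longlonglongrightarrow> 0" "(\<lambda>m. - 1 / real (Suc m)) \<longlonglongrightarrow> - 0"
      using LIMSEQ_inverse_real_of_nat tendsto_minus[OF LIMSEQ_inverse_real_of_nat]
      by (simp_all add: inverse_eq_divide)
    have h0: "(\<lambda>m. (1 / real (Suc m)) *\<^sub>R e) \<longlonglongrightarrow> 0" "(\<lambda>m. (- 1 / real (Suc m)) *\<^sub>R e) \<longlonglongrightarrow> 0"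
      using tendsto_scaleR[OF inv(1) tendsto_const[of e]] tendsto_scaleR[OF inv(2) tendsto_const[of e]] by simp_all
    have "(\<lambda>m. (\<integral>x. indicator B x * \<bar>A m x - d x\<bar> \<partial>lborel) + (\<integral>x. indicator B x * \<bar>A' m x - d x\<bar> \<partial>lborel)) \<longlonglongrightarrow> 0 + 0"
      unfolding A_def A'_def B_def by (intro tendsto_add segment_avg_tendsto_L1_local d h0)
    moreover have "(\<integral>x. norm (E m x) \<partial>lborel) =
      (\<integral>x. indicator B x * \<bar>A m x - d x\<bar> \<partial>lborel) + (\<integral>x. indicator B x * \<bar>A' m x - d x\<bar> \<partial>lborel)" for m
      using E0 int_part[OF li(1)] int_part[OF li(2)] by (simp add: E_def distrib_left)
    ultimately have EL1: "(\<lambda>m. \<integral>x. norm (E m x) \<partial>lborel) \<longlonglongrightarrow> 0" by simp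
    \<comment> \<open>one subsequence along which the quotients in both directions converge almost everywhere\<close>
    obtain r :: "nat \<Rightarrow> nat" where r: "strict_mono r" and EAE: "AE x in lborel. (\<lambda>m. E (r m) x) \<longlonglongrightarrow> 0"
      using tendsto_L1_AE_subseq[OF Eint EL1] by blast
    define t where "t = (\<lambda>m. 1 / real (Suc (r m)))"
    have t: "t \<longlonglongrightarrow> 0" "\<And>m. t m > 0" "\<And>m. t m \<le> 1"
      using LIMSEQ_subseq_LIMSEQ[OF inv(1) r] by (auto simp: t_def o_def)
    define Q where "Q = (\<lambda>m x. (w (x + t m *\<^sub>R e) - w (x - t m *\<^sub>R e)) / (2 * t m))"
    have [measurable]: "Q m \<in> borel_measurable borel" for m unfolding Q_def by measurable
    have incr: "AE x in lborel. \<forall>m. v (x + t m *\<^sub>R e) = v x + t m * A (r m) x \<and>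
        v (x - t m *\<^sub>R e) = v x - t m * A' (r m) x"
      unfolding AE_all_countable
    proof
      fix m
      show "AE x in lborel. v (x + t m *\<^sub>R e) = v x + t m * A (r m) x \<and> v (x - t m *\<^sub>R e) = v x - t m * A' (r m) x"
        using weak_partial_increment[OF vd, of "t m"] weak_partial_increment[OF vd, of "- t m"]
        by eventually_elim (simp add: A_def A'_def t_def e_def algebra_simps)
    qed
    have Qlim: "AE x in lborel. x \<in> B \<longrightarrow> (\<lambda>m. Q m x) \<longlonglongrightarrow> L x"
      using incr EAE
    proof eventually_elim
      case (elim x)
      show ?case
      proof
        assume x: "x \<in> B"
        have "(\<lambda>m. A (r m) x - d x) \<longlonglongrightarrow> 0" "(\<lambda>m. A' (r m) x - d x) \<longlonglongrightarrow> 0"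
          by (rule tendsto_rabs_zero_cancel, rule tendsto_sandwich[OF _ _ tendsto_const elim(2)], use x in \<open>auto simp: E_def\<close>)+
        then have a: "(\<lambda>m. A (r m) x) \<longlonglongrightarrow> d x" "(\<lambda>m. A' (r m) x) \<longlonglongrightarrow> d x"
          by (simp_all add: LIM_zero_iff)
        have "Q m x = (\<bar>v x - k + t m * A (r m) x\<bar> - \<bar>v x - k - t m * A' (r m) x\<bar>) / (2 * t m)" for m
          unfolding Q_def w_def elim(1)[rule_format, THEN conjunct1] elim(1)[rule_format, THEN conjunct2]
          by (simp add: algebra_simps)
        then show "(\<lambda>m. Q m x) \<longlonglongrightarrow> L x"
          using symmetric_quotient_abs_tendsto[OF a t(1,2), of "v x - k"] by (simp add: L_def)
      qed
    qed
    have Qbound: "AE x in lborel. \<forall>m. x \<in> B \<longrightarrow> \<bar>Q m x\<bar> \<le> \<bar>d x\<bar> + E (r m) x"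
      using incr
    proof (eventually_elim, intro allI impI)
      fix x m assume inc: "\<forall>m. v (x + t m *\<^sub>R e) = v x + t m * A (r m) x \<and> v (x - t m *\<^sub>R e) = v x - t m * A' (r m) x"
        and x: "x \<in> B"
      have "\<bar>w (x + t m *\<^sub>R e) - w (x - t m *\<^sub>R e)\<bar> \<le> \<bar>t m * A (r m) x\<bar> + \<bar>t m * A' (r m) x\<bar>"
        using inc[rule_format, of m] unfolding w_def by linarith
      also have "\<dots> \<le> 2 * t m * (\<bar>d x\<bar> + (\<bar>A (r m) x - d x\<bar> + \<bar>A' (r m) x - d x\<bar>))"
      proof -
        have "\<bar>A (r m) x\<bar> + \<bar>A' (r m) x\<bar> \<le> 2 * (\<bar>d x\<bar> + (\<bar>A (r m) x - d x\<bar> + \<bar>A' (r m) x - d x\<bar>))"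
          by (smt (verit))
        from mult_left_mono[OF this less_imp_le[OF t(2)[of m]]] show ?thesis
          using t(2)[of m] by (simp add: abs_mult algebra_simps)
      qed
      finally show "\<bar>Q m x\<bar> \<le> \<bar>d x\<bar> + E (r m) x"
        using x t(2)[of m] by (simp add: Q_def E_def field_simps)
    qed
    have Qli: "loc_int (Q m)" for m
    proof -
      have "loc_int (\<lambda>x. (1 / (2 * t m)) * (w (x + t m *\<^sub>R e) + (- 1) * w (x + (- t m *\<^sub>R e))))"
        by (intro loc_int_cmult loc_int_add loc_int_translate w)
      then show ?thesis by (simp add: Q_def)
    qed
    \<comment> \<open>The quotients are dominated only up to \<open>E\<close>, which tends to \<open>0\<close> in \<open>L\<^sup>1\<close>. The part of the error that exceeds \<open>E\<close> is dominated by \<open>2 |d|\<close>.\<close>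
    define X where "X = (\<lambda>m x. max 0 (indicator B x * \<bar>Q m x - L x\<bar> - E (r m) x))"
    have [measurable]: "E m \<in> borel_measurable borel" for m unfolding E_def by measurable
    have dB: "integrable lborel (\<lambda>x. \<bar>indicator B x * d x\<bar>)"
      using d unfolding loc_int_def B_def by auto
    have Xlim: "(\<lambda>m. \<integral>x. X m x \<partial>lborel) \<longlonglongrightarrow> (\<integral>x. 0 \<partial>(lborel :: (real^'n) measure))"
    proof (rule integral_dominated_convergence[where w = "\<lambda>x. 2 * \<bar>indicator B x * d x\<bar>"])
      show "AE x in lborel. (\<lambda>m. X m x) \<longlonglongrightarrow> 0"
        using Qlim EAE
      proof eventually_elim
        case (elim x)
        have "(\<lambda>m. indicator B x * \<bar>Q m x - L x\<bar>) \<longlonglongrightarrow> 0"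
          using elim(1) by (cases "x \<in> B") (auto simp: tendsto_rabs_zero_iff LIM_zero_iff)
        then have "(\<lambda>m. max 0 (indicator B x * \<bar>Q m x - L x\<bar> - E (r m) x)) \<longlonglongrightarrow> max 0 (0 - 0)"
          by (intro tendsto_intros elim(2))
        then show ?case by (simp add: X_def)
      qed
      show "AE x in lborel. norm (X m x) \<le> 2 * \<bar>indicator B x * d x\<bar>" for m
        using Qbound
      proof eventually_elim
        case (elim x)
        have "\<bar>L x\<bar> \<le> \<bar>d x\<bar>" by (auto simp: L_def sgn_real_def)
        then show ?case using elim[rule_format, of m] E0[of "r m" x] by (auto simp: X_def indicator_def)
      qed
      show "X m \<in> borel_measurable lborel" for m unfolding X_def by measurable
    qed (use dB in auto)
    have Xint: "integrable lborel (X m)" for m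
    proof (rule Bochner_Integration.integrable_bound[OF dB[THEN integrable_mult_right[of 2]]])
      show "X m \<in> borel_measurable lborel" unfolding X_def by measurable
      show "AE x in lborel. norm (X m x) \<le> norm (2 * \<bar>indicator B x * d x\<bar>)"
        using Qbound
      proof eventually_elim
        case (elim x)
        have "\<bar>L x\<bar> \<le> \<bar>d x\<bar>" by (auto simp: L_def sgn_real_def)
        then show ?case using elim[rule_format, of m] E0[of "r m" x] by (auto simp: X_def indicator_def)
      qed
    qed
    have QL: "(\<lambda>m. \<integral>x. Q m x * \<phi> x \<partial>lborel) \<longlonglongrightarrow> (\<integral>x. L x * \<phi> x \<partial>lborel)"
    proof (rule LIM_zero_cancel, rule tendsto_rabs_zero_cancel, rule tendsto_sandwich[OF _ _ tendsto_const])
      show "\<forall>\<^sub>F m in sequentially. 0 \<le> \<bar>(\<integral>x. Q m x * \<phi> x \<partial>lborel) - (\<integral>x. L x * \<phi> x \<partial>lborel)\<bar>" by simp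
      show "(\<lambda>m. M * ((\<integral>x. X m x \<partial>lborel) + (\<integral>x. norm (E (r m) x) \<partial>lborel))) \<longlonglongrightarrow> 0"
        using tendsto_mult[OF tendsto_const[of M] tendsto_add[OF Xlim LIMSEQ_subseq_LIMSEQ[OF EL1 r]]]
        by (simp add: o_def)
      have "\<bar>(\<integral>x. Q m x * \<phi> x \<partial>lborel) - (\<integral>x. L x * \<phi> x \<partial>lborel)\<bar>
        \<le> M * ((\<integral>x. X m x \<partial>lborel) + (\<integral>x. norm (E (r m) x) \<partial>lborel))" for m
      proof -
        note i1 = integrable_mult_test_fun(1)[OF Qli[of m] \<phi>] and i2 = integrable_mult_test_fun(1)[OF L \<phi>]
        have "\<bar>(\<integral>x. Q m x * \<phi> x \<partial>lborel) - (\<integral>x. L x * \<phi> x \<partial>lborel)\<bar> = \<bar>\<integral>x. Q m x * \<phi> x - L x * \<phi> x \<partial>lborel\<bar>"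
          using i1 i2 by simp
        also have "\<dots> \<le> (\<integral>x. M * (X m x + norm (E (r m) x)) \<partial>lborel)"
        proof (rule integral_abs_bound_integral)
          fix x
          show "\<bar>Q m x * \<phi> x - L x * \<phi> x\<bar> \<le> M * (X m x + norm (E (r m) x))"
          proof (cases "x \<in> B")
            case True
            have "\<bar>Q m x * \<phi> x - L x * \<phi> x\<bar> = \<bar>\<phi> x\<bar> * \<bar>Q m x - L x\<bar>"
              by (simp add: abs_mult[symmetric] algebra_simps)
            also have "\<dots> \<le> M * (X m x + norm (E (r m) x))"
              using MR(1)[of x] M E0[of "r m" x] True by (intro mult_mono) (auto simp: X_def)
            finally show ?thesis .
          next
            case False
            then show ?thesis using MR(3)[of x] M by (auto simp: B_def X_def)
          qed
        qed (use i1 i2 Xint Eint in auto)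
        also have "\<dots> = M * ((\<integral>x. X m x \<partial>lborel) + (\<integral>x. norm (E (r m) x) \<partial>lborel))"
          using Xint Eint by simp
        finally show ?thesis .
      qed
      then show "\<forall>\<^sub>F m in sequentially. \<bar>(\<integral>x. Q m x * \<phi> x \<partial>lborel) - (\<integral>x. L x * \<phi> x \<partial>lborel)\<bar>
        \<le> M * ((\<integral>x. X m x \<partial>lborel) + (\<integral>x. norm (E (r m) x) \<partial>lborel))" by simp
    qed
    have move: "(\<integral>x. Q m x * \<phi> x \<partial>lborel)
      = (\<integral>x. w x * ((\<phi> (x - t m *\<^sub>R e) - \<phi> (x + t m *\<^sub>R e)) / (2 * t m)) \<partial>lborel)" for m
    proof -
      have tr: "(\<integral>x. w (x + y) * \<phi> x \<partial>lborel) = (\<integral>x. w x * \<phi> (x - y) \<partial>lborel)" for y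
        using integral_lborel_translate[of "\<lambda>x. w x * \<phi> (x - y)" y] by simp
      have i1: "integrable lborel (\<lambda>x. w (x + y) * \<phi> x)" "integrable lborel (\<lambda>x. w x * \<phi> (x + y))" for y
        by (rule integrable_mult_test_fun(1)[OF loc_int_translate[OF w] \<phi>],
          rule integrable_mult_test_fun(1)[OF w test_fun_translate[OF \<phi>]])
      have "(\<integral>x. Q m x * \<phi> x \<partial>lborel) = (\<integral>x. (w (x + t m *\<^sub>R e) * \<phi> x - w (x + - (t m *\<^sub>R e)) * \<phi> x) / (2 * t m) \<partial>lborel)"
        by (simp add: Q_def algebra_simps diff_divide_distrib)
      also have "\<dots> = ((\<integral>x. w x * \<phi> (x + - (t m *\<^sub>R e)) \<partial>lborel) - (\<integral>x. w x * \<phi> (x + t m *\<^sub>R e) \<partial>lborel)) / (2 * t m)"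
        unfolding integral_divide_zero
        by (subst Bochner_Integration.integral_diff[OF i1(1) i1(1)]) (use tr[of "t m *\<^sub>R e"] tr[of "- (t m *\<^sub>R e)"] in simp)
      also have "\<dots> = (\<integral>x. w x * ((\<phi> (x - t m *\<^sub>R e) - \<phi> (x + t m *\<^sub>R e)) / (2 * t m)) \<partial>lborel)"
        by (subst Bochner_Integration.integral_diff[OF i1(2) i1(2), symmetric])
           (simp add: integral_divide_zero[symmetric] algebra_simps diff_divide_distrib)
      finally show ?thesis .
    qed
    have "(\<lambda>m. \<integral>x. w x * ((\<phi> (x - t m *\<^sub>R e) - \<phi> (x + t m *\<^sub>R e)) / (2 * t m)) \<partial>lborel)
       \<longlonglongrightarrow> (\<integral>x. w x * (- partial_deriv j \<phi> x) \<partial>lborel)"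
    proof (rule integral_dominated_convergence[where w = "\<lambda>x. M * \<bar>indicator (cball 0 (R + 1)) x * w x\<bar>"])
      show "integrable lborel (\<lambda>x. M * \<bar>indicator (cball 0 (R + 1)) x * w x\<bar>)"
        using w unfolding loc_int_def by auto
      show "AE x in lborel. (\<lambda>m. w x * ((\<phi> (x - t m *\<^sub>R e) - \<phi> (x + t m *\<^sub>R e)) / (2 * t m))) \<longlonglongrightarrow> w x * (- partial_deriv j \<phi> x)"
        unfolding e_def by (intro AE_I2 tendsto_mult tendsto_const symmetric_quotient_test_fun_tendsto \<phi> t)
      fix m
      show "AE x in lborel. norm (w x * ((\<phi> (x - t m *\<^sub>R e) - \<phi> (x + t m *\<^sub>R e)) / (2 * t m))) \<le> M * \<bar>indicator (cball 0 (R + 1)) x * w x\<bar>"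
      proof (rule AE_I2)
        fix x
        show "norm (w x * ((\<phi> (x - t m *\<^sub>R e) - \<phi> (x + t m *\<^sub>R e)) / (2 * t m))) \<le> M * \<bar>indicator (cball 0 (R + 1)) x * w x\<bar>"
        proof (cases "norm x \<le> R + 1")
          case True
          have "\<bar>\<phi> (x - t m *\<^sub>R e) - \<phi> (x + t m *\<^sub>R e)\<bar> \<le> M * (2 * t m)"
            using test_fun_increment_le[OF \<phi> MR(2), of x "- t m"] test_fun_increment_le[OF \<phi> MR(2), of x "t m"] t(2)[of m]
            by (simp add: e_def)
          then have "\<bar>(\<phi> (x - t m *\<^sub>R e) - \<phi> (x + t m *\<^sub>R e)) / (2 * t m)\<bar> \<le> M"
            using t(2)[of m] by (simp add: field_simps)
          from mult_left_mono[OF this abs_ge_zero[of "w x"]] show ?thesis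
            using True by (simp add: abs_mult mult.commute[of M])
        next
          case False
          have "norm (t m *\<^sub>R e) \<le> 1" using t(2,3)[of m] by (simp add: ne)
          then have "norm (x - t m *\<^sub>R e) > R" "norm (x + t m *\<^sub>R e) > R"
            using False norm_triangle_ineq[of "x - t m *\<^sub>R e" "t m *\<^sub>R e"] norm_triangle_ineq4[of "x + t m *\<^sub>R e" "t m *\<^sub>R e"]
            by simp_all
          then show ?thesis using M by (simp add: MR(3))
        qed
      qed
    qed measurable
    then have "(\<lambda>m. \<integral>x. Q m x * \<phi> x \<partial>lborel) \<longlonglongrightarrow> - (\<integral>x. w x * partial_deriv j \<phi> x \<partial>lborel)"
      unfolding move by simp
    from LIMSEQ_unique[OF QL this] show ?thesis by simp
  qed
  then show ?thesis using w L unfolding weak_partial_def w_def L_def by blast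
qed

section \<open>Truncation and a Faber--Krahn inequality\<close>

lemma weak_partial_cmult: "weak_partial j v d \<Longrightarrow> weak_partial j (\<lambda>x. c * v x) (\<lambda>x. c * d x)"
  unfolding weak_partial_def by (auto intro: loc_int_cmult simp: mult.assoc)

lemma weak_partial_add:
  assumes "weak_partial j v d" "weak_partial j v' d'"
  shows "weak_partial j (\<lambda>x. v x + v' x) (\<lambda>x. d x + d' x)"
  unfolding weak_partial_def
proof safe
  have li: "loc_int v" "loc_int d" "loc_int v'" "loc_int d'" using assms by (auto simp: weak_partial_def)
  then show "loc_int (\<lambda>x. v x + v' x)" "loc_int (\<lambda>x. d x + d' x)" by (auto intro: loc_int_add)
  fix \<phi> :: "real^'a \<Rightarrow> real" assume \<phi>: "test_fun \<phi>"
  then show "(\<integral>x. (v x + v' x) * partial_deriv j \<phi> x \<partial>lborel) = - (\<integral>x. (d x + d' x) * \<phi> x \<partial>lborel)"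
    using assms integrable_mult_test_fun(2)[OF li(1) \<phi>, of j] integrable_mult_test_fun(1)[OF li(2) \<phi>]
      integrable_mult_test_fun(2)[OF li(3) \<phi>, of j] integrable_mult_test_fun(1)[OF li(4) \<phi>]
    by (simp add: distrib_right weak_partial_def)
qed

text \<open>
  A constant is the absolute value of the difference between the zero function and that constant.
\<close>

lemma weak_partial_const:
  assumes "c \<ge> 0"
  shows "weak_partial j (\<lambda>x. c) (\<lambda>x. 0)"
proof -
  have "weak_partial j (\<lambda>x. 0) (\<lambda>x. 0)" by (simp add: weak_partial_def loc_int_const)
  from weak_partial_abs_diff[OF this, of c] show ?thesis using assms by simp
qed

text \<open>
  Written with absolute values so that its weak derivative comes from \<open>weak_partial_abs_diff\<close>.
\<close>

definition trunc :: "real \<Rightarrow> real \<Rightarrow> real \<Rightarrow> real" where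
  "trunc k h s = (\<bar>s - k\<bar> - \<bar>s - h\<bar> + (h - k)) / 2"

text \<open>
  The value \<open>1/2\<close> at \<open>k\<close> and at \<open>h\<close> is harmless: the energy estimates only need a number in
  \<open>{0..1}\<close> there, so that it need not be shown that the gradient vanishes on level sets.
\<close>

definition trunc_slope :: "real \<Rightarrow> real \<Rightarrow> real \<Rightarrow> real" where
  "trunc_slope k h s = (sgn (s - k) - sgn (s - h)) / 2"

lemma trunc_eq: "k \<le> h \<Longrightarrow> trunc k h s = min (max (s - k) 0) (h - k)"
  by (auto simp: trunc_def min_def max_def abs_if)

lemma trunc_slope_bounds:
  assumes "k < h"
  shows "0 \<le> trunc_slope k h s" "trunc_slope k h s \<le> 1" "s < k \<Longrightarrow> trunc_slope k h s = 0"
  using assms by (auto simp: trunc_slope_def sgn_real_def)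

lemma weak_partial_trunc:
  assumes "weak_partial j v d" "k \<le> h"
  shows "weak_partial j (\<lambda>x. trunc k h (v x)) (\<lambda>x. trunc_slope k h (v x) * d x)"
proof -
  have "weak_partial j (\<lambda>x. (1/2) * (\<bar>v x - k\<bar> + (- 1) * \<bar>v x - h\<bar> + (h - k)))
     (\<lambda>x. (1/2) * (sgn (v x - k) * d x + (- 1) * (sgn (v x - h) * d x) + 0))"
    using assms by (intro weak_partial_cmult weak_partial_add weak_partial_abs_diff weak_partial_const) auto
  moreover have "(1/2) * (sgn (v x - k) * d x + (- 1) * (sgn (v x - h) * d x) + 0) = trunc_slope k h (v x) * d x" for x
    by (simp add: trunc_slope_def field_simps)
  ultimately show ?thesis by (simp add: trunc_def)
qed

lemma nn_integral_axis_increment_le: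
  fixes w :: "real^'n \<Rightarrow> real"
  assumes wd: "weak_partial j w d"
  shows "(\<integral>\<^sup>+x. ennreal \<bar>w (x + t *\<^sub>R axis j 1) - w x\<bar> \<partial>lborel) \<le> ennreal \<bar>t\<bar> * (\<integral>\<^sup>+x. ennreal \<bar>d x\<bar> \<partial>lborel)"
proof -
  have d: "loc_int d" using wd by (simp add: weak_partial_def)
  note [measurable] = loc_int_measurable[OF d] segment_avg_measurable[OF loc_int_measurable[OF d]]
  let ?h = "t *\<^sub>R axis j 1 :: real^'n"
  have "(\<integral>\<^sup>+x. ennreal \<bar>w (x + ?h) - w x\<bar> \<partial>lborel) = (\<integral>\<^sup>+x. ennreal \<bar>t\<bar> * ennreal \<bar>segment_avg ?h d x\<bar> \<partial>lborel)"
    by (rule nn_integral_cong_AE) (use weak_partial_increment[OF wd, of t] in eventually_elim, simp add: abs_mult ennreal_mult)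
  also have "\<dots> = ennreal \<bar>t\<bar> * (\<integral>\<^sup>+x. ennreal \<bar>segment_avg ?h d x\<bar> \<partial>lborel)"
    by (rule nn_integral_cmult) measurable
  also have "(\<integral>\<^sup>+x. ennreal \<bar>segment_avg ?h d x\<bar> \<partial>lborel) \<le> (\<integral>\<^sup>+x. ennreal \<bar>d x\<bar> \<partial>lborel)"
  proof -
    have "(\<integral>\<^sup>+x. indicator UNIV x * ennreal \<bar>segment_avg ?h d x - 0\<bar> \<partial>lborel) \<le> (\<integral>\<^sup>+x. ennreal \<bar>d x\<bar> \<partial>lborel)"
    proof (rule nn_integral_segment_avg_le)
      show "(\<integral>\<^sup>+x. indicator UNIV x * ennreal \<bar>d (x + s *\<^sub>R ?h) - 0\<bar> \<partial>lborel) \<le> (\<integral>\<^sup>+x. ennreal \<bar>d x\<bar> \<partial>lborel)" for s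
        using nn_integral_lborel_translate[of "\<lambda>x. ennreal \<bar>d x\<bar>" "s *\<^sub>R ?h"] by simp
    qed auto
    then show ?thesis by simp
  qed
  finally show ?thesis by (simp add: mult_left_mono)
qed

text \<open>
  Move from \<open>x\<close> to \<open>x + y\<close> parallel to one coordinate axis after the other.
\<close>

lemma nn_integral_increment_le:
  fixes w :: "real^'n \<Rightarrow> real"
  assumes wd: "\<And>j. weak_partial j w (d j)" and y: "\<And>j. \<bar>y $ j\<bar> \<le> r"
  shows "(\<integral>\<^sup>+x. ennreal \<bar>w (x + y) - w x\<bar> \<partial>lborel) \<le> ennreal r * (\<Sum>j\<in>UNIV. \<integral>\<^sup>+x. ennreal \<bar>d j x\<bar> \<partial>lborel)"
proof -
  have [measurable]: "w \<in> borel_measurable borel" using wd loc_int_measurable by (auto simp: weak_partial_def)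
  have "(\<integral>\<^sup>+x. ennreal \<bar>w (x + (\<Sum>j\<in>I. (y $ j) *\<^sub>R axis j 1)) - w x\<bar> \<partial>lborel)
     \<le> ennreal r * (\<Sum>j\<in>I. \<integral>\<^sup>+x. ennreal \<bar>d j x\<bar> \<partial>lborel)" if "finite I" for I
    using that
  proof (induction I rule: finite_induct)
    case (insert i I)
    let ?s = "\<Sum>j\<in>I. (y $ j) *\<^sub>R axis j 1 :: real^'n" and ?h = "(y $ i) *\<^sub>R axis i 1 :: real^'n"
    have "(\<integral>\<^sup>+x. ennreal \<bar>w (x + (\<Sum>j\<in>insert i I. (y $ j) *\<^sub>R axis j 1)) - w x\<bar> \<partial>lborel)
      \<le> (\<integral>\<^sup>+x. ennreal \<bar>w (x + ?h) - w x\<bar> + ennreal \<bar>w ((x + ?h) + ?s) - w (x + ?h)\<bar> \<partial>lborel)"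
      using insert by (intro nn_integral_mono) (auto simp: ennreal_plus[symmetric] add.assoc simp del: ennreal_plus intro!: ennreal_leI)
    also have "\<dots> = (\<integral>\<^sup>+x. ennreal \<bar>w (x + ?h) - w x\<bar> \<partial>lborel) + (\<integral>\<^sup>+x. ennreal \<bar>w ((x + ?h) + ?s) - w (x + ?h)\<bar> \<partial>lborel)"
      by (rule nn_integral_add) measurable
    also have "(\<integral>\<^sup>+x. ennreal \<bar>w ((x + ?h) + ?s) - w (x + ?h)\<bar> \<partial>lborel) = (\<integral>\<^sup>+x. ennreal \<bar>w (x + ?s) - w x\<bar> \<partial>lborel)"
      by (rule nn_integral_lborel_translate[of "\<lambda>x. ennreal \<bar>w (x + ?s) - w x\<bar>"]) measurable
    also have "\<dots> \<le> ennreal r * (\<Sum>j\<in>I. \<integral>\<^sup>+x. ennreal \<bar>d j x\<bar> \<partial>lborel)" by (rule insert.IH)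
    also have "(\<integral>\<^sup>+x. ennreal \<bar>w (x + ?h) - w x\<bar> \<partial>lborel) \<le> ennreal \<bar>y $ i\<bar> * (\<integral>\<^sup>+x. ennreal \<bar>d i x\<bar> \<partial>lborel)"
      by (rule nn_integral_axis_increment_le[OF wd])
    also have "\<dots> \<le> ennreal r * (\<integral>\<^sup>+x. ennreal \<bar>d i x\<bar> \<partial>lborel)"
      by (intro mult_right_mono ennreal_leI y) auto
    finally show ?case using insert by (simp add: distrib_left add_mono)
  qed simp
  note bound = this[OF finite[of UNIV]]
  have "(\<Sum>j\<in>UNIV. (y $ j) *\<^sub>R axis j 1) = y"
    using basis_expansion[of y] unfolding scalar_mult_eq_scaleR .
  with bound show ?thesis by (simp only:)
qed

text \<open>
  Compare \<open>w\<close> on \<open>A\<close> with its translates by the vectors of a cube with side \<open>r\<close>. A translate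
  differs from \<open>w\<close> in \<open>L\<^sup>1\<close> by at most \<open>r\<close> times the norm of the gradient, whereas the mean of all
  translates is at most \<open>r\<^bsup>-n\<^esup> \<integral>w\<close> pointwise, and so its integral over \<open>A\<close> is at most half of
  \<open>\<integral>w\<close> once \<open>r\<^bsup>n\<^esup> = 2 |A|\<close>.
\<close>

lemma L1_Faber_Krahn:
  fixes w :: "real^'n \<Rightarrow> real"
  assumes wd: "\<And>j. weak_partial j w (d j)" and w: "integrable lborel w" and w0: "\<And>x. w x \<ge> 0"
    and d: "\<And>j. integrable lborel (d j)"
    and A[measurable]: "A \<in> sets borel" and Afin: "emeasure lborel A < \<infinity>" and out: "\<And>x. x \<notin> A \<Longrightarrow> w x = 0"
  shows "(\<integral>x. w x \<partial>lborel) \<le> 2 * (2 * measure lborel A) powr (1 / CARD('n)) * (\<Sum>j\<in>UNIV. \<integral>x. \<bar>d j x\<bar> \<partial>lborel)"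
proof (cases "measure lborel A = 0")
  case True
  then have "A \<in> null_sets lborel" using Afin A by (auto simp: null_sets_def emeasure_eq_ennreal_measure)
  then have "AE x in lborel. x \<notin> A" by (rule AE_not_in)
  then have "AE x in lborel. w x = 0" by eventually_elim (rule out)
  then have "(\<integral>x. w x \<partial>lborel) = 0" by (rule integral_eq_zero_AE)
  then show ?thesis by (simp add: sum_nonneg)
next
  case False
  define a where "a = measure lborel A"
  have a: "a > 0" using False measure_nonneg[of lborel A] by (simp add: a_def less_le)
  define r where "r = (2 * a) powr (1 / CARD('n))"
  have r: "r > 0" "r ^ CARD('n) = 2 * a"
    using a by (simp_all add: r_def powr_realpow[symmetric] powr_powr)
  note [measurable] = borel_measurable_integrable[OF w]
  define I where "I = (\<integral>x. w x \<partial>lborel)"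
  define S where "S = (\<Sum>j\<in>UNIV. \<integral>x. \<bar>d j x\<bar> \<partial>lborel)"
  have I0: "I \<ge> 0" using w0 by (simp add: I_def)
  have S0: "S \<ge> 0" by (simp add: S_def sum_nonneg)
  have Inn: "(\<integral>\<^sup>+x. ennreal (w x) \<partial>lborel) = ennreal I"
    unfolding I_def using w w0 by (intro nn_integral_eq_integral) auto
  have Snn: "(\<Sum>j\<in>UNIV. \<integral>\<^sup>+x. ennreal \<bar>d j x\<bar> \<partial>lborel) = ennreal S"
    unfolding S_def using d by (simp add: nn_integral_eq_integral sum_ennreal)
  have ea: "emeasure lborel A = ennreal a" unfolding a_def using Afin by (simp add: emeasure_eq_ennreal_measure)
  define Q where "Q = cbox (0::real^'n) (\<chi> i. r)"
  have Qm[measurable]: "Q \<in> sets borel" by (simp add: Q_def)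
  have eQ: "emeasure lborel Q = ennreal (2 * a)"
  proof -
    have "cbox (0::real^'n) (\<chi> i. r) \<noteq> {}" using r by (simp add: interval_ne_empty_cart less_imp_le)
    then have "measure lborel Q = (\<Prod>i\<in>(UNIV::'n set). r)" unfolding Q_def
      by (simp add: content_cbox_cart)
    then have "measure lborel Q = 2 * a" using r by simp
    moreover have "emeasure lborel Q < \<infinity>" unfolding Q_def by (rule emeasure_lborel_cbox_finite)
    ultimately show ?thesis by (simp add: emeasure_eq_ennreal_measure)
  qed
  have shifted: "ennreal I \<le> (\<integral>\<^sup>+x. indicator A x * ennreal (w (x + y)) \<partial>lborel) + ennreal (r * S)" if y: "y \<in> Q" for y
  proof -
    have "\<bar>y $ j\<bar> \<le> r" for j using y by (auto simp: Q_def mem_box_cart)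
    note incr = nn_integral_increment_le[OF wd this]
    have "ennreal I = (\<integral>\<^sup>+x. indicator A x * ennreal (w x) \<partial>lborel)"
      unfolding Inn[symmetric] using out by (intro nn_integral_cong) (auto simp: indicator_def)
    also have "\<dots> \<le> (\<integral>\<^sup>+x. indicator A x * ennreal (w (x + y)) + ennreal \<bar>w (x + y) - w x\<bar> \<partial>lborel)"
    proof (rule nn_integral_mono)
      fix x
      have "ennreal (w x) \<le> ennreal (w (x + y) + \<bar>w (x + y) - w x\<bar>)" by (intro ennreal_leI) linarith
      then show "indicator A x * ennreal (w x) \<le> indicator A x * ennreal (w (x + y)) + ennreal \<bar>w (x + y) - w x\<bar>"
        using w0[of "x + y"] by (auto simp: indicator_def)
    qed
    also have "\<dots> = (\<integral>\<^sup>+x. indicator A x * ennreal (w (x + y)) \<partial>lborel) + (\<integral>\<^sup>+x. ennreal \<bar>w (x + y) - w x\<bar> \<partial>lborel)"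
      by (rule nn_integral_add) measurable
    also have "(\<integral>\<^sup>+x. ennreal \<bar>w (x + y) - w x\<bar> \<partial>lborel) \<le> ennreal (r * S)"
      using incr r S0 by (simp add: Snn ennreal_mult)
    finally show ?thesis by (simp add: add_left_mono)
  qed
  have "ennreal I * ennreal (2 * a) = (\<integral>\<^sup>+y. ennreal I * indicator Q y \<partial>lborel)"
    by (simp add: nn_integral_cmult_indicator eQ)
  also have "\<dots> \<le> (\<integral>\<^sup>+y. (\<integral>\<^sup>+x. indicator A x * (indicator Q y * ennreal (w (x + y))) \<partial>lborel) + ennreal (r * S) * indicator Q y \<partial>lborel)"
    by (rule nn_integral_mono) (use shifted in \<open>auto simp: indicator_def\<close>)
  also have "\<dots> = (\<integral>\<^sup>+y. (\<integral>\<^sup>+x. indicator A x * (indicator Q y * ennreal (w (x + y))) \<partial>lborel) \<partial>lborel) + ennreal (r * S) * ennreal (2 * a)"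
    by (subst nn_integral_add) (auto simp: nn_integral_cmult_indicator eQ)
  also have "(\<integral>\<^sup>+y. (\<integral>\<^sup>+x. indicator A x * (indicator Q y * ennreal (w (x + y))) \<partial>lborel) \<partial>lborel)
     = (\<integral>\<^sup>+x. (\<integral>\<^sup>+y. indicator A x * (indicator Q y * ennreal (w (x + y))) \<partial>lborel) \<partial>lborel)"
    by (rule lborel_pair.Fubini') measurable
  also have "\<dots> \<le> (\<integral>\<^sup>+x. ennreal I * indicator A x \<partial>lborel)"
  proof (rule nn_integral_mono)
    fix x
    have "(\<integral>\<^sup>+y. indicator Q y * ennreal (w (x + y)) \<partial>lborel) \<le> (\<integral>\<^sup>+y. ennreal (w (y + x)) \<partial>lborel)"
      by (rule nn_integral_mono) (auto simp: indicator_def add.commute)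
    also have "\<dots> = ennreal I"
      unfolding Inn[symmetric] by (rule nn_integral_lborel_translate[of "\<lambda>x. ennreal (w x)"]) measurable
    finally show "(\<integral>\<^sup>+y. indicator A x * (indicator Q y * ennreal (w (x + y))) \<partial>lborel) \<le> ennreal I * indicator A x"
      by (auto simp: indicator_def)
  qed
  also have "\<dots> = ennreal I * ennreal a" by (simp add: nn_integral_cmult_indicator ea)
  finally have "ennreal (I * (2 * a)) \<le> ennreal (I * a + r * S * (2 * a))"
    using I0 a S0 r by (simp add: ennreal_mult[symmetric] ennreal_plus[symmetric] add_right_mono del: ennreal_plus)
  then have "I * (2 * a) \<le> I * a + r * S * (2 * a)"
    using I0 a S0 r by (subst (asm) ennreal_le_iff) auto
  then have "a * I \<le> a * (2 * r * S)" by (simp add: algebra_simps)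
  then have "I \<le> 2 * r * S" using a by simp
  then show ?thesis unfolding I_def S_def r_def a_def .
qed

lemma integral_abs_le_sqrt_measure:
  fixes d :: "'a::euclidean_space \<Rightarrow> real"
  assumes [measurable]: "d \<in> borel_measurable borel" and sq: "integrable lborel (\<lambda>x. (d x)\<^sup>2)"
    and A[measurable]: "A \<in> sets borel" and Afin: "emeasure lborel A < \<infinity>" and out: "\<And>x. x \<notin> A \<Longrightarrow> d x = 0"
  shows "integrable lborel d"
    and "(\<integral>x. \<bar>d x\<bar> \<partial>lborel) \<le> sqrt (measure lborel A) * sqrt (\<integral>x. (d x)\<^sup>2 \<partial>lborel)"
proof -
  have ind: "integrable lborel (indicator A :: 'a \<Rightarrow> real)" using Afin by auto
  show int: "integrable lborel d"
  proof (rule Bochner_Integration.integrable_bound[OF Bochner_Integration.integrable_add[OF sq ind]])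
    have "\<bar>d x\<bar> \<le> (d x)\<^sup>2 + indicator A x" for x
    proof (cases "x \<in> A")
      case True
      have "0 \<le> (\<bar>d x\<bar> - 1 / 2)\<^sup>2" by simp
      then have "\<bar>d x\<bar> \<le> (d x)\<^sup>2 + 1" by (simp add: power2_diff power_divide)
      then show ?thesis using True by simp
    qed (simp add: out)
    then show "AE x in lborel. norm (d x) \<le> norm ((d x)\<^sup>2 + indicator A x)" by auto
  qed measurable
  have "(\<integral>\<^sup>+x. indicator A x * ennreal \<bar>d x\<bar> \<partial>lborel)\<^sup>2
     \<le> (\<integral>\<^sup>+x. (indicator A x)\<^sup>2 \<partial>lborel) * (\<integral>\<^sup>+x. (ennreal \<bar>d x\<bar>)\<^sup>2 \<partial>lborel)"
    by (rule Cauchy_Schwarz_nn_integral) auto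
  also have "(\<integral>\<^sup>+x. indicator A x * ennreal \<bar>d x\<bar> \<partial>lborel) = (\<integral>\<^sup>+x. ennreal \<bar>d x\<bar> \<partial>lborel)"
    using out by (intro nn_integral_cong) (auto simp: indicator_def)
  also have "\<dots> = ennreal (\<integral>x. \<bar>d x\<bar> \<partial>lborel)" by (rule nn_integral_eq_integral) (use int in auto)
  also have "(\<integral>\<^sup>+x. (ennreal \<bar>d x\<bar>)\<^sup>2 \<partial>lborel) = (\<integral>\<^sup>+x. ennreal ((d x)\<^sup>2) \<partial>lborel)"
    by (simp add: ennreal_power)
  also have "\<dots> = ennreal (\<integral>x. (d x)\<^sup>2 \<partial>lborel)" by (rule nn_integral_eq_integral) (use sq in auto)
  also have "(\<integral>\<^sup>+x. (indicator A x)\<^sup>2 \<partial>lborel) = (\<integral>\<^sup>+x. indicator A x \<partial>lborel)"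
    by (intro nn_integral_cong) (auto simp: indicator_def)
  also have "\<dots> = ennreal (measure lborel A)" using Afin by (simp add: emeasure_eq_ennreal_measure)
  finally have "(\<integral>x. \<bar>d x\<bar> \<partial>lborel)\<^sup>2 \<le> measure lborel A * (\<integral>x. (d x)\<^sup>2 \<partial>lborel)"
    by (simp add: ennreal_power ennreal_mult[symmetric])
  then show "(\<integral>x. \<bar>d x\<bar> \<partial>lborel) \<le> sqrt (measure lborel A) * sqrt (\<integral>x. (d x)\<^sup>2 \<partial>lborel)"
    by (simp add: real_sqrt_mult[symmetric] real_le_rsqrt)
qed

section \<open>Borel representatives of Sobolev functions\<close>

lemma borel_measurable_lebesgue_if_local:
  assumes "in_Lp_loc p (v :: real^'n \<Rightarrow> real)"
  shows "v \<in> borel_measurable lebesgue"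
proof (rule borel_measurable_LIMSEQ_real)
  fix m :: nat
  have "v \<in> borel_measurable (lebesgue_on (cball 0 (real m)))"
    using assms unfolding in_Lp_loc_def in_Lp_def by auto
  then show "(\<lambda>x. indicator (cball 0 (real m)) x * v x) \<in> borel_measurable lebesgue"
    by (subst (asm) borel_measurable_restrict_space_iff) auto
next
  fix x :: "real^'n"
  obtain N where "norm x \<le> real N" using real_arch_simple by blast
  then have "\<forall>\<^sub>F m in sequentially. indicator (cball 0 (real m)) x * v x = v x"
    by (auto simp: eventually_sequentially indicator_def intro!: exI[of _ N])
  then show "(\<lambda>m. indicator (cball 0 (real m)) x * v x) \<longlonglongrightarrow> v x" by (rule tendsto_eventually)
qed

lemma integrable_lebesgue_on_iff_lborel:
  fixes v v' :: "real^'n \<Rightarrow> real"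
  assumes v: "v \<in> borel_measurable lebesgue" and v': "v' \<in> borel_measurable borel"
    and eq: "AE x in lborel. v x = v' x" and K: "K \<in> sets borel"
  shows "integrable (lebesgue_on K) v \<longleftrightarrow> integrable lborel (\<lambda>x. indicator K x * v' x)"
proof -
  have [measurable]: "v' \<in> borel_measurable lebesgue" using v' by (simp add: measurable_completion)
  have Kl[measurable]: "K \<in> sets lebesgue" using K by simp
  note [measurable] = v
  have "integrable (lebesgue_on K) v \<longleftrightarrow> integrable lebesgue (\<lambda>x. indicator K x * v x)"
    by (subst integrable_restrict_space) auto
  also have "\<dots> \<longleftrightarrow> integrable lebesgue (\<lambda>x. indicator K x * v' x)"
  proof (rule integrable_cong_AE)
    show "AE x in lebesgue. indicator K x * v x = indicator K x * v' x"
      using AE_completion[OF eq] by eventually_elim simp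
  qed measurable
  also have "\<dots> \<longleftrightarrow> integrable lborel (\<lambda>x. indicator K x * v' x)"
    by (rule integrable_completion) (use v' K in simp)
  finally show ?thesis .
qed

lemma in_Lp_loc_1_iff:
  fixes v v' :: "real^'n \<Rightarrow> real"
  assumes v: "v \<in> borel_measurable lebesgue" and v': "v' \<in> borel_measurable borel"
    and eq: "AE x in lborel. v x = v' x"
  shows "in_Lp_loc 1 v \<longleftrightarrow> loc_int v'"
proof -
  have K: "in_Lp (lebesgue_on K) 1 v \<longleftrightarrow> integrable lborel (\<lambda>x. indicator K x * v' x)" if "compact K" for K
  proof -
    have Kb: "K \<in> sets borel" using that by (simp add: borel_compact)
    have vK: "v \<in> borel_measurable (lebesgue_on K)" using v by (rule measurable_restrict_space1)
    then have "in_Lp (lebesgue_on K) 1 v \<longleftrightarrow> integrable (lebesgue_on K) (\<lambda>x. \<bar>v x\<bar>)"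
      by (simp add: in_Lp_def)
    also have "\<dots> \<longleftrightarrow> integrable (lebesgue_on K) v" using vK by (rule integrable_abs_iff)
    finally show ?thesis using integrable_lebesgue_on_iff_lborel[OF v v' eq Kb] by simp
  qed
  show ?thesis
  proof
    assume "in_Lp_loc 1 v"
    then show "loc_int v'" using K v' by (simp add: loc_int_def in_Lp_loc_def)
  next
    assume l: "loc_int v'"
    have "integrable lborel (\<lambda>x. indicator K x * v' x)" if cK: "compact K" for K
    proof -
      obtain R where R: "\<forall>x\<in>K. norm x \<le> R" using cK compact_imp_bounded bounded_iff by metis
      have [measurable]: "K \<in> sets borel" using cK by (simp add: borel_compact)
      have "integrable lborel (\<lambda>x. v' x * indicator K x)"
        by (rule integrable_mult_loc_int[OF l, where M = 1 and R = R]) (use R in \<open>auto simp: indicator_def\<close>)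
      then show ?thesis by (simp add: mult.commute)
    qed
    then show "in_Lp_loc 1 v" using K by (simp add: in_Lp_loc_def)
  qed
qed

lemma in_Lp_2_iff_integrable_square:
  "in_Lp M 2 v \<longleftrightarrow> v \<in> borel_measurable M \<and> integrable M (\<lambda>x. (v x)\<^sup>2)"
  by (simp add: in_Lp_def)

lemma in_Lp_loc_2_iff:
  fixes v v' :: "real^'n \<Rightarrow> real"
  assumes v: "v \<in> borel_measurable lebesgue" and v': "v' \<in> borel_measurable borel"
    and eq: "AE x in lborel. v x = v' x"
  shows "in_Lp_loc 2 v \<longleftrightarrow> loc_int (\<lambda>x. (v' x)\<^sup>2)"
proof -
  have "in_Lp_loc 2 v \<longleftrightarrow> in_Lp_loc 1 (\<lambda>x. (v x)\<^sup>2)"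
  proof -
    have vK: "v \<in> borel_measurable (lebesgue_on K)" for K using v by (rule measurable_restrict_space1)
    then show ?thesis
      unfolding in_Lp_loc_def in_Lp_2_iff_integrable_square by (simp add: in_Lp_def)
  qed
  also have "\<dots> \<longleftrightarrow> loc_int (\<lambda>x. (v' x)\<^sup>2)"
    using v v' eq by (intro in_Lp_loc_1_iff) auto
  finally show ?thesis .
qed

lemma loc_int_if_square:
  assumes v: "v \<in> borel_measurable borel" and sq: "loc_int (\<lambda>x. (v x)\<^sup>2)"
  shows "loc_int v"
proof (rule loc_int_dominated[OF sq v, of 1])
  fix x
  have "0 \<le> (\<bar>v x\<bar> - 1 / 2)\<^sup>2" by simp
  then show "\<bar>v x\<bar> \<le> \<bar>(v x)\<^sup>2\<bar> + 1" by (simp add: power2_diff power_divide)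
qed

text \<open>
  The link to distributional gradients: changing functions on null sets and passing between
  Lebesgue and Borel measurable functions does not affect the defining integrals.
\<close>

lemma is_distr_grad_iff_weak_partial:
  fixes v v' :: "real^'n \<Rightarrow> real"
  assumes v: "v \<in> borel_measurable lebesgue" and v': "loc_int v'" and eq: "AE x in lborel. v x = v' x"
    and D: "\<And>j. (\<lambda>x. D x $ j) \<in> borel_measurable lebesgue" and d: "\<And>j. d j \<in> borel_measurable borel"
    and Deq: "\<And>j. AE x in lborel. D x $ j = d j x"
  shows "is_distr_grad v D \<longleftrightarrow> (\<forall>j. weak_partial j v' (d j))"
proof -
  have int_eq: "(\<integral>x. a x * \<phi> x \<partial>lebesgue) = (\<integral>x. b x * \<phi> x \<partial>lborel)"
    if a: "a \<in> borel_measurable lebesgue" and b: "b \<in> borel_measurable borel"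
      and ab: "AE x in lborel. a x = b x" and \<phi>: "\<phi> \<in> borel_measurable borel"
    for a b \<phi> :: "real^'n \<Rightarrow> real"
  proof -
    have [measurable]: "\<phi> \<in> borel_measurable lebesgue" "b \<in> borel_measurable lebesgue"
      using \<phi> b by (simp_all add: measurable_completion)
    note [measurable] = a
    have "(\<integral>x. a x * \<phi> x \<partial>lebesgue) = (\<integral>x. b x * \<phi> x \<partial>lebesgue)"
    proof (rule integral_cong_AE)
      show "AE x in lebesgue. a x * \<phi> x = b x * \<phi> x"
        using AE_completion[OF ab] by eventually_elim simp
    qed measurable
    also have "\<dots> = (\<integral>x. b x * \<phi> x \<partial>lborel)"
      by (rule integral_completion) (use b \<phi> in simp)
    finally show ?thesis .
  qed
  have "in_Lp_loc 1 (\<lambda>x. D x $ j) \<longleftrightarrow> loc_int (d j)" for j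
    by (rule in_Lp_loc_1_iff[OF D d Deq])
  then show ?thesis
    unfolding is_distr_grad_def weak_partial_def
    using int_eq[OF v loc_int_measurable[OF v'] eq test_fun_measurable(2)]
      int_eq[OF D d Deq test_fun_measurable(1)] v' by auto
qed

lemma weak_partial_unique:
  assumes "weak_partial j v d" "weak_partial j v d'"
  shows "AE x in lborel. d x = d' x"
proof -
  have li: "loc_int d" "loc_int d'" using assms by (auto simp: weak_partial_def)
  have "AE x in lborel. d x + (- 1) * d' x = 0"
  proof (rule AE_eq_zero_if_test_integrals_zero)
    show "loc_int (\<lambda>x. d x + (- 1) * d' x)" by (intro loc_int_add loc_int_cmult li)
    fix \<phi> :: "real^'a \<Rightarrow> real" assume \<phi>: "test_fun \<phi>"
    have "(\<integral>x. d x * \<phi> x \<partial>lborel) = (\<integral>x. d' x * \<phi> x \<partial>lborel)"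
      using assms \<phi> unfolding weak_partial_def by (metis minus_equation_iff)
    then show "(\<integral>x. (d x + (- 1) * d' x) * \<phi> x \<partial>lborel) = 0"
      using integrable_mult_test_fun(1)[OF li(1) \<phi>] integrable_mult_test_fun(1)[OF li(2) \<phi>]
      by (simp add: left_diff_distrib)
  qed
  then show ?thesis by eventually_elim simp
qed

text \<open>
  A Borel representative \<open>u\<close> of \<open>U\<close> together with Borel weak partial derivatives that are square
  integrable; a function belongs to \<open>W12\<close> if and only if it has one.
\<close>

definition sobolev_rep :: "(real^'n \<Rightarrow> real) \<Rightarrow> (real^'n \<Rightarrow> real) \<Rightarrow> ('n \<Rightarrow> real^'n \<Rightarrow> real) \<Rightarrow> bool" where
  "sobolev_rep U u d \<longleftrightarrow> U \<in> borel_measurable lebesgue \<and> (AE x in lborel. U x = u x) \<and>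
     u \<in> borel_measurable borel \<and> loc_int (\<lambda>x. (u x)\<^sup>2) \<and>
     (\<forall>j. weak_partial j u (d j) \<and> integrable lborel (\<lambda>x. (d j x)\<^sup>2))"

lemma sobolev_rep_is_distr_grad:
  assumes "sobolev_rep U u d"
  shows "is_distr_grad U (\<lambda>x. \<chi> j. d j x)"
proof -
  have wp: "\<And>j. weak_partial j u (d j)" using assms by (simp add: sobolev_rep_def)
  then have d: "d j \<in> borel_measurable borel" for j
    using loc_int_measurable unfolding weak_partial_def by blast
  then show ?thesis
    using assms wp
    by (subst is_distr_grad_iff_weak_partial[where v' = u and d = d])
       (auto simp: sobolev_rep_def measurable_completion intro: loc_int_if_square)
qed

lemma sobolev_rep_imp_W12:
  assumes rep: "sobolev_rep U u d"
  shows "U \<in> W12"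
proof -
  have d: "d j \<in> borel_measurable borel" for j
    using rep loc_int_measurable unfolding sobolev_rep_def weak_partial_def by blast
  have "in_Lp_loc 2 U"
    using rep by (subst in_Lp_loc_2_iff[where v' = u]) (auto simp: sobolev_rep_def)
  moreover have "in_Lp lebesgue 2 (\<lambda>x. (\<chi> j. d j x) $ j)" for j
    using rep d[of j] unfolding in_Lp_2_iff_integrable_square
    by (auto simp: measurable_completion integrable_completion sobolev_rep_def)
  ultimately show ?thesis
    using sobolev_rep_is_distr_grad[OF rep] unfolding W12_def by blast
qed

lemma W12_imp_sobolev_rep:
  fixes U :: "real^'n \<Rightarrow> real"
  assumes U: "U \<in> W12" and u: "u \<in> borel_measurable borel" and eq: "AE x in lborel. U x = u x"
  shows "\<exists>d. sobolev_rep U u d"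
proof -
  obtain D where D: "is_distr_grad U D" "\<And>j. in_Lp lebesgue 2 (\<lambda>x. D x $ j)" and U2: "in_Lp_loc 2 U"
    using U by (auto simp: W12_def)
  have Um: "U \<in> borel_measurable lebesgue" by (rule borel_measurable_lebesgue_if_local[OF U2])
  have Dm: "(\<lambda>x. D x $ j) \<in> borel_measurable lebesgue" for j using D(2)[of j] by (simp add: in_Lp_def)
  have "\<exists>d. \<forall>j. d j \<in> borel_measurable lborel \<and> (AE x in lborel. D x $ j = d j x)"
    using completion_ex_borel_measurable_real[OF Dm] by metis
  then obtain d where d: "\<And>j. d j \<in> borel_measurable borel" "\<And>j. AE x in lborel. D x $ j = d j x"
    by auto
  have sq: "loc_int (\<lambda>x. (u x)\<^sup>2)" using in_Lp_loc_2_iff[OF Um u eq] U2 by simp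
  have "weak_partial j u (d j)" for j
    using is_distr_grad_iff_weak_partial[OF Um loc_int_if_square[OF u sq] eq Dm d] D(1) by simp
  moreover have "integrable lborel (\<lambda>x. (d j x)\<^sup>2)" for j
  proof -
    have "integrable (lebesgue_on UNIV) (\<lambda>x. (D x $ j)\<^sup>2)"
      using D(2)[of j] by (simp add: in_Lp_2_iff_integrable_square lebesgue_on_UNIV_eq)
    moreover have "AE x in lborel. (D x $ j)\<^sup>2 = (d j x)\<^sup>2" using d(2)[of j] by eventually_elim simp
    ultimately have "integrable lborel (\<lambda>x. indicator UNIV x * (d j x)\<^sup>2)"
      using Dm d(1) by (subst (asm) integrable_lebesgue_on_iff_lborel[where v' = "\<lambda>x. (d j x)\<^sup>2"]) auto
    then show ?thesis by simp
  qed
  ultimately show ?thesis using Um u eq sq unfolding sobolev_rep_def by blast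
qed

text \<open>
  Weak derivatives are unique almost everywhere, so the choice made in \<open>distr_grad\<close> is immaterial.
\<close>

lemma sobolev_rep_energy:
  assumes rep: "sobolev_rep U u d"
  shows "(\<integral>x. (norm (distr_grad U x))\<^sup>2 \<partial>lebesgue) = (\<integral>x. (\<Sum>j\<in>UNIV. (d j x)\<^sup>2) \<partial>lborel)"
proof -
  let ?D = "distr_grad U"
  have u: "u \<in> borel_measurable borel" "AE x in lborel. U x = u x" "U \<in> borel_measurable lebesgue" "loc_int u"
    using rep loc_int_if_square by (auto simp: sobolev_rep_def)
  have wp: "weak_partial j u (d j)" for j using rep by (simp add: sobolev_rep_def)
  then have d: "d j \<in> borel_measurable borel" for j
    using loc_int_measurable unfolding weak_partial_def by blast
  have D: "is_distr_grad U ?D"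
    unfolding distr_grad_def by (rule someI[of "is_distr_grad U", OF sobolev_rep_is_distr_grad[OF rep]])
  then have Dm: "(\<lambda>x. ?D x $ j) \<in> borel_measurable lebesgue" for j
    unfolding is_distr_grad_def by (auto intro: borel_measurable_lebesgue_if_local)
  have "\<exists>b. \<forall>j. b j \<in> borel_measurable lborel \<and> (AE x in lborel. ?D x $ j = b j x)"
    using completion_ex_borel_measurable_real[OF Dm] by metis
  then obtain b where b: "\<And>j. b j \<in> borel_measurable borel" "\<And>j. AE x in lborel. ?D x $ j = b j x"
    by auto
  have "weak_partial j u (b j)" for j
    using is_distr_grad_iff_weak_partial[OF u(3,4,2) Dm b] D by simp
  then have bd: "AE x in lborel. b j x = d j x" for j using wp weak_partial_unique by blast
  have "AE x in lborel. ?D x $ j = d j x" for j using b(2)[of j] bd[of j] by eventually_elim simp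
  then have "AE x in lborel. \<forall>j\<in>UNIV. ?D x $ j = d j x" by (subst AE_finite_all) auto
  then have "AE x in lebesgue. \<forall>j\<in>UNIV. ?D x $ j = d j x" by (rule AE_completion)
  then have AE: "AE x in lebesgue. (norm (?D x))\<^sup>2 = (\<Sum>j\<in>UNIV. (d j x)\<^sup>2)"
    by eventually_elim (simp add: norm_vec_def L2_set_def sum_nonneg)
  have [measurable]: "(\<lambda>x. ?D x $ j) \<in> borel_measurable lebesgue" "d j \<in> borel_measurable lebesgue" for j
    using Dm d by (auto simp: measurable_completion)
  have "(\<integral>x. (norm (?D x))\<^sup>2 \<partial>lebesgue) = (\<integral>x. (\<Sum>j\<in>UNIV. (d j x)\<^sup>2) \<partial>lebesgue)"
  proof (rule integral_cong_AE[OF _ _ AE])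
    have "(\<lambda>x. (norm (?D x))\<^sup>2) = (\<lambda>x. \<Sum>j\<in>UNIV. (?D x $ j)\<^sup>2)"
      by (auto simp: norm_vec_def L2_set_def sum_nonneg)
    then show "(\<lambda>x. (norm (?D x))\<^sup>2) \<in> borel_measurable lebesgue" by simp
  qed measurable
  also have "\<dots> = (\<integral>x. (\<Sum>j\<in>UNIV. (d j x)\<^sup>2) \<partial>lborel)"
    by (rule integral_completion) (use d in simp)
  finally show ?thesis .
qed

section \<open>Data terms and the minimality of a single component\<close>

lemma le_powr_Young:
  fixes x P :: real
  assumes "x \<ge> 0" "P \<ge> 1"
  shows "x \<le> x powr P / P + (1 - 1 / P)"
proof (cases "P = 1")
  case False
  then have P: "P > 1" using assms by simp
  have "x * 1 \<le> x powr P / P + 1 powr (P / (P - 1)) / (P / (P - 1))"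
    by (rule Youngs_inequality) (use P assms in \<open>auto simp: field_simps\<close>)
  also have "1 powr (P / (P - 1)) / (P / (P - 1)) = 1 - 1 / P" using P by (simp add: field_simps)
  finally show ?thesis by simp
qed (use assms in simp)

text \<open>
  Hoelder's inequality against an indicator function. The exponent is \<open>1 - 1/p\<close>, where \<open>1/p\<close> has
  to be read as \<open>0\<close> for \<open>p = \<infinity>\<close>.
\<close>

lemma
  assumes g: "in_Lp M p g" and p: "p \<ge> 1" and fin: "emeasure M (space M) < \<infinity>"
  shows in_Lp_imp_integrable: "integrable M g"
    and in_Lp_integral_subset_le: "A \<in> sets M \<Longrightarrow>
      (\<integral>x. indicator A x * \<bar>g x\<bar> \<partial>M) \<le> Lp_norm M p g * measure M A powr (1 - (if p = \<infinity> then 0 else 1 / enn2real p))"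
proof -
  interpret finite_measure M by (rule finite_measureI) (use fin in auto)
  have [measurable]: "g \<in> borel_measurable M" using g by (simp add: in_Lp_def)
  have "integrable M g \<and> (A \<in> sets M \<longrightarrow> (\<integral>x. indicator A x * \<bar>g x\<bar> \<partial>M)
     \<le> Lp_norm M p g * measure M A powr (1 - (if p = \<infinity> then 0 else 1 / enn2real p)))" for A
  proof (cases "p = \<infinity>")
    case True
    let ?G = "Lp_norm M p g"
    have "esssup M (\<lambda>x. ennreal \<bar>g x\<bar>) < \<infinity>" using g True by (simp add: in_Lp_def)
    then have G: "esssup M (\<lambda>x. ennreal \<bar>g x\<bar>) = ennreal ?G" "?G \<ge> 0" using True by (simp_all add: Lp_norm_def)
    have bd: "AE x in M. \<bar>g x\<bar> \<le> ?G"
      using esssup_AE[of "\<lambda>x. ennreal \<bar>g x\<bar>" M] unfolding G(1)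
      by eventually_elim (use G(2) in simp)
    have int: "integrable M g"
      by (rule integrable_const_bound[where B = ?G]) (use bd in auto)
    have "(\<integral>x. indicator A x * \<bar>g x\<bar> \<partial>M) \<le> ?G * measure M A" if A: "A \<in> sets M"
    proof -
      have "(\<integral>x. indicator A x * \<bar>g x\<bar> \<partial>M) \<le> (\<integral>x. ?G * indicator A x \<partial>M)"
      proof (rule integral_mono_AE)
        show "integrable M (\<lambda>x. indicator A x * \<bar>g x\<bar>)"
          using integrable_real_mult_indicator[OF A integrable_abs[OF int]] by (simp add: mult.commute)
        show "AE x in M. indicator A x * \<bar>g x\<bar> \<le> ?G * indicator A x"
          using bd by eventually_elim (auto simp: indicator_def)
      qed (use A fin in \<open>auto intro!: integrable_real_indicator simp: emeasure_finite less_top[symmetric]\<close>)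
      also have "\<dots> = ?G * measure M A" using A sets.sets_into_space[OF A] by (simp add: Int_absorb2)
      finally show ?thesis .
    qed
    then show ?thesis using int True by simp
  next
    case False
    define P where "P = enn2real p"
    have P: "P \<ge> 1"
      using p False enn2real_mono[of 1 p] by (simp add: P_def less_top)
    have intP: "integrable M (\<lambda>x. \<bar>g x\<bar> powr P)" using g False by (simp add: in_Lp_def P_def)
    have int: "integrable M g"
    proof (rule Bochner_Integration.integrable_bound[OF Bochner_Integration.integrable_add[OF intP integrable_const[of 1]]])
      have "\<bar>g x\<bar> \<le> \<bar>g x\<bar> powr P + 1" for x
      proof -
        have "\<bar>g x\<bar> powr P / P \<le> \<bar>g x\<bar> powr P" 
          using P mult_left_mono[of 1 P "\<bar>g x\<bar> powr P"] by (simp add: divide_le_eq)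
        moreover have "0 \<le> 1 / P" using P by simp
        ultimately show ?thesis using le_powr_Young[OF abs_ge_zero P, of "g x"] by linarith
      qed
      then show "AE x in M. norm (g x) \<le> norm (\<bar>g x\<bar> powr P + 1)" by simp
    qed simp
    define N where "N = (\<integral>x. \<bar>g x\<bar> powr P \<partial>M)"
    have N0: "N \<ge> 0" by (simp add: N_def)
    have norm: "Lp_norm M p g = N powr (1 / P)" using False by (simp add: Lp_norm_def N_def P_def)
    have "(\<integral>x. indicator A x * \<bar>g x\<bar> \<partial>M) \<le> N powr (1 / P) * measure M A powr (1 - 1 / P)" if A[measurable]: "A \<in> sets M"
    proof -
      have RHS0: "0 \<le> N powr (1 / P) * measure M A powr (1 - 1 / P)" by simp
      consider "measure M A = 0" | "N = 0" | "measure M A > 0" "N > 0"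
        using N0 measure_nonneg[of M A] by linarith
      then show ?thesis
      proof cases
        case 1
        then have "AE x in M. x \<notin> A" using A by (intro AE_not_in) (simp add: null_sets_def emeasure_eq_measure)
        then have "(\<integral>x. indicator A x * \<bar>g x\<bar> \<partial>M) = 0"
          by (intro integral_eq_zero_AE) (auto elim: eventually_mono)
        then show ?thesis using RHS0 by simp
      next
        case 2
        then have "AE x in M. \<bar>g x\<bar> powr P = 0"
          using integral_nonneg_eq_0_iff_AE[OF intP] by (simp add: N_def)
        then have "(\<integral>x. indicator A x * \<bar>g x\<bar> \<partial>M) = 0"
          by (intro integral_eq_zero_AE) (auto elim!: eventually_mono)
        then show ?thesis using RHS0 by simp
      next
        case 3
        define a where "a = measure M A"
        have a: "a > 0" using 3 by (simp add: a_def)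
        \<comment> \<open>\<open>\<mu>\<close> is the size of \<open>g\<close> for which Young's inequality is sharp: \<open>|g|\<close> constant on \<open>A\<close>\<close>
        define \<mu> where "\<mu> = (N / a) powr (1 / P)"
        have \<mu>: "\<mu> > 0" "\<mu> powr P = N / a" using 3 P a by (simp_all add: \<mu>_def powr_powr)
        have "\<bar>g x\<bar> \<le> \<mu> * (\<bar>g x\<bar> powr P / (N / a) / P + (1 - 1 / P))" for x
        proof -
          have "\<bar>g x\<bar> / \<mu> \<le> (\<bar>g x\<bar> / \<mu>) powr P / P + (1 - 1 / P)"
            by (rule le_powr_Young) (use \<mu> P in auto)
          also have "(\<bar>g x\<bar> / \<mu>) powr P = \<bar>g x\<bar> powr P / (N / a)"
            using \<mu> by (simp add: powr_divide)
          finally show ?thesis using \<mu>(1) by (simp add: pos_divide_le_eq mult.commute)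
        qed
        then have pw: "indicator A x * \<bar>g x\<bar> \<le> \<mu> * (\<bar>g x\<bar> powr P / (N / a) / P + (1 - 1 / P) * indicator A x)" for x
          using \<mu>(1) 3 P a by (auto simp: indicator_def)
        have "(\<integral>x. indicator A x * \<bar>g x\<bar> \<partial>M) \<le> (\<integral>x. \<mu> * (\<bar>g x\<bar> powr P / (N / a) / P + (1 - 1 / P) * indicator A x) \<partial>M)"
        proof (rule integral_mono_AE')
          show "integrable M (\<lambda>x. \<mu> * (\<bar>g x\<bar> powr P / (N / a) / P + (1 - 1 / P) * indicator A x))"
            using intP by (auto simp: emeasure_eq_measure)
          have "0 \<le> \<mu> * (\<bar>g x\<bar> powr P / (N / a) / P + (1 - 1 / P) * indicator A x)" for x
            by (rule order_trans[OF _ pw[of x]]) simp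
          then show "AE x in M. 0 \<le> \<mu> * (\<bar>g x\<bar> powr P / (N / a) / P + (1 - 1 / P) * indicator A x)" by simp
        qed (use pw in simp)
        also have "\<dots> = \<mu> * (N / (N / a) / P + (1 - 1 / P) * a)"
          using intP sets.sets_into_space[OF A] by (simp add: N_def a_def emeasure_eq_measure Int_absorb2)
        also have "\<dots> = \<mu> * a" using 3 P a by (simp add: field_simps)
        also have "\<dots> = N powr (1 / P) * a powr (1 - 1 / P)"
          using 3 a by (simp add: \<mu>_def powr_divide powr_diff)
        finally show ?thesis by (simp add: a_def)
      qed
    qed
    then show ?thesis using int False norm by (simp add: P_def)
  qed
  then show "integrable M g" "A \<in> sets M \<Longrightarrow>
      (\<integral>x. indicator A x * \<bar>g x\<bar> \<partial>M) \<le> Lp_norm M p g * measure M A powr (1 - (if p = \<infinity> then 0 else 1 / enn2real p))"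
    by auto
qed

text \<open>
  Minimality against changes of a single function, with the sets fixed. Unlike minimality of the
  whole tuple for a given \<open>g\<close>, it only involves this function and is therefore easily seen to be
  invariant under a change of sign (\<open>component_minimizer_uminus\<close>).
\<close>

definition component_minimizer ::
  "(real^'n) set \<Rightarrow> (real^'n) set \<Rightarrow> (real^'n \<Rightarrow> real) \<Rightarrow> (real^'n \<Rightarrow> real) \<Rightarrow> (real^'n \<Rightarrow> real) \<Rightarrow> bool" where
  "component_minimizer \<Omega> W f g U \<longleftrightarrow> U \<in> W12 \<and> (AE x in lebesgue. x \<notin> W \<longrightarrow> U x = 0) \<and>
     (\<forall>v\<in>W12. (AE x in lebesgue. x \<notin> W \<longrightarrow> v x = 0) \<longrightarrow>
       (\<integral>x. (norm (distr_grad U x))\<^sup>2 \<partial>lebesgue) + (\<integral>x. (U x)\<^sup>2 * f x - U x * g x \<partial>lebesgue_on \<Omega>)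
       \<le> (\<integral>x. (norm (distr_grad v x))\<^sup>2 \<partial>lebesgue) + (\<integral>x. (v x)\<^sup>2 * f x - v x * g x \<partial>lebesgue_on \<Omega>))"

lemma minimizer_imp_component_minimizer:
  fixes u :: "'m::finite \<Rightarrow> real^'n \<Rightarrow> real"
  assumes "is_minimizer \<Omega> f g F u W"
  shows "component_minimizer \<Omega> (W i) (f i) (g i) (u i)"
  unfolding component_minimizer_def
proof (intro conjI ballI impI)
  have adm: "(u, W) \<in> admissible \<Omega>"
    and min: "\<And>u' W'. (u', W') \<in> admissible \<Omega> \<Longrightarrow> J_fun \<Omega> f g F u W \<le> J_fun \<Omega> f g F u' W'"
    using assms by (auto simp: is_minimizer_def)
  show "u i \<in> W12" "AE x in lebesgue. x \<notin> W i \<longrightarrow> u i x = 0" using adm by (auto simp: admissible_def)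
  fix v assume v: "v \<in> W12" "AE x in lebesgue. x \<notin> W i \<longrightarrow> v x = 0"
  have "(u(i := v), W) \<in> admissible \<Omega>" using adm v by (auto simp: admissible_def)
  from min[OF this] show "(\<integral>x. (norm (distr_grad (u i) x))\<^sup>2 \<partial>lebesgue) + (\<integral>x. (u i x)\<^sup>2 * f i x - u i x * g i x \<partial>lebesgue_on \<Omega>)
       \<le> (\<integral>x. (norm (distr_grad v x))\<^sup>2 \<partial>lebesgue) + (\<integral>x. (v x)\<^sup>2 * f i x - v x * g i x \<partial>lebesgue_on \<Omega>)"
    unfolding J_fun_def by (simp add: sum.remove[of UNIV i])
qed

text \<open>
  The representative vanishes everywhere off \<open>W\<close>, so that its level sets at positive levels are
  contained in \<open>W\<close>.
\<close>

lemma W12_borel_rep: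
  fixes U :: "real^'n \<Rightarrow> real"
  assumes U: "U \<in> W12" and W[measurable]: "W \<in> sets borel" and U0: "AE x in lebesgue. x \<notin> W \<longrightarrow> U x = 0"
  obtains u d where "sobolev_rep U u d" "\<And>x. x \<notin> W \<Longrightarrow> u x = 0"
proof -
  have "in_Lp_loc 2 U" using U by (simp add: W12_def)
  then obtain u where u: "u \<in> borel_measurable lborel" "AE x in lborel. U x = u x"
    using completion_ex_borel_measurable_real[OF borel_measurable_lebesgue_if_local] by blast
  let ?u = "\<lambda>x. indicator W x * u x"
  have um: "?u \<in> borel_measurable borel" using u(1) by simp
  have "AE x in lborel. x \<notin> W \<longrightarrow> U x = 0" using U0 by (simp add: AE_completion_iff)
  with u(2) have "AE x in lborel. U x = ?u x" by eventually_elim (auto simp: indicator_def)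
  then obtain d where "sobolev_rep U ?u d" using W12_imp_sobolev_rep[OF U um] by blast
  then show ?thesis by (rule that) simp
qed

lemma sobolev_rep_uminus:
  assumes "sobolev_rep U u d"
  shows "sobolev_rep (\<lambda>x. - U x) (\<lambda>x. - u x) (\<lambda>j x. - d j x)"
  using assms weak_partial_cmult[of _ u "d _" "- 1"] by (auto simp: sobolev_rep_def)

lemma component_minimizer_uminus:
  fixes U :: "real^'n \<Rightarrow> real"
  assumes "component_minimizer \<Omega> W f g U"
  shows "component_minimizer \<Omega> W f (\<lambda>x. - g x) (\<lambda>x. - U x)"
proof -
  have neg: "(\<lambda>x. - v x) \<in> W12 \<and> (\<integral>x. (norm (distr_grad (\<lambda>x. - v x) x))\<^sup>2 \<partial>lebesgue) = (\<integral>x. (norm (distr_grad v x))\<^sup>2 \<partial>lebesgue)"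
    if v: "v \<in> W12" for v :: "real^'n \<Rightarrow> real"
  proof -
    obtain u d where rep: "sobolev_rep v u d" by (rule W12_borel_rep[OF v, of UNIV]) auto
    show ?thesis
      using sobolev_rep_imp_W12[OF sobolev_rep_uminus[OF rep]] sobolev_rep_energy[OF sobolev_rep_uminus[OF rep]]
        sobolev_rep_energy[OF rep] by simp
  qed
  show ?thesis
    unfolding component_minimizer_def
  proof (intro conjI ballI impI)
    have U: "U \<in> W12" "AE x in lebesgue. x \<notin> W \<longrightarrow> U x = 0" using assms by (auto simp: component_minimizer_def)
    show "(\<lambda>x. - U x) \<in> W12" "AE x in lebesgue. x \<notin> W \<longrightarrow> - U x = 0" using neg U by auto
    fix v :: "real^'n \<Rightarrow> real" assume v: "v \<in> W12" "AE x in lebesgue. x \<notin> W \<longrightarrow> v x = 0"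
    have "(\<integral>x. (norm (distr_grad U x))\<^sup>2 \<partial>lebesgue) + (\<integral>x. (U x)\<^sup>2 * f x - U x * g x \<partial>lebesgue_on \<Omega>)
       \<le> (\<integral>x. (norm (distr_grad (\<lambda>x. - v x) x))\<^sup>2 \<partial>lebesgue) + (\<integral>x. (- v x)\<^sup>2 * f x - (- v x) * g x \<partial>lebesgue_on \<Omega>)"
    proof (rule assms[unfolded component_minimizer_def, THEN conjunct2, THEN conjunct2, rule_format])
      show "(\<lambda>x. - v x) \<in> W12" using neg[OF v(1)] by blast
      show "AE x in lebesgue. x \<notin> W \<longrightarrow> - v x = 0" using v(2) by simp
    qed
    then show "(\<integral>x. (norm (distr_grad (\<lambda>x. - U x) x))\<^sup>2 \<partial>lebesgue) + (\<integral>x. (- U x)\<^sup>2 * f x - (- U x) * (- g x) \<partial>lebesgue_on \<Omega>)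
       \<le> (\<integral>x. (norm (distr_grad v x))\<^sup>2 \<partial>lebesgue) + (\<integral>x. (v x)\<^sup>2 * f x - v x * (- g x) \<partial>lebesgue_on \<Omega>)"
      using neg[OF v(1)] neg[OF U(1)] by simp
  qed
qed

text \<open>
  Where \<open>w\<close> does not vanish, \<open>u \<ge> k > 0\<close>, and so \<open>u f\<close> is controlled by the data term itself:
  \<open>u f - g\<close> is the quotient of \<open>u\<^sup>2 f - u g\<close> and \<open>u\<close>. Thus integrability of the data term of \<open>u\<close>
  carries over to the competitor, although \<open>u\<^sup>2 f\<close> is not known to be integrable beforehand.
\<close>

lemma truncation_data_increment:
  fixes u f g k h :: real
  assumes kh: "0 < k" "k < h"
  defines "w \<equiv> trunc k h u"
  shows "\<bar>(u - w)\<^sup>2 * f - (u - w) * g - (u\<^sup>2 * f - u * g)\<bar> \<le> 2 * (h - k) * (\<bar>u\<^sup>2 * f - u * g\<bar> / k + \<bar>g\<bar>) + (h - k) * \<bar>g\<bar>"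
    and "f \<ge> 0 \<Longrightarrow> (u - w)\<^sup>2 * f - (u - w) * g - (u\<^sup>2 * f - u * g) \<le> (h - k) * (indicator {x. k \<le> x} u * \<bar>g\<bar>)"
proof -
  have w: "w = min (max (u - k) 0) (h - k)" using kh by (simp add: w_def trunc_eq)
  have eq: "(u - w)\<^sup>2 * f - (u - w) * g - (u\<^sup>2 * f - u * g) = - (w * (2 * u - w) * f) + w * g"
    by (simp add: power2_eq_square algebra_simps)
  have *: "\<bar>(u - w)\<^sup>2 * f - (u - w) * g - (u\<^sup>2 * f - u * g)\<bar> \<le> 2 * (h - k) * (\<bar>u\<^sup>2 * f - u * g\<bar> / k + \<bar>g\<bar>) + (h - k) * \<bar>g\<bar>
     \<and> (f \<ge> 0 \<longrightarrow> (u - w)\<^sup>2 * f - (u - w) * g - (u\<^sup>2 * f - u * g) \<le> (h - k) * (indicator {x. k \<le> x} u * \<bar>g\<bar>))"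
  proof (cases "k \<le> u")
    case False
    then show ?thesis using kh by (simp add: w)
  next
    case True
    have w0: "0 \<le> w" "w \<le> h - k" "w \<le> u" using True kh by (auto simp: w)
    have "\<bar>w * g\<bar> \<le> (h - k) * \<bar>g\<bar>"
      unfolding abs_mult using w0 by (intro mult_right_mono) auto
    then have wg: "w * g \<le> (h - k) * \<bar>g\<bar>" "\<bar>w * g\<bar> \<le> (h - k) * \<bar>g\<bar>" by linarith+
    have "\<bar>u * f - g\<bar> \<le> \<bar>u\<^sup>2 * f - u * g\<bar> / k"
    proof -
      have "k * \<bar>u * f - g\<bar> \<le> u * \<bar>u * f - g\<bar>" using True by (intro mult_right_mono) auto
      also have "\<dots> = \<bar>u\<^sup>2 * f - u * g\<bar>" 
      proof -
        have e: "u\<^sup>2 * f - u * g = u * (u * f - g)" by (simp add: power2_eq_square algebra_simps)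
        show ?thesis unfolding e abs_mult using True kh by simp
      qed
      finally show ?thesis using kh by (simp add: field_simps)
    qed
    moreover have "u * \<bar>f\<bar> = \<bar>u * f\<bar>" using True kh by (simp add: abs_mult)
    moreover have "\<bar>u * f\<bar> \<le> \<bar>u * f - g\<bar> + \<bar>g\<bar>" by linarith
    ultimately have uf: "u * \<bar>f\<bar> \<le> \<bar>u\<^sup>2 * f - u * g\<bar> / k + \<bar>g\<bar>" by linarith
    have "\<bar>w * (2 * u - w) * f\<bar> = w * ((2 * u - w) * \<bar>f\<bar>)" using w0 by (simp add: abs_mult)
    also have "\<dots> \<le> (h - k) * (2 * (\<bar>u\<^sup>2 * f - u * g\<bar> / k + \<bar>g\<bar>))"
    proof (rule mult_mono)
      have "(2 * u - w) * \<bar>f\<bar> \<le> 2 * (u * \<bar>f\<bar>)" using w0 mult_nonneg_nonneg[of w "\<bar>f\<bar>"] by (simp add: left_diff_distrib)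
      also have "\<dots> \<le> 2 * (\<bar>u\<^sup>2 * f - u * g\<bar> / k + \<bar>g\<bar>)" using uf by (intro mult_left_mono) auto
      finally show "(2 * u - w) * \<bar>f\<bar> \<le> 2 * (\<bar>u\<^sup>2 * f - u * g\<bar> / k + \<bar>g\<bar>)" .
    qed (use w0 kh in auto)
    also have "\<dots> = 2 * (h - k) * (\<bar>u\<^sup>2 * f - u * g\<bar> / k + \<bar>g\<bar>)" by (simp only: ac_simps)
    finally have 1: "\<bar>w * (2 * u - w) * f\<bar> \<le> 2 * (h - k) * (\<bar>u\<^sup>2 * f - u * g\<bar> / k + \<bar>g\<bar>)" .
    have 2: "f \<ge> 0 \<Longrightarrow> 0 \<le> w * (2 * u - w) * f" using w0 by (intro mult_nonneg_nonneg) auto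
    have "\<bar>- X + Y\<bar> \<le> a + b" if "\<bar>X\<bar> \<le> a" "\<bar>Y\<bar> \<le> b" for X Y a b :: real using that by linarith
    from this[OF 1 wg(2)] show ?thesis unfolding eq using 2 wg(1) True by auto
  qed
  then show "\<bar>(u - w)\<^sup>2 * f - (u - w) * g - (u\<^sup>2 * f - u * g)\<bar> \<le> 2 * (h - k) * (\<bar>u\<^sup>2 * f - u * g\<bar> / k + \<bar>g\<bar>) + (h - k) * \<bar>g\<bar>"
    "f \<ge> 0 \<Longrightarrow> (u - w)\<^sup>2 * f - (u - w) * g - (u\<^sup>2 * f - u * g) \<le> (h - k) * (indicator {x. k \<le> x} u * \<bar>g\<bar>)"
    by auto
qed

section \<open>Energy of the truncation of a minimizer\<close>

lemma sobolev_rep_zero: "sobolev_rep (\<lambda>x. 0) (\<lambda>x. 0) (\<lambda>j x. 0)"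
  by (simp add: sobolev_rep_def loc_int_const weak_partial_def)

lemma sobolev_rep_minus_trunc:
  assumes rep: "sobolev_rep U u d" and kh: "0 < k" "k < h"
  shows "sobolev_rep (\<lambda>x. u x - trunc k h (u x)) (\<lambda>x. u x - trunc k h (u x))
    (\<lambda>j x. (1 - trunc_slope k h (u x)) * d j x)"
proof -
  have u[measurable]: "u \<in> borel_measurable borel" and u2: "loc_int (\<lambda>x. (u x)\<^sup>2)"
    and wp: "\<And>j. weak_partial j u (d j)" and d2: "\<And>j. integrable lborel (\<lambda>x. (d j x)\<^sup>2)"
    using rep by (auto simp: sobolev_rep_def)
  have [measurable]: "d j \<in> borel_measurable borel" for j
    using wp[of j] loc_int_measurable unfolding weak_partial_def by blast
  have vm[measurable]: "(\<lambda>x. u x - trunc k h (u x)) \<in> borel_measurable borel"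
    unfolding trunc_def by measurable
  have sl[measurable]: "(\<lambda>x. trunc_slope k h (u x)) \<in> borel_measurable borel"
    unfolding trunc_slope_def by measurable
  have "loc_int (\<lambda>x. (u x - trunc k h (u x))\<^sup>2)"
  proof (rule loc_int_dominated[OF u2, of _ 0])
    fix x
    have "\<bar>u x - trunc k h (u x)\<bar> \<le> \<bar>u x\<bar>" using kh by (auto simp: trunc_eq)
    then have "(u x - trunc k h (u x))\<^sup>2 \<le> (u x)\<^sup>2" by (rule abs_le_square_iff[THEN iffD1])
    then show "\<bar>(u x - trunc k h (u x))\<^sup>2\<bar> \<le> \<bar>(u x)\<^sup>2\<bar> + 0" by simp
  qed measurable
  moreover have "weak_partial j (\<lambda>x. u x - trunc k h (u x)) (\<lambda>x. (1 - trunc_slope k h (u x)) * d j x)" for j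
  proof -
    have "weak_partial j (\<lambda>x. trunc k h (u x)) (\<lambda>x. trunc_slope k h (u x) * d j x)"
      using kh by (intro weak_partial_trunc wp) simp
    from weak_partial_add[OF wp[of j] weak_partial_cmult[OF this, of "- 1"]] show ?thesis
      by (simp add: left_diff_distrib)
  qed
  moreover have "integrable lborel (\<lambda>x. ((1 - trunc_slope k h (u x)) * d j x)\<^sup>2)" for j
  proof (rule Bochner_Integration.integrable_bound[OF d2[of j]])
    have "((1 - trunc_slope k h (u x)) * d j x)\<^sup>2 \<le> (d j x)\<^sup>2" for x
      using trunc_slope_bounds[OF kh(2), of "u x"]
      by (simp add: power_mult_distrib mult_left_le_one_le power_le_one)
    then show "AE x in lborel. norm (((1 - trunc_slope k h (u x)) * d j x)\<^sup>2) \<le> norm ((d j x)\<^sup>2)" by simp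
  qed measurable
  ultimately show ?thesis using vm by (auto simp: sobolev_rep_def measurable_completion)
qed

text \<open>
  The comparison of \<open>u\<close> with \<open>u - trunc k h u\<close>. With slope \<open>\<theta>\<close> in \<open>{0..1}\<close> the gradient splits into
  \<open>\<theta> d\<close> and \<open>(1 - \<theta>) d\<close>, and \<open>\<theta>\<^sup>2 + (1 - \<theta>)\<^sup>2 \<le> 1\<close> shows that the energy of the truncation is at
  most the energy gained. Since the Bochner integral of a function that is not integrable is \<open>0\<close>,
  a minimizer could in principle have a meaningless data term; it is then compared with the zero
  function, which forces its gradient to vanish.
\<close>

lemma truncation_energy_le:
  fixes U u :: "real^'n \<Rightarrow> real"
  assumes min: "component_minimizer \<Omega> W f g U" and \<Omega>: "\<Omega> \<in> sets borel"
    and rep: "sobolev_rep U u d" and u0: "\<And>x. x \<notin> W \<Longrightarrow> u x = 0"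
    and f: "f \<in> borel_measurable (lebesgue_on \<Omega>)" "AE x in lebesgue_on \<Omega>. f x \<ge> 0"
    and g: "integrable (lebesgue_on \<Omega>) g" and kh: "0 < k" "k < h"
  shows "(\<integral>x. (\<Sum>j\<in>UNIV. (trunc_slope k h (u x) * d j x)\<^sup>2) \<partial>lborel)
    \<le> (h - k) * (\<integral>x. indicator {x. k \<le> u x} x * \<bar>g x\<bar> \<partial>lebesgue_on \<Omega>)"
proof -
  define M where "M = lebesgue_on \<Omega>"
  have u[measurable]: "u \<in> borel_measurable borel" and Uu: "AE x in lborel. U x = u x"
    and wp: "\<And>j. weak_partial j u (d j)" and d2: "\<And>j. integrable lborel (\<lambda>x. (d j x)\<^sup>2)"
    and Um: "U \<in> borel_measurable lebesgue"
    using rep by (auto simp: sobolev_rep_def)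
  have [measurable]: "d j \<in> borel_measurable borel" for j
    using wp[of j] loc_int_measurable unfolding weak_partial_def by blast
  have ul: "u \<in> borel_measurable lebesgue" using u by (simp add: measurable_completion)
  have [measurable]: "u \<in> borel_measurable M" "U \<in> borel_measurable M" "f \<in> borel_measurable M" "g \<in> borel_measurable M"
    using f(1) borel_measurable_integrable[OF g] measurable_restrict_space1[OF ul] measurable_restrict_space1[OF Um]
    by (auto simp: M_def)
  have sl[measurable]: "(\<lambda>x. trunc_slope k h (u x)) \<in> borel_measurable borel"
    unfolding trunc_slope_def by measurable
  define \<theta> where "\<theta> = (\<lambda>x. trunc_slope k h (u x))"
  have \<theta>: "0 \<le> \<theta> x" "\<theta> x \<le> 1" for x using trunc_slope_bounds[OF kh(2)] by (auto simp: \<theta>_def)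
  have [measurable]: "\<theta> \<in> borel_measurable borel" unfolding \<theta>_def by measurable
  have dom: "integrable lborel (\<lambda>x. (c x * d j x)\<^sup>2)"
    if [measurable]: "c \<in> borel_measurable borel" and c: "\<And>x. \<bar>c x\<bar> \<le> 1" for c j
  proof (rule Bochner_Integration.integrable_bound[OF d2[of j]])
    have "(c x * d j x)\<^sup>2 \<le> (d j x)\<^sup>2" for x
      using c[of x] by (simp add: power_mult_distrib mult_left_le_one_le abs_square_le_1)
    then show "AE x in lborel. norm ((c x * d j x)\<^sup>2) \<le> norm ((d j x)\<^sup>2)" by simp
  qed measurable
  have i\<theta>: "integrable lborel (\<lambda>x. (\<theta> x * d j x)\<^sup>2)" "integrable lborel (\<lambda>x. ((1 - \<theta> x) * d j x)\<^sup>2)" for j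
  proof -
    show "integrable lborel (\<lambda>x. (\<theta> x * d j x)\<^sup>2)" by (rule dom) (use \<theta> in simp_all)
    show "integrable lborel (\<lambda>x. ((1 - \<theta> x) * d j x)\<^sup>2)" by (rule dom[of "\<lambda>x. 1 - \<theta> x"]) (use \<theta> in simp_all)
  qed
  define H where "H = (\<lambda>x. (u x)\<^sup>2 * f x - u x * g x)"
  have [measurable]: "H \<in> borel_measurable M" unfolding H_def by measurable
  have UH: "(\<integral>x. (U x)\<^sup>2 * f x - U x * g x \<partial>M) = (\<integral>x. H x \<partial>M)"
  proof (rule integral_cong_AE)
    have "AE x in lebesgue. U x = u x" using Uu by (rule AE_completion)
    then have "AE x in M. U x = u x" 
    proof -
      have "\<Omega> \<inter> space lebesgue \<in> sets lebesgue" using \<Omega> by simp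
      from AE_restrict_space_iff[OF this, of "\<lambda>x. U x = u x"] \<open>AE x in lebesgue. U x = u x\<close>
      show ?thesis unfolding M_def by (simp add: eventually_mono)
    qed
    then show "AE x in M. (U x)\<^sup>2 * f x - U x * g x = H x" by eventually_elim (simp add: H_def)
  qed measurable
  define T where "T = (\<integral>x. (\<Sum>j\<in>UNIV. (\<theta> x * d j x)\<^sup>2) \<partial>lborel)"
  define E where "E = (\<integral>x. (\<Sum>j\<in>UNIV. (d j x)\<^sup>2) \<partial>lborel)"
  have compare: "E + (\<integral>x. H x \<partial>M) \<le> (\<integral>x. (\<Sum>j\<in>UNIV. (d' j x)\<^sup>2) \<partial>lborel) + (\<integral>x. (v x)\<^sup>2 * f x - v x * g x \<partial>M)"
    if v: "sobolev_rep v v d'" "\<And>x. x \<notin> W \<Longrightarrow> v x = 0" for v d'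
  proof -
    have "AE x in lebesgue. x \<notin> W \<longrightarrow> v x = 0" using v(2) by simp
    from min[unfolded component_minimizer_def, THEN conjunct2, THEN conjunct2, rule_format,
        OF sobolev_rep_imp_W12[OF v(1)] this]
    show ?thesis
      unfolding M_def[symmetric] UH sobolev_rep_energy[OF rep] sobolev_rep_energy[OF v(1)] E_def .
  qed
  have gint: "integrable M (\<lambda>x. indicator {x. k \<le> u x} x * \<bar>g x\<bar>)"
  proof -
    have "integrable M g" using g by (simp add: M_def)
    moreover have "(\<lambda>x. if k \<le> u x then \<bar>g x\<bar> else 0) \<in> borel_measurable M"
    proof (rule measurable_If)
      show "{x \<in> space M. k \<le> u x} \<in> sets M" by (intro borel_measurable_le) auto
    qed auto
    ultimately have "integrable M (\<lambda>x. if k \<le> u x then \<bar>g x\<bar> else 0)"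
      by (rule Bochner_Integration.integrable_bound) (auto intro!: AE_I2)
    moreover have "(\<lambda>x. if k \<le> u x then \<bar>g x\<bar> else 0) = (\<lambda>x. indicator {x. k \<le> u x} x * \<bar>g x\<bar>)"
      by (auto simp: indicator_def)
    ultimately show ?thesis by simp
  qed
  have "T \<le> (h - k) * (\<integral>x. indicator {x. k \<le> u x} x * \<bar>g x\<bar> \<partial>M)"
  proof (cases "integrable M H")
    case False
    have "E \<le> 0"
      using compare[OF sobolev_rep_zero] not_integrable_integral_eq[OF False] by simp
    moreover have "T \<le> E"
      unfolding T_def E_def
    proof (rule integral_mono)
      show "(\<Sum>j\<in>UNIV. (\<theta> x * d j x)\<^sup>2) \<le> (\<Sum>j\<in>UNIV. (d j x)\<^sup>2)" for x
        using \<theta>[of x] by (intro sum_mono) (simp add: power_mult_distrib mult_left_le_one_le power_le_one)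
    qed (use i\<theta> d2 in auto)
    moreover have "0 \<le> (h - k) * (\<integral>x. indicator {x. k \<le> u x} x * \<bar>g x\<bar> \<partial>M)" using kh by simp
    ultimately show ?thesis by linarith
  next
    case True
    define v where "v = (\<lambda>x. u x - trunc k h (u x))"
    have [measurable]: "v \<in> borel_measurable M" unfolding v_def trunc_def by measurable
    define H' where "H' = (\<lambda>x. (v x)\<^sup>2 * f x - v x * g x)"
    have [measurable]: "H' \<in> borel_measurable M" unfolding H'_def by measurable
    have "v x = 0" if "x \<notin> W" for x using u0[OF that] kh by (simp add: v_def trunc_eq)
    then have le: "E + (\<integral>x. H x \<partial>M) \<le> (\<integral>x. (\<Sum>j\<in>UNIV. ((1 - \<theta> x) * d j x)\<^sup>2) \<partial>lborel) + (\<integral>x. H' x \<partial>M)"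
      using compare[OF sobolev_rep_minus_trunc[OF rep kh]] by (simp add: v_def H'_def \<theta>_def)
    have incr: "integrable M (\<lambda>x. H' x - H x)"
    proof (rule Bochner_Integration.integrable_bound)
      show "integrable M (\<lambda>x. 2 * (h - k) * (\<bar>H x\<bar> / k + \<bar>g x\<bar>) + (h - k) * \<bar>g x\<bar>)"
        using True g unfolding M_def[symmetric] by auto
      show "AE x in M. norm (H' x - H x) \<le> norm (2 * (h - k) * (\<bar>H x\<bar> / k + \<bar>g x\<bar>) + (h - k) * \<bar>g x\<bar>)"
      proof (rule AE_I2)
        fix x
        have "\<bar>H' x - H x\<bar> \<le> 2 * (h - k) * (\<bar>H x\<bar> / k + \<bar>g x\<bar>) + (h - k) * \<bar>g x\<bar>"
          unfolding H_def H'_def v_def by (rule truncation_data_increment(1)[OF kh])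
        then show "norm (H' x - H x) \<le> norm (2 * (h - k) * (\<bar>H x\<bar> / k + \<bar>g x\<bar>) + (h - k) * \<bar>g x\<bar>)"
          unfolding real_norm_def by (rule order_trans[OF _ abs_ge_self])
      qed
    qed measurable
    have H': "integrable M H'" using Bochner_Integration.integrable_add[OF incr True] by simp
    have "(\<integral>x. H' x - H x \<partial>M) \<le> (\<integral>x. (h - k) * (indicator {x. k \<le> u x} x * \<bar>g x\<bar>) \<partial>M)"
    proof (rule integral_mono_AE[OF incr])
      show "AE x in M. H' x - H x \<le> (h - k) * (indicator {x. k \<le> u x} x * \<bar>g x\<bar>)"
        using f(2) unfolding M_def[symmetric]
      proof eventually_elim
        case (elim x)
        from truncation_data_increment(2)[OF kh this, where u = "u x" and g = "g x"] show ?case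
          unfolding H_def H'_def v_def by (simp add: indicator_def)
      qed
    qed (use gint in auto)
    then have HH: "(\<integral>x. H' x \<partial>M) - (\<integral>x. H x \<partial>M) \<le> (h - k) * (\<integral>x. indicator {x. k \<le> u x} x * \<bar>g x\<bar> \<partial>M)"
      using H' True by simp
    have "T + (\<integral>x. (\<Sum>j\<in>UNIV. ((1 - \<theta> x) * d j x)\<^sup>2) \<partial>lborel)
      = (\<integral>x. (\<Sum>j\<in>UNIV. (\<theta> x * d j x)\<^sup>2) + (\<Sum>j\<in>UNIV. ((1 - \<theta> x) * d j x)\<^sup>2) \<partial>lborel)"
      unfolding T_def using i\<theta> by simp
    also have "\<dots> \<le> E"
      unfolding E_def
    proof (rule integral_mono)
      fix x
      have "\<theta> x * \<theta> x \<le> \<theta> x" using \<theta>[of x] by (simp add: mult_left_le)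
      then have "(\<theta> x)\<^sup>2 + (1 - \<theta> x)\<^sup>2 \<le> 1" by (simp add: power2_eq_square algebra_simps)
      then have "((\<theta> x)\<^sup>2 + (1 - \<theta> x)\<^sup>2) * (d j x)\<^sup>2 \<le> 1 * (d j x)\<^sup>2" for j by (rule mult_right_mono) simp
      then show "(\<Sum>j\<in>UNIV. (\<theta> x * d j x)\<^sup>2) + (\<Sum>j\<in>UNIV. ((1 - \<theta> x) * d j x)\<^sup>2) \<le> (\<Sum>j\<in>UNIV. (d j x)\<^sup>2)"
        unfolding sum.distrib[symmetric] by (intro sum_mono) (simp add: power_mult_distrib distrib_right)
    qed (use i\<theta> d2 in auto)
    finally show ?thesis using le HH by linarith
  qed
  then show ?thesis by (simp add: T_def \<theta>_def M_def)
qed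

section \<open>Decay of the level sets\<close>

text \<open>
  Along the levels \<open>\<kappa> m = K (2 - 2\<^bsup>-m\<^esup>)\<close> the measures decay like \<open>V q\<^bsup>m\<^esup>\<close>. The ratio \<open>q\<close> is
  chosen so that \<open>q\<^bsup>\<beta>\<^esup> = 2\<^bsup>-1/2\<^esup>\<close> compensates the growth of \<open>(h - k)\<^bsup>-1/2\<^esup>\<close> from one step to the
  next, and \<open>K\<close> so that the constants close the induction; the summand \<open>1\<close> keeps \<open>K\<close> positive.
\<close>

lemma stampacchia_iteration:
  fixes a :: "real \<Rightarrow> real"
  assumes a: "\<And>k. k > 0 \<Longrightarrow> 0 \<le> a k" "\<And>k. k > 0 \<Longrightarrow> a k \<le> V"
    and mono: "\<And>k h. 0 < k \<Longrightarrow> k \<le> h \<Longrightarrow> a h \<le> a k"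
    and decay: "\<And>k h. 0 < k \<Longrightarrow> k < h \<Longrightarrow> sqrt (h - k) * a h \<le> C * a k powr (1 + \<beta>)"
    and C: "C \<ge> 0" and \<beta>: "\<beta> > 0"
    and q_def: "q = 2 powr (- 1 / (2 * \<beta>))"
    and K_def: "K = 1 + 2 * (C * V powr \<beta> / q)\<^sup>2"
  shows "a (2 * K) = 0"
proof -
  have q: "0 < q" "q < 1" "q powr \<beta> = sqrt (1 / 2)"
  proof -
    show "0 < q" by (simp add: q_def)
    show "q < 1" using powr_less_mono[of "- 1 / (2 * \<beta>)" 0 2] \<beta> by (simp add: q_def)
    have "q powr \<beta> = 2 powr (- (1 / 2))" using \<beta> by (simp add: q_def powr_powr)
    also have "\<dots> = sqrt (1 / 2)" by (simp only: powr_minus powr_half_sqrt real_sqrt_inverse[symmetric]) (simp add: inverse_eq_divide)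
    finally show "q powr \<beta> = sqrt (1 / 2)" .
  qed
  have V: "V \<ge> 0" using a[of 1] by simp
  have K: "K \<ge> 1" by (simp add: K_def)
  have CK: "C * V powr \<beta> \<le> sqrt K * sqrt (1 / 2) * q"
  proof -
    have "(C * V powr \<beta> / q)\<^sup>2 \<le> K * (1 / 2)" by (simp add: K_def)
    then have "C * V powr \<beta> / q \<le> sqrt (K * (1 / 2))" by (rule real_le_rsqrt)
    then show ?thesis using q by (simp only: real_sqrt_mult pos_divide_le_eq)
  qed
  define \<kappa> where "\<kappa> = (\<lambda>m::nat. K * (2 - (1 / 2) ^ m))"
  have half: "(1 / 2 :: real) ^ m \<le> 1" for m by (simp add: power_le_one)
  have \<kappa>: "\<kappa> m > 0" "\<kappa> m < \<kappa> (Suc m)" "\<kappa> m \<le> 2 * K" "\<kappa> (Suc m) - \<kappa> m = K * (1 / 2) ^ Suc m" for m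
    using K half[of m] by (auto simp: \<kappa>_def intro!: mult_pos_pos) (auto simp: algebra_simps)
  have bound: "a (\<kappa> m) \<le> V * q ^ m" for m
  proof (induction m)
    case 0
    then show ?case using a(2)[OF \<kappa>(1)] by simp
  next
    case (Suc m)
    have "sqrt K * sqrt (1 / 2) * sqrt (1 / 2) ^ m * a (\<kappa> (Suc m)) = sqrt (\<kappa> (Suc m) - \<kappa> m) * a (\<kappa> (Suc m))"
      by (simp only: \<kappa>(4) real_sqrt_mult real_sqrt_power power_Suc mult.assoc)
    also have "\<dots> \<le> C * a (\<kappa> m) powr (1 + \<beta>)" by (rule decay[OF \<kappa>(1,2)])
    also have "\<dots> \<le> C * (V * q ^ m) powr (1 + \<beta>)"
      using C \<beta> Suc a(1)[OF \<kappa>(1)] by (intro mult_left_mono powr_mono2) auto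
    also have "\<dots> = C * V powr \<beta> * V * (q ^ m * (q powr \<beta>) ^ m)"
    proof -
      have "(q ^ m) powr \<beta> = (q powr \<beta>) ^ m" using q(1)
        by (simp add: powr_realpow[symmetric] powr_powr mult.commute)
      then show ?thesis using V q by (simp add: powr_mult powr_add)
    qed
    also have "\<dots> \<le> (sqrt K * sqrt (1 / 2) * q) * V * (q ^ m * (q powr \<beta>) ^ m)"
      using CK V q by (intro mult_right_mono) auto
    also have "\<dots> = sqrt K * sqrt (1 / 2) * sqrt (1 / 2) ^ m * (V * q ^ Suc m)"
      unfolding q(3) by (simp only: power_Suc ac_simps)
    finally have "(sqrt K * sqrt (1 / 2) * sqrt (1 / 2) ^ m) * a (\<kappa> (Suc m)) \<le> (sqrt K * sqrt (1 / 2) * sqrt (1 / 2) ^ m) * (V * q ^ Suc m)" .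
    then show ?case using K by (subst (asm) mult_le_cancel_left_pos) auto
  qed
  have "a (2 * K) \<le> V * q ^ m" for m
    using mono[OF \<kappa>(1,3)[of m]] bound[of m] by linarith
  moreover have "(\<lambda>m. V * q ^ m) \<longlonglongrightarrow> V * 0"
    using q by (intro tendsto_intros LIMSEQ_realpow_zero) auto
  ultimately have "a (2 * K) \<le> 0" by (metis LIMSEQ_le_const mult_zero_right)
  then show ?thesis using a(1)[of "2 * K"] K by simp
qed

text \<open>
  For \<open>w = trunc k h u\<close>, which equals \<open>h - k\<close> on the upper level set,
  \<open>(h - k) |A h| \<le> \<integral>w \<le> C |A k|\<^bsup>1/n\<^esup> \<integral>|\<nabla>w| \<le> C |A k|\<^bsup>1/n + 1/2\<^esup> (\<integral>|\<nabla>w|\<^sup>2)\<^bsup>1/2\<^esup>\<close>; insert the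
  energy bound and divide by \<open>(h - k)\<^bsup>1/2\<^esup>\<close>.
\<close>

lemma level_set_decay:
  fixes u :: "real^'n \<Rightarrow> real"
  assumes u[measurable]: "u \<in> borel_measurable borel" and wp: "\<And>j. weak_partial j u (d j)"
    and d2: "\<And>j. integrable lborel (\<lambda>x. (d j x)\<^sup>2)"
    and fin: "\<And>k. k > 0 \<Longrightarrow> emeasure lborel {x. k \<le> u x} < \<infinity>"
    and kh: "0 < k" "k < h" and G: "G \<ge> 0"
    and energy: "(\<integral>x. (\<Sum>j\<in>UNIV. (trunc_slope k h (u x) * d j x)\<^sup>2) \<partial>lborel)
      \<le> (h - k) * (G * measure lborel {x. k \<le> u x} powr (1 - \<tau>))"
  shows "sqrt (h - k) * measure lborel {x. h \<le> u x}
    \<le> 2 * 2 powr (1 / CARD('n)) * CARD('n) * sqrt G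
       * measure lborel {x. k \<le> u x} powr (1 + (1 / CARD('n) - \<tau> / 2))"
proof -
  define n where "n = real CARD('n)"
  have n: "n > 0" by (simp add: n_def)
  define A where "A = (\<lambda>k. {x. k \<le> u x})"
  have A[measurable]: "A k \<in> sets borel" for k unfolding A_def by measurable
  have finA: "emeasure lborel (A k) < \<infinity>" "emeasure lborel (A h) < \<infinity>" using fin[of k] fin[of h] kh by (simp_all add: A_def)
  define a where "a = measure lborel (A k)"
  have a0: "a \<ge> 0" by (simp add: a_def)
  have [measurable]: "d j \<in> borel_measurable borel" for j
    using wp[of j] loc_int_measurable unfolding weak_partial_def by blast
  define w where "w = (\<lambda>x. trunc k h (u x))"
  have w: "w x = min (max (u x - k) 0) (h - k)" for x using kh by (simp add: w_def trunc_eq)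
  have [measurable]: "w \<in> borel_measurable borel" unfolding w_def trunc_def by measurable
  have w0: "w x \<ge> 0" for x using kh by (simp add: w)
  have wout: "x \<notin> A k \<Longrightarrow> w x = 0" for x using kh by (simp add: w A_def)
  have wint: "integrable lborel w"
  proof (rule Bochner_Integration.integrable_bound)
    show "integrable lborel (\<lambda>x. (h - k) * indicator (A k) x)" using finA by auto
    show "AE x in lborel. norm (w x) \<le> norm ((h - k) * indicator (A k) x)"
      using kh by (intro AE_I2) (auto simp: w A_def indicator_def)
  qed measurable
  define \<delta> where "\<delta> = (\<lambda>j x. trunc_slope k h (u x) * d j x)"
  have w\<delta>: "weak_partial j w (\<delta> j)" for j
    unfolding w_def \<delta>_def using kh by (intro weak_partial_trunc wp) auto
  have sl[measurable]: "(\<lambda>x. trunc_slope k h (u x)) \<in> borel_measurable borel"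
    unfolding trunc_slope_def by measurable
  have [measurable]: "\<delta> j \<in> borel_measurable borel" for j unfolding \<delta>_def by measurable
  have \<delta>2: "integrable lborel (\<lambda>x. (\<delta> j x)\<^sup>2)" for j
  proof (rule Bochner_Integration.integrable_bound[OF d2[of j]])
    have "(\<delta> j x)\<^sup>2 \<le> (d j x)\<^sup>2" for x
      using trunc_slope_bounds[OF kh(2), of "u x"]
      by (simp add: \<delta>_def power_mult_distrib mult_left_le_one_le power_le_one)
    then show "AE x in lborel. norm ((\<delta> j x)\<^sup>2) \<le> norm ((d j x)\<^sup>2)" by simp
  qed measurable
  have \<delta>out: "x \<notin> A k \<Longrightarrow> \<delta> j x = 0" for j x
    using trunc_slope_bounds(3)[OF kh(2), of "u x"] by (simp add: A_def \<delta>_def)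
  note \<delta>1 = integral_abs_le_sqrt_measure[OF _ \<delta>2 A finA(1) \<delta>out]
  define T where "T = (\<integral>x. (\<Sum>j\<in>UNIV. (\<delta> j x)\<^sup>2) \<partial>lborel)"
  have "(h - k) * measure lborel (A h) = (\<integral>x. (h - k) * indicator (A h) x \<partial>lborel)" by simp
  also have "\<dots> \<le> (\<integral>x. w x \<partial>lborel)"
  proof (rule integral_mono[OF _ wint])
    show "integrable lborel (\<lambda>x. (h - k) * indicator (A h) x)" using finA by auto
    show "(h - k) * indicator (A h) x \<le> w x" for x using w0[of x] by (auto simp: w A_def indicator_def)
  qed
  also have "\<dots> \<le> 2 * (2 * a) powr (1 / n) * (\<Sum>j\<in>UNIV. \<integral>x. \<bar>\<delta> j x\<bar> \<partial>lborel)"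
    unfolding a_def n_def
    by (rule L1_Faber_Krahn[OF w\<delta> wint w0 _ A finA(1) wout]) (auto intro: \<delta>1(1))
  also have "\<dots> \<le> 2 * (2 * a) powr (1 / n) * (\<Sum>j\<in>(UNIV::'n set). sqrt a * sqrt T)"
  proof (intro mult_left_mono sum_mono)
    fix j :: 'n
    have "(\<integral>x. \<bar>\<delta> j x\<bar> \<partial>lborel) \<le> sqrt a * sqrt (\<integral>x. (\<delta> j x)\<^sup>2 \<partial>lborel)"
      unfolding a_def by (rule \<delta>1(2)) measurable
    also have "\<dots> \<le> sqrt a * sqrt T"
    proof -
      have "(\<integral>x. (\<delta> j x)\<^sup>2 \<partial>lborel) \<le> T" unfolding T_def
        by (rule integral_mono) (use \<delta>2 in \<open>auto intro: member_le_sum\<close>)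
      then show ?thesis using a0 by (intro mult_left_mono) auto
    qed
    finally show "(\<integral>x. \<bar>\<delta> j x\<bar> \<partial>lborel) \<le> sqrt a * sqrt T" .
  qed auto
  also have "\<dots> = 2 * (2 * a) powr (1 / n) * n * sqrt a * sqrt T" by (simp add: n_def)
  also have "\<dots> \<le> 2 * (2 * a) powr (1 / n) * n * sqrt a * sqrt ((h - k) * (G * a powr (1 - \<tau>)))"
    using energy n a0 by (intro mult_left_mono) (auto simp: T_def \<delta>_def a_def A_def)
  also have "\<dots> = sqrt (h - k) * (2 * 2 powr (1 / n) * n * sqrt G * a powr (1 + (1 / n - \<tau> / 2)))"
  proof (cases "a = 0")
    case False
    then have a: "a > 0" using a0 by simp
    have "a powr (1 + (1 / n - \<tau> / 2)) = a powr (1 / n) * a powr (1 / 2) * (a powr (1 - \<tau>)) powr (1 / 2)"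
    proof -
      have "1 + (1 / n - \<tau> / 2) = 1 / n + 1 / 2 + (1 - \<tau>) * (1 / 2)" by (simp add: field_simps)
      then show ?thesis by (simp only: powr_powr powr_add)
    qed
    moreover have "(2 * a) powr (1 / n) = 2 powr (1 / n) * a powr (1 / n)" using a by (simp add: powr_mult)
    ultimately show ?thesis using a by (simp add: powr_half_sqrt real_sqrt_mult)
  qed simp
  finally have "sqrt (h - k) * (sqrt (h - k) * measure lborel (A h))
     \<le> sqrt (h - k) * (2 * 2 powr (1 / n) * n * sqrt G * a powr (1 + (1 / n - \<tau> / 2)))"
    using kh by (simp add: mult.assoc[symmetric])
  then have "sqrt (h - k) * measure lborel (A h) \<le> 2 * 2 powr (1 / n) * n * sqrt G * a powr (1 + (1 / n - \<tau> / 2))"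
    using kh by (subst (asm) mult_le_cancel_left_pos) auto
  then show ?thesis by (simp add: A_def a_def n_def)
qed

text \<open>
  The level \<open>2 K\<close> of \<open>stampacchia_iteration\<close> with the constants of \<open>level_set_decay\<close>; \<open>\<tau>\<close> stands
  for \<open>1/p\<close>.
\<close>

definition sup_bound :: "nat \<Rightarrow> real \<Rightarrow> real \<Rightarrow> real \<Rightarrow> real" where
  "sup_bound n \<tau> V G =
     (let \<beta> = 1 / n - \<tau> / 2; C = 2 * 2 powr (1 / n) * n * sqrt G; q = 2 powr (- 1 / (2 * \<beta>))
      in 2 * (1 + 2 * (C * V powr \<beta> / q)\<^sup>2))"

lemma component_minimizer_upper_bound:
  fixes U :: "real^'n \<Rightarrow> real"
  assumes min: "component_minimizer \<Omega> W f g U" and \<Omega>: "\<Omega> \<in> sets borel"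
    and V: "emeasure lebesgue \<Omega> < \<infinity>" "measure lebesgue \<Omega> = V"
    and W: "W \<in> sets borel" "W \<subseteq> \<Omega>"
    and f: "f \<in> borel_measurable (lebesgue_on \<Omega>)" "AE x in lebesgue_on \<Omega>. f x \<ge> 0"
    and g: "in_Lp (lebesgue_on \<Omega>) p g" and p: "p \<ge> 1"
    and \<tau>_def: "\<tau> = (if p = \<infinity> then 0 else 1 / enn2real p)" and \<tau>: "\<tau> < 2 / CARD('n)"
  shows "AE x in lebesgue. U x \<le> sup_bound CARD('n) \<tau> V (Lp_norm (lebesgue_on \<Omega>) p g)"
proof -
  define G where "G = Lp_norm (lebesgue_on \<Omega>) p g"
  have G0: "G \<ge> 0" by (simp add: G_def Lp_norm_def)
  obtain u d where rep: "sobolev_rep U u d" and u0: "\<And>x. x \<notin> W \<Longrightarrow> u x = 0"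
    using W12_borel_rep[of U W] min W by (auto simp: component_minimizer_def)
  have u[measurable]: "u \<in> borel_measurable borel" and Uu: "AE x in lborel. U x = u x"
    and wp: "\<And>j. weak_partial j u (d j)" and d2: "\<And>j. integrable lborel (\<lambda>x. (d j x)\<^sup>2)"
    using rep by (auto simp: sobolev_rep_def)
  define A where "A = (\<lambda>k. {x. k \<le> u x})"
  have A[measurable]: "A k \<in> sets borel" for k unfolding A_def by measurable
  have A\<Omega>: "A k \<subseteq> \<Omega>" if "k > 0" for k using that u0 W(2) unfolding A_def by force
  have e\<Omega>: "emeasure lborel \<Omega> < \<infinity>" "measure lborel \<Omega> = V" using V \<Omega> by simp_all
  have finA: "emeasure lborel (A k) < \<infinity>" if "k > 0" for k
    using emeasure_mono[OF A\<Omega>[OF that], of lborel] \<Omega> e\<Omega>(1) by (auto intro: le_less_trans)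
  have mono: "measure lborel (A h) \<le> measure lborel (A k)" if "0 < k" "k \<le> h" for k h
    using that finA[of k] by (intro measure_mono_fmeasurable) (auto simp: A_def fmeasurable_def)
  have AV: "measure lborel (A k) \<le> V" if "k > 0" for k
    unfolding e\<Omega>(2)[symmetric] using A\<Omega>[OF that] \<Omega> e\<Omega>(1) by (intro measure_mono_fmeasurable) (auto simp: fmeasurable_def)
  have fin\<Omega>: "emeasure (lebesgue_on \<Omega>) (space (lebesgue_on \<Omega>)) < \<infinity>"
    using V(1) \<Omega> by (simp add: emeasure_restrict_space)
  have gA: "(\<integral>x. indicator (A k) x * \<bar>g x\<bar> \<partial>lebesgue_on \<Omega>) \<le> G * measure lborel (A k) powr (1 - \<tau>)" if "k > 0" for k
  proof -
    have "A k \<in> sets (lebesgue_on \<Omega>)" using A\<Omega>[OF that] \<Omega> A[of k] by (simp add: sets_restrict_space_iff)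
    moreover have "measure (lebesgue_on \<Omega>) (A k) = measure lborel (A k)"
      using A\<Omega>[OF that] \<Omega> A[of k] by (simp add: measure_restrict_space)
    ultimately show ?thesis using in_Lp_integral_subset_le[OF g p fin\<Omega>, of "A k"] by (simp add: G_def \<tau>_def)
  qed
  define \<beta> where "\<beta> = 1 / CARD('n) - \<tau> / 2"
  have \<beta>: "\<beta> > 0" using \<tau> by (simp add: \<beta>_def field_simps)
  define C where "C = 2 * 2 powr (1 / CARD('n)) * CARD('n) * sqrt G"
  have decay: "sqrt (h - k) * measure lborel (A h) \<le> C * measure lborel (A k) powr (1 + \<beta>)" if kh: "0 < k" "k < h" for k h
    unfolding A_def C_def \<beta>_def
  proof (rule level_set_decay[OF u wp d2 _ kh G0])
    show "emeasure lborel {x. k \<le> u x} < \<infinity>" if "k > 0" for k using finA[OF that] by (simp add: A_def)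
    have "(\<integral>x. (\<Sum>j\<in>UNIV. (trunc_slope k h (u x) * d j x)\<^sup>2) \<partial>lborel)
      \<le> (h - k) * (\<integral>x. indicator {x. k \<le> u x} x * \<bar>g x\<bar> \<partial>lebesgue_on \<Omega>)"
      by (rule truncation_energy_le[OF min \<Omega> rep u0 f in_Lp_imp_integrable[OF g p fin\<Omega>] kh])
    also have "\<dots> \<le> (h - k) * (G * measure lborel {x. k \<le> u x} powr (1 - \<tau>))"
      using gA[OF kh(1)] kh by (intro mult_left_mono) (auto simp: A_def)
    finally show "(\<integral>x. (\<Sum>j\<in>UNIV. (trunc_slope k h (u x) * d j x)\<^sup>2) \<partial>lborel)
      \<le> (h - k) * (G * measure lborel {x. k \<le> u x} powr (1 - \<tau>))" .
  qed
  define K where "K = 1 + 2 * (C * V powr \<beta> / 2 powr (- 1 / (2 * \<beta>)))\<^sup>2"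
  have K: "2 * K > 0" by (simp add: K_def add_pos_nonneg)
  have "measure lborel (A (2 * K)) = 0"
    by (rule stampacchia_iteration[where a = "\<lambda>k. measure lborel (A k)" and C = C and \<beta> = \<beta>, OF _ AV mono decay _ \<beta> refl K_def])
       (use G0 in \<open>auto simp: C_def\<close>)
  then have "A (2 * K) \<in> null_sets lborel" using finA[OF K] by (auto simp: null_sets_def emeasure_eq_ennreal_measure)
  then have "AE x in lborel. x \<notin> A (2 * K)" by (rule AE_not_in)
  with Uu have "AE x in lborel. U x \<le> 2 * K" by eventually_elim (simp add: A_def)
  then have "AE x in lebesgue. U x \<le> 2 * K" by (rule AE_completion)
  moreover have "2 * K = sup_bound CARD('n) \<tau> V G"
    by (simp add: sup_bound_def Let_def K_def C_def \<beta>_def)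
  ultimately show ?thesis by (simp add: G_def)
qed

theorem theorem5p1:
  fixes p :: ennreal and B V :: real and G :: "'m::finite \<Rightarrow> real"
  assumes "(CARD('n::finite) = 1 \<and> p = 1) \<or>
           (CARD('n) \<ge> 2 \<and> p > ennreal (real CARD('n) / 2))"
  shows "\<exists>C::real. \<forall>(\<Omega> :: (real ^ 'n) set)
            (f :: 'm \<Rightarrow> real ^ 'n \<Rightarrow> real) (g :: 'm \<Rightarrow> real ^ 'n \<Rightarrow> real)
            (F :: ('m \<Rightarrow> (real ^ 'n) set) \<Rightarrow> real)
            (u :: 'm \<Rightarrow> real ^ 'n \<Rightarrow> real) (W :: 'm \<Rightarrow> (real ^ 'n) set).
          \<Omega> \<in> sets borel \<and> emeasure lebesgue \<Omega> < \<infinity> \<and> measure lebesgue \<Omega> = V \<and>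
          (\<forall>i. in_Lp (lebesgue_on \<Omega>) p (f i) \<and> (AE x in lebesgue_on \<Omega>. f i x \<ge> 0)) \<and>
          (\<forall>i. in_Lp (lebesgue_on \<Omega>) p (g i) \<and> Lp_norm (lebesgue_on \<Omega>) p (g i) = G i) \<and>
          (\<forall>W' \<in> disjoint_tuples \<Omega>. \<bar>F W'\<bar> \<le> B) \<and>
          is_minimizer \<Omega> f g F u W
          \<longrightarrow> (\<forall>i. in_Lp lebesgue \<infinity> (u i) \<and> Lp_norm lebesgue \<infinity> (u i) \<le> C)"
proof -
  define \<tau> where "\<tau> = (if p = \<infinity> then 0 else 1 / enn2real p)"
  have p: "p \<ge> 1"
  proof -
    have "1 \<le> p" if "CARD('n) \<ge> 2" "p > ennreal (real CARD('n) / 2)"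
    proof -
      have "ennreal 1 \<le> ennreal (real CARD('n) / 2)" using that(1) by (intro ennreal_leI) simp
      then have "1 \<le> ennreal (real CARD('n) / 2)" by (simp only: ennreal_1)
      then show ?thesis by (rule order_trans[OF _ less_imp_le[OF that(2)]])
    qed
    then show ?thesis using assms by auto
  qed
  have \<tau>: "\<tau> < 2 / CARD('n)"
    using assms
  proof
    assume "CARD('n) = 1 \<and> p = 1"
    then show ?thesis by (simp add: \<tau>_def)
  next
    assume a: "CARD('n) \<ge> 2 \<and> p > ennreal (real CARD('n) / 2)"
    show ?thesis
    proof (cases "p = \<infinity>")
      case False
      then obtain P where P: "p = ennreal P" "P \<ge> 0" by (cases p) auto
      have "real CARD('n) / 2 < P" using a P by (simp add: ennreal_less_iff)
      then show ?thesis using a P by (simp add: \<tau>_def field_simps)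
    qed (simp add: \<tau>_def)
  qed
  have sup0: "0 \<le> sup_bound n \<tau> V G'" for n G' by (simp add: sup_bound_def Let_def)
  define C where "C = (\<Sum>i\<in>UNIV. sup_bound CARD('n) \<tau> V (G i))"
  show ?thesis
  proof (intro exI[of _ C] allI impI)
    fix \<Omega> :: "(real ^ 'n) set" and f g :: "'m \<Rightarrow> real ^ 'n \<Rightarrow> real"
      and F :: "('m \<Rightarrow> (real ^ 'n) set) \<Rightarrow> real" and u :: "'m \<Rightarrow> real ^ 'n \<Rightarrow> real"
      and W :: "'m \<Rightarrow> (real ^ 'n) set" and i :: 'm
    assume H: "\<Omega> \<in> sets borel \<and> emeasure lebesgue \<Omega> < \<infinity> \<and> measure lebesgue \<Omega> = V \<and>
          (\<forall>i. in_Lp (lebesgue_on \<Omega>) p (f i) \<and> (AE x in lebesgue_on \<Omega>. f i x \<ge> 0)) \<and>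
          (\<forall>i. in_Lp (lebesgue_on \<Omega>) p (g i) \<and> Lp_norm (lebesgue_on \<Omega>) p (g i) = G i) \<and>
          (\<forall>W' \<in> disjoint_tuples \<Omega>. \<bar>F W'\<bar> \<le> B) \<and>
          is_minimizer \<Omega> f g F u W"
    have min: "component_minimizer \<Omega> (W i) (f i) (g i) (u i)"
      using H minimizer_imp_component_minimizer by blast
    have W: "W i \<in> sets borel" "W i \<subseteq> \<Omega>"
      using H by (auto simp: is_minimizer_def admissible_def disjoint_tuples_def)
    have f: "f i \<in> borel_measurable (lebesgue_on \<Omega>)" "AE x in lebesgue_on \<Omega>. f i x \<ge> 0"
      using H by (auto simp: in_Lp_def)
    have g: "in_Lp (lebesgue_on \<Omega>) p (g i)" "in_Lp (lebesgue_on \<Omega>) p (\<lambda>x. - g i x)"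
      "Lp_norm (lebesgue_on \<Omega>) p (g i) = G i" "Lp_norm (lebesgue_on \<Omega>) p (\<lambda>x. - g i x) = G i"
      using H by (auto simp: in_Lp_def Lp_norm_def)
    have le: "sup_bound CARD('n) \<tau> V (G i) \<le> C"
      unfolding C_def by (rule member_le_sum) (auto simp: sup0)
    have "AE x in lebesgue. u i x \<le> sup_bound CARD('n) \<tau> V (G i)"
      using component_minimizer_upper_bound[OF min _ _ _ W f g(1) p \<tau>_def \<tau>] H g(3) by auto
    moreover have "AE x in lebesgue. - u i x \<le> sup_bound CARD('n) \<tau> V (G i)"
      using component_minimizer_upper_bound[OF component_minimizer_uminus[OF min] _ _ _ W f g(2) p \<tau>_def \<tau>] H g(4) by auto
    ultimately have bd: "AE x in lebesgue. ennreal \<bar>u i x\<bar> \<le> ennreal C"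
      by eventually_elim (use le in \<open>auto intro!: ennreal_leI\<close>)
    have um: "u i \<in> borel_measurable lebesgue"
      using min borel_measurable_lebesgue_if_local by (auto simp: component_minimizer_def W12_def)
    have "esssup lebesgue (\<lambda>x. ennreal \<bar>u i x\<bar>) \<le> ennreal C"
      using um bd by (intro esssup_I) auto
    moreover have "C \<ge> 0" unfolding C_def by (intro sum_nonneg sup0)
    ultimately show "in_Lp lebesgue \<infinity> (u i) \<and> Lp_norm lebesgue \<infinity> (u i) \<le> C"
      using um by (auto simp: in_Lp_def Lp_norm_def intro: enn2real_leI le_less_trans)
  qed
qed

end
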